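(* Fix an interval $J\subseteq\mathbb R$, $t_0\in J$, $y\in V$, and let $(X,\mathbb X^2)$ be a rough path on $J$, i.e. $X\in\mathcal C^\gamma(J,V)$, $\mathbb X^2\in\Omega\mathcal C^{2\gamma}(J,V\otimes V)$ and $N\mathbb X^{2,\mu\nu}_{sut}=\delta X^\mu_{su}\,\delta X^\nu_{ut}$ for all $s,u,t\in J$. If $\gamma>1/3$ and $\varphi\in C^{2,\delta}(V,V\otimes V^* )$ with $\delta\in(0,1)$ and $(2+\delta)\gamma>1$, there exists a unique path $Y\in\mathcal D_X^{\gamma,2\gamma}(J,V)$ which solves $dY^\mu_t=\varphi(Y_t)^\mu_\nu\,dX^\nu_t$, $Y_{t_0}=y$, in $J$ based on the couple $(X,\mathbb X^2)$, i.e. such that $$Y^\mu_t=y^\mu+\int_{t_0}^t\varphi(Y_u)^\mu_\nu\,dX^\nu_u\qquad\text{for every }t\in J,$$ the integral being the rough integral based on $(X,\mathbb X^2)$. Denote by $F(y,\varphi,X,\mathbb X^2)$ this solution (the Itô map). Moreover the Itô map $F(y,\varphi,X,\mathbb X^2)$ is Lipschitz continuous in the following sense. Let $Y=F(y,\varphi,X,\mathbb X^2)$ and $\widetilde Y=F(\widetilde y,\widetilde\varphi,\widetilde X,\widetilde{\mathbb X}^2)$, where $(X,\mathbb X^2)$ and $(\widetilde X,\widetilde{\mathbb X}^2)$ are two rough paths; then defining $$\epsilon_{Y,I}=\|Y'-\widetilde Y'\|_{\infty,I}+\|Y'-\widetilde Y'\|_{\gamma,I}+\|R_Y-R_{\widetilde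 Y}\|_{2\gamma,I}+\|\varphi-\widetilde\varphi\|_{2,\delta},$$ $$\rho_I=|Y_{t_0}-\widetilde Y_{t_0}|+\|X-\widetilde X\|_{\gamma,I}+\|\mathbb X^2-\widetilde{\mathbb X}^2\|_{2\gamma,I},$$ $$C_{X,I}=1+\|X\|_{\gamma,I}+\|\widetilde X\|_{\gamma,I}+\|\mathbb X^2\|_{2\gamma,I}+\|\widetilde{\mathbb X}^2\|_{2\gamma,I},\qquad C_{Y,I}=1+\|Y\|_{*,I}+\|\widetilde Y\|_{*,I},$$ there exists a constant $M$ depending only on $C_{X,J}$, $C_{Y,J}$, $\|\varphi\|_{2,\delta}$ and $\|\widetilde\varphi\|_{2,\delta}$ such that $$\epsilon_{Y,J}\le M\rho_J.$$
   Context: $V$ is a finite-dimensional vector space; repeated indices are summed; the exponent $\delta$ is not to be confused with the increment operator $\delta f_{st}:=f_t-f_s$. For an interval $I$: $\mathcal C^\gamma(I,U)$: bounded continuous $f:I\to U$ with $\|f\|_{\gamma,I}:=\sup_{s\ne t}|f_t-f_s|/|t-s|^\gamma<\infty$; $\|f\|_{\infty,I}:=\sup_I|f|$. $\Omega\mathcal C(I,U)$: bounded continuous $R:I^2\to U$ with $R_{tt}=0$; $\|R\|_{\gamma,I}:=\sup_{s\neq t}|R_{st}|/|t-s|^\gamma$; $\Omega\mathcal C^\gamma(I,U)$: those with $\|R\|_{\gamma,I}<\infty$. $(NR)_{sut}:=R_{st}-R_{ut}-R_{su}$. For a path $f$, $(fR)_{st}=f_sR_{st}$. $C^{2,\delta}(V,U)$: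 twice differentiable maps $\varphi:V\to U$ with $\delta$-Hölder second derivative, with norm $\|\varphi\|_{2,\delta}=\sup|\varphi|+\sup|\partial\varphi|+\sup|\partial^2\varphi|+\sup_{x\ne y}|\partial^2\varphi(x)-\partial^2\varphi(y)|/|x-y|^\delta$. For $\eta>\gamma$, $\mathcal D_X^{\gamma,\eta}(I,U)$ is the space of pairs $(Y,Y')$ (often denoted just $Y$) with $Y\in\mathcal C^\gamma(I,U)$, $Y'\in\mathcal C^{\eta-\gamma}(I,U\otimes V^* )$ and $\delta Y^\mu=Y'^{\,\mu}_\nu\,\delta X^\nu+R_Y^\mu$ with $R_Y\in\Omega\mathcal C^\eta(I,U)$; semi-norm $\|Y\|_{D(X,\gamma,\eta),I}:=\|Y'\|_{\infty,I}+\|Y'\|_{\eta-\gamma,I}+\|R_Y\|_{\eta,I}+\|Y\|_{\gamma,I}$. $\|Y\|_{*,I}$ denotes $\|Y\|_{D(X,\gamma,2\gamma),I}$; for $\widetilde Y$ the derivative, remainder and semi-norm are taken relative to $\widetilde X$: $\delta\widetilde Y=\widetilde Y'\,\delta\widetilde X+R_{\widetilde Y}$. Rough integral: if $W\in\mathcal D_X^{\gamma,\eta}(J,V\otimes V^* )$ with $\eta+\gamma>1$ and $\delta W^\mu_\nu=W'^{\,\mu}_{\kappa\nu}\,\delta X^\kappa+R^\mu_{W,\nu}$, then $\int_s^tW^\mu_{\nu,u}\,dX^\nu_u:=W^\mu_{\nu,s}\,\delta X^\nu_{st}+W'^{\,\mu}_{\kappa\nu,s}\,\mathbb X^{2,\kappa\nu}_{st}-Q^\mu_{st}$,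 where $Q$ is the unique element of $\Omega\mathcal C^{\eta+\gamma}(J,V)$ with $NQ^\mu=N(W^\mu_\nu\,\delta X^\nu+W'^{\,\mu}_{\kappa\nu}\,\mathbb X^{2,\kappa\nu})$. Here $W=\varphi(Y)\in\mathcal D_X^{\gamma,(1+\delta)\gamma}(J,V\otimes V^* )$ with $W'^{\,\mu}_{\kappa\nu}=\partial_\rho\varphi(Y)^\mu_\nu\,Y'^{\,\rho}_\kappa$. Solutions are fixed points $Y=G(Y)$ of the map $G(Y)_t=Y_{t_0}+\int_{t_0}^t\varphi(Y_u)\,dX_u$ on $\mathcal D_X^{\gamma,2\gamma}$, where $G(Y)$ carries the derivative $G(Y)'=\varphi(Y)$.
   Formalization: The interval J is assumed bounded (existence can fail on unbounded J), and the Lipschitz bound reads ε ≤ M(ρ + ‖φ−φ̃‖_{2,δ}), since ε ≤ Mρ fails for X = X̃ = 0, y = ỹ, φ ≠ φ̃; V is a nonzero Euclidean space. *)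

theory Defs
  imports "HOL-Analysis.Analysis"
begin

(* Conventions.  The space V is real ^ 'n; U \<otimes> V* is the space of linear maps
   (real ^ 'n) \<Rightarrow>\<^sub>L 'u, V \<otimes> V is real ^ 'n ^ 'n, and an element of U \<otimes> V* \<otimes> V* is a curried
   bilinear map whose first argument carries the first lower index.
   Paths are total functions on the reals of which only the values on I matter. *)

definition incr :: "(real \<Rightarrow> 'u::real_normed_vector) \<Rightarrow> real \<Rightarrow> real \<Rightarrow> 'u" where
  "incr f s t = f t - f s"

definition sup_norm :: "real set \<Rightarrow> (real \<Rightarrow> 'u::real_normed_vector) \<Rightarrow> real" where
  "sup_norm I f = (SUP t\<in>I. norm (f t))"

(* For s = t the quotient is x / 0 = 0, so including the diagonal does not change the
   supremum, except that it is 0 (rather than unspecified) when I is a single point. *)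
definition two_quot :: "real \<Rightarrow> (real \<Rightarrow> real \<Rightarrow> 'u::real_normed_vector) \<Rightarrow> real \<times> real \<Rightarrow> real" where
  "two_quot \<gamma> R = (\<lambda>(s, t). norm (R s t) / \<bar>t - s\<bar> powr \<gamma>)"

definition two_norm :: "real \<Rightarrow> real set \<Rightarrow> (real \<Rightarrow> real \<Rightarrow> 'u::real_normed_vector) \<Rightarrow> real" where
  "two_norm \<gamma> I R = (SUP p\<in>I \<times> I. two_quot \<gamma> R p)"

definition holder_norm :: "real \<Rightarrow> real set \<Rightarrow> (real \<Rightarrow> 'u::real_normed_vector) \<Rightarrow> real" where
  "holder_norm \<gamma> I f = two_norm \<gamma> I (incr f)"

definition holder_space :: "real \<Rightarrow> real set \<Rightarrow> (real \<Rightarrow> 'u::real_normed_vector) set" where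
  "holder_space \<gamma> I = {f. continuous_on I f \<and> bounded (f ` I) \<and>
     bdd_above (two_quot \<gamma> (incr f) ` (I \<times> I))}"

definition Omega_space :: "real \<Rightarrow> real set \<Rightarrow> (real \<Rightarrow> real \<Rightarrow> 'u::real_normed_vector) set" where
  "Omega_space \<gamma> I = {R. continuous_on (I \<times> I) (\<lambda>(s, t). R s t) \<and>
     bounded ((\<lambda>(s, t). R s t) ` (I \<times> I)) \<and> (\<forall>t\<in>I. R t t = 0) \<and>
     bdd_above (two_quot \<gamma> R ` (I \<times> I))}"

definition N_op :: "(real \<Rightarrow> real \<Rightarrow> 'u::real_normed_vector) \<Rightarrow> real \<Rightarrow> real \<Rightarrow> real \<Rightarrow> 'u" where
  "N_op R s u t = R s t - R u t - R s u"

definition rough_path ::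
    "real \<Rightarrow> real set \<Rightarrow> (real \<Rightarrow> real ^ 'n) \<Rightarrow> (real \<Rightarrow> real \<Rightarrow> real ^ 'n ^ 'n) \<Rightarrow> bool" where
  "rough_path \<gamma> J X XX \<longleftrightarrow> X \<in> holder_space \<gamma> J \<and> XX \<in> Omega_space (2 * \<gamma>) J \<and>
     (\<forall>s\<in>J. \<forall>u\<in>J. \<forall>t\<in>J. \<forall>\<mu> \<nu>. N_op XX s u t $ \<mu> $ \<nu> = incr X s u $ \<mu> * incr X u t $ \<nu>)"

definition fderiv :: "('a::real_normed_vector \<Rightarrow> 'b::real_normed_vector) \<Rightarrow> 'a \<Rightarrow> 'a \<Rightarrow>\<^sub>L 'b" where
  "fderiv f x = Blinfun (frechet_derivative f (at x))"

definition space_quot :: "real \<Rightarrow> ('a::real_normed_vector \<Rightarrow> 'b::real_normed_vector) \<Rightarrow> 'a \<times> 'a \<Rightarrow> real" where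
  "space_quot \<delta> f = (\<lambda>(x, y). norm (f x - f y) / norm (x - y) powr \<delta>)"

definition C2_space :: "real \<Rightarrow> ('a::real_normed_vector \<Rightarrow> 'b::real_normed_vector) set" where
  "C2_space \<delta> = {\<phi>. (\<forall>x. \<phi> differentiable (at x)) \<and> (\<forall>x. fderiv \<phi> differentiable (at x)) \<and>
     bounded (range \<phi>) \<and> bounded (range (fderiv \<phi>)) \<and> bounded (range (fderiv (fderiv \<phi>))) \<and>
     bdd_above (range (space_quot \<delta> (fderiv (fderiv \<phi>))))}"

definition C2_norm :: "real \<Rightarrow> ('a::real_normed_vector \<Rightarrow> 'b::real_normed_vector) \<Rightarrow> real" where
  "C2_norm \<delta> \<phi> = (SUP x. norm (\<phi> x)) + (SUP x. norm (fderiv \<phi> x)) +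
     (SUP x. norm (fderiv (fderiv \<phi>) x)) + (SUP p. space_quot \<delta> (fderiv (fderiv \<phi>)) p)"

definition remainder :: "(real \<Rightarrow> real ^ 'n) \<Rightarrow> (real \<Rightarrow> 'u::real_normed_vector) \<Rightarrow>
    (real \<Rightarrow> (real ^ 'n) \<Rightarrow>\<^sub>L 'u) \<Rightarrow> real \<Rightarrow> real \<Rightarrow> 'u" where
  "remainder X Y Y' s t = incr Y s t - blinfun_apply (Y' s) (incr X s t)"

definition controlled :: "real \<Rightarrow> real \<Rightarrow> real set \<Rightarrow> (real \<Rightarrow> real ^ 'n) \<Rightarrow>
    (real \<Rightarrow> 'u::real_normed_vector) \<Rightarrow> (real \<Rightarrow> (real ^ 'n) \<Rightarrow>\<^sub>L 'u) \<Rightarrow> bool" where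
  "controlled \<gamma> \<eta> I X Y Y' \<longleftrightarrow> Y \<in> holder_space \<gamma> I \<and> Y' \<in> holder_space (\<eta> - \<gamma>) I \<and>
     remainder X Y Y' \<in> Omega_space \<eta> I"

definition controlled_norm :: "real \<Rightarrow> real \<Rightarrow> real set \<Rightarrow> (real \<Rightarrow> real ^ 'n) \<Rightarrow>
    (real \<Rightarrow> 'u::real_normed_vector) \<Rightarrow> (real \<Rightarrow> (real ^ 'n) \<Rightarrow>\<^sub>L 'u) \<Rightarrow> real" where
  "controlled_norm \<gamma> \<eta> I X Y Y' = sup_norm I Y' + holder_norm (\<eta> - \<gamma>) I Y' +
     two_norm \<eta> I (remainder X Y Y') + holder_norm \<gamma> I Y"

definition contract2 :: "((real ^ 'n) \<Rightarrow>\<^sub>L (real ^ 'n) \<Rightarrow>\<^sub>L 'u) \<Rightarrow> real ^ 'n ^ 'n \<Rightarrow> 'u::real_normed_vector" where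
  "contract2 B M = (\<Sum>\<kappa>\<in>UNIV. \<Sum>\<nu>\<in>UNIV.
     (M $ \<kappa> $ \<nu>) *\<^sub>R blinfun_apply (blinfun_apply B (axis \<kappa> 1)) (axis \<nu> 1))"

definition germ :: "(real \<Rightarrow> real ^ 'n) \<Rightarrow> (real \<Rightarrow> real \<Rightarrow> real ^ 'n ^ 'n) \<Rightarrow>
    (real \<Rightarrow> (real ^ 'n) \<Rightarrow>\<^sub>L (real ^ 'n)) \<Rightarrow> (real \<Rightarrow> (real ^ 'n) \<Rightarrow>\<^sub>L (real ^ 'n) \<Rightarrow>\<^sub>L (real ^ 'n)) \<Rightarrow>
    real \<Rightarrow> real \<Rightarrow> real ^ 'n" where
  "germ X XX W W' s t = blinfun_apply (W s) (incr X s t) + contract2 (W' s) (XX s t)"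

(* The vanishing condition off J \<times> J makes the correction unique as a total function. *)
definition rough_correction where
  "rough_correction \<gamma> \<eta> J X XX W W' = (THE Q. Q \<in> Omega_space (\<eta> + \<gamma>) J \<and>
     (\<forall>s\<in>J. \<forall>u\<in>J. \<forall>t\<in>J. N_op Q s u t = N_op (germ X XX W W') s u t) \<and>
     (\<forall>s t. (s, t) \<notin> J \<times> J \<longrightarrow> Q s t = 0))"

definition rough_integral where
  "rough_integral \<gamma> \<eta> J X XX W W' s t =
     germ X XX W W' s t - rough_correction \<gamma> \<eta> J X XX W W' s t"

(* A solution is a pair (Y, Y').  The derivative is part of the fixed point equation: it is
   not determined by Y when X is degenerate, and the rough integral depends on it. *)
definition rde_solution :: "real \<Rightarrow> real \<Rightarrow> real set \<Rightarrow> real \<Rightarrow> real ^ 'n \<Rightarrow>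
    (real ^ 'n \<Rightarrow> (real ^ 'n) \<Rightarrow>\<^sub>L (real ^ 'n)) \<Rightarrow> (real \<Rightarrow> real ^ 'n) \<Rightarrow> (real \<Rightarrow> real \<Rightarrow> real ^ 'n ^ 'n) \<Rightarrow>
    (real \<Rightarrow> real ^ 'n) \<times> (real \<Rightarrow> (real ^ 'n) \<Rightarrow>\<^sub>L (real ^ 'n)) \<Rightarrow> bool" where
  "rde_solution \<gamma> \<delta> J t0 y \<phi> X XX = (\<lambda>(Y, Y').
     controlled \<gamma> (2 * \<gamma>) J X Y Y' \<and>
     (\<forall>t\<in>J. Y' t = \<phi> (Y t)) \<and>
     (\<forall>t\<in>J. Y t = y + rough_integral \<gamma> ((1 + \<delta>) * \<gamma>) J X XX
        (\<lambda>u. \<phi> (Y u)) (\<lambda>u. fderiv \<phi> (Y u) o\<^sub>L Y' u) t0 t))"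

(* The solution is unique on J only, so its values off J are arbitrary. *)
definition ito_map where
  "ito_map \<gamma> \<delta> J t0 y \<phi> X XX = (SOME S. rde_solution \<gamma> \<delta> J t0 y \<phi> X XX S)"

(* A suffix t marks the data decorated with a tilde.  The distance of the vector fields is part
   of eps_Y but not of rho; an upper bound of eps_Y in terms of rho must therefore add it. *)
definition eps_Y where
  "eps_Y \<gamma> \<delta> I \<phi> \<phi>t X Xt Y Y' Yt Yt' =
     sup_norm I (\<lambda>t. Y' t - Yt' t) + holder_norm \<gamma> I (\<lambda>t. Y' t - Yt' t) +
     two_norm (2 * \<gamma>) I (\<lambda>s t. remainder X Y Y' s t - remainder Xt Yt Yt' s t) +
     C2_norm \<delta> (\<lambda>x. \<phi> x - \<phi>t x)"

definition rho where
  "rho \<gamma> I t0 X XX Xt XXt Y Yt = norm (Y t0 - Yt t0) + holder_norm \<gamma> I (\<lambda>t. X t - Xt t) +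
     two_norm (2 * \<gamma>) I (\<lambda>s t. XX s t - XXt s t)"

definition C_X where
  "C_X \<gamma> I X XX Xt XXt = 1 + holder_norm \<gamma> I X + holder_norm \<gamma> I Xt +
     two_norm (2 * \<gamma>) I XX + two_norm (2 * \<gamma>) I XXt"

definition C_Y where
  "C_Y \<gamma> I X Xt Y Y' Yt Yt' =
     1 + controlled_norm \<gamma> (2 * \<gamma>) I X Y Y' + controlled_norm \<gamma> (2 * \<gamma>) I Xt Yt Yt'"

end

theory Submission
  imports Defs
begin

text \<open>
  Write \<open>\<Xi>(y; s, t) = \<phi>(y) X_st + (D\<phi>(y) \<circ> \<phi>(y)) : XX_st\<close> for one step of the Milstein scheme, and
  \<open>z = (2 + \<delta>) \<gamma> > 1\<close>. A path with \<open>Y' = \<phi>(Y)\<close> solves the rough equation if and only if it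
  agrees with single steps up to a superlinear error, as in Davie's approach: the error
  \<open>Q_st = \<Xi>(Y_s; s, t) - (Y_t - Y_s)\<close> is at most \<open>C |t - s|^z\<close>.

  Everything rests on one mechanism. Cutting \<open>[s, t]\<close> at \<open>u\<close> gives \<open>Q_st = Q_su + Q_ut + N_sut\<close> with
  the defect \<open>N_sut = \<Xi>(Y_s; s, t) - \<Xi>(Y_u; u, t) - \<Xi>(Y_s; s, u)\<close>, which by Chen's relation is a sum of
  products of small increments, of order \<open>3\<gamma>\<close>. If \<open>|Q_st| \<le> p |t - s|^z\<close>, then cutting in the middle
  improves \<open>p\<close> to \<open>2^(1-z) p\<close> plus the constant of the defect. As \<open>2^(1-z) < 1\<close>, any finite constant,
  however bad, can be replaced by one that the defect alone determines
  (\<open>contraction_bootstrap\<close>). The mechanism is used three times.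

  \<^item> Existence. On a finite grid an explicit scheme has no error between neighbours, and the
    mechanism bounds its errors by a constant that does not depend on the grid. These bounds
    are closed conditions on finitely many values, so Tychonoff's theorem provides one path that
    satisfies all of them (\<open>sewing\<close>).

  \<^item> The rough integral. The same compactness argument, for a germ that ignores its state
    argument, constructs the correction in the rough integral, and the mechanism with defect
    zero shows that it is unique. Hence the fixed point equation and the bound on \<open>Q\<close> are
    equivalent (\<open>davie_imp_rde_solution\<close>, \<open>rde_solution_imp_davie\<close>).

  \<^item> Lipschitz dependence. For two solutions, the increments of \<open>Y - Y~\<close> and the difference of the
    two errors improve together on short intervals (\<open>regular_step\<close>). This needs a
    bound on the difference of the defects that is linear in \<open>Y - Y~\<close>, although \<open>D\<^sup>2\<phi>\<close> is only
    \<open>\<delta>\<close>-Hoelder. Differentiating along the segment between the two configurations keeps the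
    linearity and loses regularity in time instead, which leaves the exponent
    \<open>z\<close> (\<open>taylor1_difference_le\<close>). Finitely many short intervals cover \<open>J\<close>
    (\<open>ito_lipschitz\<close>). Equal data give uniqueness.
\<close>

section \<open>Bootstrapping and second-order calculus\<close>

text \<open>Iterating the improvement \<open>p \<mapsto> \<theta> p + k\<close> from the a priori constant \<open>p0\<close> converges to its fixed
  point \<open>k / (1 - \<theta>)\<close>, whatever \<open>p0\<close> was. The predicate \<open>P p\<close> stands for a family of estimates
  with constant \<open>p\<close>, and \<open>x \<le> p * w\<close> for one of them.\<close>

lemma contraction_bootstrap:
  fixes P :: "real \<Rightarrow> bool"
  assumes "P p0" "0 \<le> p0"
    and step: "\<And>p. 0 \<le> p \<Longrightarrow> P p \<Longrightarrow> P (\<theta> * p + k)"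
    and "0 \<le> \<theta>" "\<theta> < 1" "0 \<le> k" "0 \<le> w"
    and bound: "\<And>p. 0 \<le> p \<Longrightarrow> P p \<Longrightarrow> x \<le> p * w"
  shows "x \<le> k / (1 - \<theta>) * w"
proof -
  have *: "\<exists>p\<ge>0. P p \<and> p \<le> \<theta> ^ n * p0 + k / (1 - \<theta>)" for n
  proof (induction n)
    case 0
    then show ?case using assms by (intro exI[of _ p0]) auto
  next
    case (Suc n)
    then obtain p where p: "0 \<le> p" "P p" "p \<le> \<theta> ^ n * p0 + k / (1 - \<theta>)" by blast
    have "\<theta> * p + k \<le> \<theta> * (\<theta> ^ n * p0 + k / (1 - \<theta>)) + k"
      using p assms by (intro add_right_mono mult_left_mono) auto
    also have "\<dots> = \<theta> ^ Suc n * p0 + k / (1 - \<theta>)"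
      using \<open>\<theta> < 1\<close> by (simp add: field_simps)
    finally show ?case using p assms by (intro exI[of _ "\<theta> * p + k"]) auto
  qed
  have "x \<le> (\<theta> ^ n * p0 + k / (1 - \<theta>)) * w" for n
    using *[of n] bound \<open>0 \<le> w\<close> by (meson mult_right_mono order_trans)
  moreover have "(\<lambda>n. (\<theta> ^ n * p0 + k / (1 - \<theta>)) * w) \<longlonglongrightarrow> (0 * p0 + k / (1 - \<theta>)) * w"
    using assms by (intro tendsto_intros LIMSEQ_power_zero) auto
  ultimately show ?thesis
    by (metis (no_types, lifting) LIMSEQ_le_const add_0 mult_zero_left)
qed

text \<open>One constant for all four parts of the \<open>C2_norm\<close>; it can be enlarged freely, so that two vector
  fields can share it.\<close>

definition C2_bound :: "real \<Rightarrow> real \<Rightarrow> ('a::real_normed_vector \<Rightarrow> 'b::real_normed_vector) \<Rightarrow> bool" where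
  "C2_bound \<delta> K f \<longleftrightarrow>
     (\<forall>x. (f has_derivative blinfun_apply (fderiv f x)) (at x)) \<and>
     (\<forall>x. (fderiv f has_derivative blinfun_apply (fderiv (fderiv f) x)) (at x)) \<and>
     (\<forall>x. norm (f x) \<le> K) \<and> (\<forall>x. norm (fderiv f x) \<le> K) \<and> (\<forall>x. norm (fderiv (fderiv f) x) \<le> K) \<and>
     (\<forall>x y. norm (fderiv (fderiv f) x - fderiv (fderiv f) y) \<le> K * norm (x - y) powr \<delta>)"

lemma C2_boundD:
  assumes "C2_bound \<delta> K f"
  shows "(f has_derivative blinfun_apply (fderiv f x)) (at x)"
    "(fderiv f has_derivative blinfun_apply (fderiv (fderiv f) x)) (at x)"
    "norm (f x) \<le> K" "norm (fderiv f x) \<le> K" "norm (fderiv (fderiv f) x) \<le> K"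
    "norm (fderiv (fderiv f) x - fderiv (fderiv f) y) \<le> K * norm (x - y) powr \<delta>"
  using assms by (auto simp: C2_bound_def)

lemma blinfun_derivative_linearization:
  fixes f :: "'a::real_normed_vector \<Rightarrow> 'b::real_normed_vector"
  assumes "convex S" "a \<in> S" "b \<in> S" "c \<in> S"
    and "\<And>x. x \<in> S \<Longrightarrow> (f has_derivative blinfun_apply (Df x)) (at x)"
    and B: "\<And>x. x \<in> S \<Longrightarrow> norm (Df x - Df c) \<le> B"
  shows "norm (f b - f a - Df c (b - a)) \<le> B * norm (b - a)"
proof -
  have "norm (f b - f a - Df c (b - a)) \<le> norm (b - a) * B"
  proof (rule differentiable_bound_linearization[where S = S and f' = "\<lambda>x. blinfun_apply (Df x)"])
    fix t :: real assume "t \<in> {0..1}"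
    then have "(1 - t) *\<^sub>R a + t *\<^sub>R b \<in> S"
      using assms(1-3) by (intro convexD) auto
    then show "a + t *\<^sub>R (b - a) \<in> S" by (simp add: algebra_simps)
  next
    fix x assume "x \<in> S"
    have "(\<lambda>v. Df x v - Df c v) = blinfun_apply (Df x - Df c)"
      by (auto simp: blinfun.bilinear_simps)
    then show "onorm (blinfun_apply (Df x) - blinfun_apply (Df c)) \<le> B"
      using B[OF \<open>x \<in> S\<close>] by (simp add: fun_diff_def norm_blinfun.rep_eq)
  qed (use assms in \<open>auto intro: has_derivative_at_withinI\<close>)
  then show ?thesis by (simp add: mult.commute)
qed

lemma blinfun_derivative_lipschitz:
  fixes f :: "'a::real_normed_vector \<Rightarrow> 'b::real_normed_vector"
  assumes "\<And>x. (f has_derivative blinfun_apply (Df x)) (at x)" "\<And>x. norm (Df x) \<le> K"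
  shows "norm (f b - f a) \<le> K * norm (b - a)"
  using differentiable_bound[of UNIV f "\<lambda>x. blinfun_apply (Df x)" K b a] assms
  by (auto simp: norm_blinfun.rep_eq)

lemma unit_interval_derivative_bound:
  fixes g :: "real \<Rightarrow> 'b::real_normed_vector"
  assumes "\<And>r. (g has_vector_derivative g' r) (at r)" "\<And>r. 0 \<le> r \<Longrightarrow> r \<le> 1 \<Longrightarrow> norm (g' r) \<le> B"
  shows "norm (g 1 - g 0) \<le> B"
proof -
  have "norm (g 1 - g 0) \<le> B * norm (1 - 0 :: real)"
  proof (rule differentiable_bound[where S = "{0..1}" and f' = "\<lambda>r h. h *\<^sub>R g' r"])
    fix r :: real assume r: "r \<in> {0..1}"
    show "(g has_derivative (\<lambda>h. h *\<^sub>R g' r)) (at r within {0..1})"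
      using assms(1)[of r] by (auto simp: has_vector_derivative_def intro: has_derivative_at_withinI)
    show "onorm (\<lambda>h. h *\<^sub>R g' r) \<le> B"
      using assms(2)[of r] r by (intro onorm_le) (simp add: mult.commute[of B] mult_left_mono)
  qed auto
  then show ?thesis by simp
qed

text \<open>The second difference \<open>f (x + u + v) - f (x + u) - f (x + v) + f x\<close> is symmetric in \<open>u\<close> and \<open>v\<close>,
  and it differs from \<open>D\<^sup>2f(x) u v\<close> by a term of degree \<open>2 + \<delta>\<close>. Scaling \<open>u\<close> and \<open>v\<close> down removes
  that term.\<close>

lemma second_derivative_symmetric:
  fixes f :: "'a::real_normed_vector \<Rightarrow> 'b::real_normed_vector"
  assumes f: "C2_bound \<delta> K f" and "0 < \<delta>"
  shows "fderiv (fderiv f) x u v = fderiv (fderiv f) x v u"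
proof -
  note D = C2_boundD[OF f]
  define S where "S u v = f (x + u + v) - f (x + u) - f (x + v) + f x" for u v
  have "0 \<le> K" using norm_ge_zero[of "f x"] D(3)[of x] by linarith
  have key: "norm (S u v - fderiv (fderiv f) x u v)
      \<le> K * (norm u + norm v) powr \<delta> * norm u * norm v" for u v
  proof -
    define g where "g w = f (x + u + w) - f (x + w) - fderiv (fderiv f) x u w" for w
    have "norm (g v - g 0) \<le> (K * (norm u + norm v) powr \<delta> * norm u) * norm (v - 0)"
    proof (rule differentiable_bound[where S = "cball 0 (norm v)" and
          f' = "\<lambda>w. blinfun_apply (fderiv f (x + u + w) - fderiv f (x + w) - fderiv (fderiv f) x u)"])
      fix w :: 'a assume w: "w \<in> cball 0 (norm v)"
      have 1: "((\<lambda>w. f (x + u + w)) has_derivative blinfun_apply (fderiv f (x + u + w))) (at w)"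
        by (rule has_derivative_compose[where f = "\<lambda>w::'a. x + u + w", OF _ D(1)]) (auto intro!: derivative_eq_intros)
      have 2: "((\<lambda>w. f (x + w)) has_derivative blinfun_apply (fderiv f (x + w))) (at w)"
        by (rule has_derivative_compose[where f = "\<lambda>w::'a. x + w", OF _ D(1)]) (auto intro!: derivative_eq_intros)
      show "(g has_derivative blinfun_apply (fderiv f (x + u + w) - fderiv f (x + w) -
          fderiv (fderiv f) x u)) (at w within cball 0 (norm v))"
        unfolding g_def
        by (rule has_derivative_at_withinI)
          (auto intro!: derivative_eq_intros 1 2 bounded_linear.has_derivative[OF blinfun.bounded_linear_right]
            simp: blinfun.bilinear_simps)
      have "norm (fderiv f (x + u + w) - fderiv f (x + w)
          - fderiv (fderiv f) x ((x + u + w) - (x + w)))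
          \<le> (K * (norm u + norm v) powr \<delta>) * norm ((x + u + w) - (x + w))"
      proof (rule blinfun_derivative_linearization[where S = "cball x (norm u + norm v)"])
        fix y assume y: "y \<in> cball x (norm u + norm v)"
        have "norm (fderiv (fderiv f) y - fderiv (fderiv f) x) \<le> K * norm (y - x) powr \<delta>" by (rule D)
        also have "\<dots> \<le> K * (norm u + norm v) powr \<delta>"
          using y \<open>0 \<le> K\<close> \<open>0 < \<delta>\<close>
          by (intro mult_left_mono powr_mono2) (auto simp: dist_norm norm_minus_commute)
        finally show "norm (fderiv (fderiv f) y - fderiv (fderiv f) x) \<le> K * (norm u + norm v) powr \<delta>" .
      next
        have "norm (u + w) \<le> norm u + norm v"
          using w norm_triangle_ineq[of u w] by auto
        then have "norm (- (u + w)) \<le> norm u + norm v" by (simp only: norm_minus_cancel)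
        then show "x + u + w \<in> cball x (norm u + norm v)"
          by (simp add: dist_norm)
        show "x + w \<in> cball x (norm u + norm v)"
          using w by (auto simp: dist_norm add_increasing)
      qed (use D in auto)
      then show "onorm (blinfun_apply (fderiv f (x + u + w) - fderiv f (x + w) -
          fderiv (fderiv f) x u)) \<le> K * (norm u + norm v) powr \<delta> * norm u"
        by (simp add: norm_blinfun.rep_eq)
    qed auto
    moreover have "g v - g 0 = S u v - fderiv (fderiv f) x u v"
      by (simp add: g_def S_def blinfun.bilinear_simps algebra_simps)
    ultimately show ?thesis by simp
  qed
  define c where "c = fderiv (fderiv f) x u v - fderiv (fderiv f) x v u"
  define B where "B = 2 * K * (norm u + norm v) powr \<delta> * norm u * norm v"
  have "norm c \<le> \<tau> powr \<delta> * B" if "\<tau> > 0" for \<tau>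
  proof -
    have S: "S (\<tau> *\<^sub>R u) (\<tau> *\<^sub>R v) = S (\<tau> *\<^sub>R v) (\<tau> *\<^sub>R u)"
      by (simp add: S_def algebra_simps)
    have pw: "(\<tau> * norm u + \<tau> * norm v) powr \<delta> = \<tau> powr \<delta> * (norm u + norm v) powr \<delta>"
      using that by (simp add: powr_mult flip: distrib_left)
    have pw': "(\<tau> * norm v + \<tau> * norm u) powr \<delta> = \<tau> powr \<delta> * (norm u + norm v) powr \<delta>"
      using pw by (simp add: add.commute)
    have "\<tau>\<^sup>2 *\<^sub>R c = (S (\<tau> *\<^sub>R v) (\<tau> *\<^sub>R u) - fderiv (fderiv f) x (\<tau> *\<^sub>R v) (\<tau> *\<^sub>R u))
        - (S (\<tau> *\<^sub>R u) (\<tau> *\<^sub>R v) - fderiv (fderiv f) x (\<tau> *\<^sub>R u) (\<tau> *\<^sub>R v))"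
      unfolding S by (simp add: c_def blinfun.bilinear_simps algebra_simps power2_eq_square)
    then have "norm (\<tau>\<^sup>2 *\<^sub>R c) \<le> norm (S (\<tau> *\<^sub>R v) (\<tau> *\<^sub>R u) - fderiv (fderiv f) x (\<tau> *\<^sub>R v) (\<tau> *\<^sub>R u))
        + norm (S (\<tau> *\<^sub>R u) (\<tau> *\<^sub>R v) - fderiv (fderiv f) x (\<tau> *\<^sub>R u) (\<tau> *\<^sub>R v))"
      by (metis norm_triangle_ineq4)
    also have "\<dots> \<le> \<tau>\<^sup>2 * (\<tau> powr \<delta> * B)"
      using key[of "\<tau> *\<^sub>R v" "\<tau> *\<^sub>R u"] key[of "\<tau> *\<^sub>R u" "\<tau> *\<^sub>R v"] that
      by (simp add: pw pw' B_def power2_eq_square algebra_simps)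
    finally show ?thesis using that by simp
  qed
  moreover have "((\<lambda>\<tau>. \<tau> powr \<delta> * B) \<longlongrightarrow> 0 * B) (at_right 0)"
    using \<open>0 < \<delta>\<close> by (intro tendsto_intros tendsto_zero_powrI[of _ _ _ \<delta>])
      (auto simp: eventually_at_right_less intro: eventually_mono[OF eventually_at_right_less])
  ultimately have "norm c \<le> 0 * B"
    by (intro tendsto_lowerbound[of "\<lambda>\<tau>. \<tau> powr \<delta> * B" "0 * B" "at_right 0"])
      (auto intro: eventually_mono[OF eventually_at_right_less])
  then show ?thesis by (simp add: c_def)
qed

text \<open>Differentiate \<open>f b - f a\<close> along the segment from \<open>(a', b')\<close> to \<open>(a, b)\<close>. The bound is linear in
  the distance of the two configurations, and \<open>\<kappa>\<close> only has to control the derivative between the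
  two moving end points, which stay as close as they were.\<close>

lemma double_difference_bound:
  fixes f :: "'a::real_normed_vector \<Rightarrow> 'b::real_normed_vector"
  assumes f: "\<And>x. (f has_derivative blinfun_apply (Df x)) (at x)" and K: "\<And>x. norm (Df x) \<le> K"
    and \<kappa>: "\<And>r. 0 \<le> r \<Longrightarrow> r \<le> 1 \<Longrightarrow>
      norm (Df (b' + r *\<^sub>R (b - b')) - Df (a' + r *\<^sub>R (a - a'))) \<le> \<kappa>"
  shows "norm ((f b - f a) - (f b' - f a')) \<le> \<kappa> * norm (a - a') + K * norm ((b - a) - (b' - a'))"
proof -
  let ?a = "\<lambda>r. a' + r *\<^sub>R (a - a')" and ?b = "\<lambda>r. b' + r *\<^sub>R (b - b')"
  have d: "((\<lambda>r. f (x + r *\<^sub>R v)) has_vector_derivative Df (x + r *\<^sub>R v) v) (at r)" for x v r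
  proof -
    have "((\<lambda>r. x + r *\<^sub>R v) has_derivative (\<lambda>h. h *\<^sub>R v)) (at r)"
      by (auto intro!: derivative_eq_intros)
    from has_derivative_compose[OF this f]
    show ?thesis by (simp add: has_vector_derivative_def blinfun.bilinear_simps)
  qed
  have "norm ((f (?b 1) - f (?a 1)) - (f (?b 0) - f (?a 0)))
      \<le> \<kappa> * norm (a - a') + K * norm ((b - a) - (b' - a'))"
  proof (rule unit_interval_derivative_bound)
    show "((\<lambda>r. f (?b r) - f (?a r)) has_vector_derivative
        Df (?b r) (b - b') - Df (?a r) (a - a')) (at r)" for r
      by (intro derivative_intros d)
  next
    fix r :: real assume r: "0 \<le> r" "r \<le> 1"
    have "Df (?b r) (b - b') - Df (?a r) (a - a')
        = (Df (?b r) - Df (?a r)) (a - a') + Df (?b r) ((b - a) - (b' - a'))"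
      by (simp add: blinfun.bilinear_simps algebra_simps)
    also have "norm \<dots> \<le> norm (Df (?b r) - Df (?a r)) * norm (a - a')
        + norm (Df (?b r)) * norm ((b - a) - (b' - a'))"
      by (intro norm_triangle_mono norm_blinfun)
    also have "\<dots> \<le> \<kappa> * norm (a - a') + K * norm ((b - a) - (b' - a'))"
      by (intro add_mono mult_right_mono K \<kappa> r) auto
    finally show "norm (Df (?b r) (b - b') - Df (?a r) (a - a'))
      \<le> \<kappa> * norm (a - a') + K * norm ((b - a) - (b' - a'))" .
  qed
  then show ?thesis by simp
qed

lemma interpolated_increment_bound:
  fixes a b a' b' :: "'a::real_normed_vector"
  assumes "0 \<le> r" "r \<le> 1" "norm (b - a) \<le> m" "norm (b' - a') \<le> m"
  shows "norm ((b' + r *\<^sub>R (b - b')) - (a' + r *\<^sub>R (a - a'))) \<le> m"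
proof -
  have "(b' + r *\<^sub>R (b - b')) - (a' + r *\<^sub>R (a - a')) = (1 - r) *\<^sub>R (b' - a') + r *\<^sub>R (b - a)"
    by (simp add: algebra_simps)
  also have "norm \<dots> \<le> (1 - r) * norm (b' - a') + r * norm (b - a)"
    using norm_triangle_ineq[of "(1 - r) *\<^sub>R (b' - a')" "r *\<^sub>R (b - a)"] assms by simp
  also have "\<dots> \<le> (1 - r) * m + r * m"
    using assms by (intro add_mono mult_left_mono) auto
  finally show ?thesis by (simp add: algebra_simps)
qed

definition taylor1 :: "('a::real_normed_vector \<Rightarrow> 'b::real_normed_vector) \<Rightarrow> 'a \<Rightarrow> 'a \<Rightarrow> 'b" where
  "taylor1 f a b = f b - f a - fderiv f a (b - a)"

lemma taylor1_le:
  assumes f: "C2_bound \<delta> K f"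
  shows "norm (taylor1 f a b) \<le> K * norm (b - a) ^ 2"
proof -
  note D = C2_boundD[OF f]
  have "0 \<le> K" using norm_ge_zero[of "f a"] D(3)[of a] by linarith
  have "norm (f b - f a - fderiv f a (b - a)) \<le> (K * norm (b - a)) * norm (b - a)"
  proof (rule blinfun_derivative_linearization[where S = "cball a (norm (b - a))"])
    fix x assume x: "x \<in> cball a (norm (b - a))"
    have "norm (fderiv f x - fderiv f a) \<le> K * norm (x - a)"
      by (rule blinfun_derivative_lipschitz[OF D(2) D(5)])
    also have "\<dots> \<le> K * norm (b - a)"
      using x \<open>0 \<le> K\<close> by (intro mult_left_mono) (auto simp: dist_norm norm_minus_commute)
    finally show "norm (fderiv f x - fderiv f a) \<le> K * norm (b - a)" .
  qed (use D in \<open>auto simp: dist_norm norm_minus_commute\<close>)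
  then show ?thesis by (simp add: taylor1_def power2_eq_square mult.assoc)
qed

lemma taylor1_fderiv_le:
  assumes f: "C2_bound \<delta> K f" and "0 < \<delta>" "norm (b - a) \<le> m"
  shows "norm (taylor1 (fderiv f) a b) \<le> K * m powr \<delta> * m"
proof -
  note D = C2_boundD[OF f]
  have "0 \<le> K" using norm_ge_zero[of "f a"] D(3)[of a] by linarith
  have "0 \<le> m" using assms(3) norm_ge_zero[of "b - a"] by linarith
  have "norm (fderiv f b - fderiv f a - fderiv (fderiv f) a (b - a)) \<le> (K * m powr \<delta>) * norm (b - a)"
  proof (rule blinfun_derivative_linearization[where S = "cball a m"])
    fix x assume x: "x \<in> cball a m"
    have "norm (fderiv (fderiv f) x - fderiv (fderiv f) a) \<le> K * norm (x - a) powr \<delta>" by (rule D)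
    also have "\<dots> \<le> K * m powr \<delta>"
      using x \<open>0 \<le> K\<close> \<open>0 < \<delta>\<close>
      by (intro mult_left_mono powr_mono2) (auto simp: dist_norm norm_minus_commute)
    finally show "norm (fderiv (fderiv f) x - fderiv (fderiv f) a) \<le> K * m powr \<delta>" .
  qed (use D assms \<open>0 \<le> m\<close> in \<open>auto simp: dist_norm norm_minus_commute\<close>)
  also have "\<dots> \<le> (K * m powr \<delta>) * m"
    using assms \<open>0 \<le> K\<close> by (intro mult_left_mono) auto
  finally show ?thesis by (simp add: taylor1_def)
qed

text \<open>Linear in the distance of the two configurations, although the second derivative is only Hoelder
  continuous. Along the segment from \<open>(a', b')\<close> to \<open>(a, b)\<close> the derivative of the remainder
  contains \<open>D\<^sup>2f\<close> applied first to \<open>a - a'\<close> and then to the increment; exchanging the two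
  arguments turns the terms with \<open>a - a'\<close> into the Taylor remainder of \<open>Df\<close>, of order \<open>m^(1 + \<delta>)\<close>.\<close>

lemma taylor1_difference_le:
  assumes f: "C2_bound \<delta> K f" and "0 < \<delta>" and m: "norm (b - a) \<le> m" "norm (b' - a') \<le> m"
  shows "norm (taylor1 f a b - taylor1 f a' b')
    \<le> K * m powr \<delta> * m * norm (a - a') + K * m * norm ((b - a) - (b' - a'))"
proof -
  note D = C2_boundD[OF f]
  have "0 \<le> K" using norm_ge_zero[of "f a"] D(3)[of a] by linarith
  let ?a = "\<lambda>r. a' + r *\<^sub>R (a - a')" and ?b = "\<lambda>r. b' + r *\<^sub>R (b - b')"
  define g' where "g' r = fderiv f (?b r) (b - b') - fderiv f (?a r) (a - a')
    - (fderiv (fderiv f) (?a r) (a - a') (?b r - ?a r) + fderiv f (?a r) ((b - b') - (a - a')))" for r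
  have line: "((\<lambda>r. x + r *\<^sub>R v) has_derivative (\<lambda>h. h *\<^sub>R v)) (at r)" for x v :: 'a and r
    by (auto intro!: derivative_eq_intros)
  have d: "((\<lambda>r. f (x + r *\<^sub>R v)) has_derivative (\<lambda>h. fderiv f (x + r *\<^sub>R v) (h *\<^sub>R v))) (at r)" for x v r
    using has_derivative_compose[OF line D(1), of x v r] by simp
  have d2: "((\<lambda>r. fderiv f (x + r *\<^sub>R v)) has_derivative
      (\<lambda>h. fderiv (fderiv f) (x + r *\<^sub>R v) (h *\<^sub>R v))) (at r)" for x v r
    using has_derivative_compose[OF line D(2), of x v r] by simp
  have "norm (taylor1 f (?a 1) (?b 1) - taylor1 f (?a 0) (?b 0))
      \<le> K * m powr \<delta> * m * norm (a - a') + K * m * norm ((b - a) - (b' - a'))"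
  proof (rule unit_interval_derivative_bound)
    fix r
    have "((\<lambda>r. ?b r - ?a r) has_derivative (\<lambda>h. h *\<^sub>R (b - b') - h *\<^sub>R (a - a'))) (at r)"
      by (intro has_derivative_diff line)
    note blinfun.FDERIV[OF d2[of a' "a - a'" r] this]
    from has_derivative_diff[OF has_derivative_diff[OF d[of b' "b - b'"] d[of a' "a - a'"]] this]
    show "((\<lambda>r. taylor1 f (?a r) (?b r)) has_vector_derivative g' r) (at r)"
      unfolding taylor1_def has_vector_derivative_def g'_def
      by (simp add: blinfun.bilinear_simps algebra_simps)
  next
    fix r :: real assume r: "0 \<le> r" "r \<le> 1"
    have inc: "norm (?b r - ?a r) \<le> m" using r m by (rule interpolated_increment_bound)
    have "g' r = taylor1 (fderiv f) (?a r) (?b r) (a - a')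
        + (fderiv f (?b r) - fderiv f (?a r)) ((b - a) - (b' - a'))"
      unfolding g'_def taylor1_def
      by (simp add: second_derivative_symmetric[OF f \<open>0 < \<delta>\<close>, of _ "a - a'"])
        (simp add: blinfun.bilinear_simps algebra_simps)
    also have "norm \<dots> \<le> norm (taylor1 (fderiv f) (?a r) (?b r)) * norm (a - a')
        + norm (fderiv f (?b r) - fderiv f (?a r)) * norm ((b - a) - (b' - a'))"
      by (intro norm_triangle_mono norm_blinfun)
    also have "\<dots> \<le> K * m powr \<delta> * m * norm (a - a') + K * m * norm ((b - a) - (b' - a'))"
    proof (intro add_mono mult_right_mono)
      show "norm (taylor1 (fderiv f) (?a r) (?b r)) \<le> K * m powr \<delta> * m"
        by (rule taylor1_fderiv_le[OF f \<open>0 < \<delta>\<close> inc])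
      have "norm (fderiv f (?b r) - fderiv f (?a r)) \<le> K * norm (?b r - ?a r)"
        by (rule blinfun_derivative_lipschitz[OF D(2) D(5)])
      also have "\<dots> \<le> K * m" by (rule mult_left_mono[OF inc \<open>0 \<le> K\<close>])
      finally show "norm (fderiv f (?b r) - fderiv f (?a r)) \<le> K * m" .
    qed auto
    finally show "norm (g' r) \<le> K * m powr \<delta> * m * norm (a - a') + K * m * norm ((b - a) - (b' - a'))" .
  qed
  then show ?thesis by simp
qed

section \<open>Sewing of almost flows\<close>

text \<open>A germ \<open>A y s t\<close> proposes an increment over \<open>[s, t]\<close> for a path that starts at \<open>y\<close>. The last
  assumption compares one step with two: it must hold with a constant that grows only slowly (\<open>\<epsilon>\<close>)
  with the error \<open>p\<close> that the intermediate state \<open>b\<close> already carries. The smallness condition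
  counts one cut of a grid interval, which uses two halves and three defects. The times \<open>s, u, t\<close>
  need not be ordered, so both directions of time are treated at once.\<close>

locale almost_flow =
  fixes J :: "real set" and A :: "'v::euclidean_space \<Rightarrow> real \<Rightarrow> real \<Rightarrow> 'v" and K \<epsilon> z h :: real
  assumes interval: "is_interval J" and bounded_time: "bounded J"
    and continuous_state: "\<And>s t. s \<in> J \<Longrightarrow> t \<in> J \<Longrightarrow> continuous_on UNIV (\<lambda>y. A y s t)"
    and diagonal: "\<And>y s. s \<in> J \<Longrightarrow> A y s s = 0"
    and bounded_increment: "\<exists>B. \<forall>y. \<forall>s\<in>J. \<forall>t\<in>J. norm (A y s t) \<le> B"
    and K: "0 \<le> K" and \<epsilon>: "0 \<le> \<epsilon>" "2 powr (1 - z) + 3 * \<epsilon> < 1" and z: "1 < z" and h: "0 < h"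
    and defect: "\<And>a b s u t L p. \<lbrakk>s \<in> J; u \<in> J; t \<in> J; 0 \<le> p; \<bar>u - s\<bar> \<le> L; \<bar>t - u\<bar> \<le> L; L \<le> h;
      norm (A a s u - (b - a)) \<le> p * L powr z\<rbrakk>
      \<Longrightarrow> norm (A a s t - A b u t - A a s u) \<le> (K + \<epsilon> * p) * L powr z"
begin

definition error :: "(real \<Rightarrow> 'v) \<Rightarrow> real \<Rightarrow> real \<Rightarrow> 'v" where
  "error Y s t = A (Y s) s t - (Y t - Y s)"

definition error_const :: real where
  "error_const = 3 * K / (1 - (2 powr (1 - z) + 3 * \<epsilon>))"

lemma error_const_nonneg: "0 \<le> error_const"
  using K \<epsilon> by (simp add: error_const_def)

lemma error_split:
  "error Y s t = error Y s u + error Y u t + (A (Y s) s t - A (Y u) u t - A (Y s) s u)"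
  by (simp add: error_def)

text \<open>Build the grid outwards from \<open>t0\<close>: a point that is farthest from \<open>t0\<close> gets its value by one step
  from its neighbour towards \<open>t0\<close>. To the left of \<open>t0\<close> these steps run backwards in time, so the
  error vanishes in one of the two directions only.\<close>

lemma grid_scheme:
  assumes "finite F"
  obtains Y where "Y t0 = y"
    and "\<And>s t. \<lbrakk>s \<in> insert t0 F; t \<in> insert t0 F; s < t; insert t0 F \<inter> {s<..<t} = {}\<rbrakk>
      \<Longrightarrow> error Y s t = 0 \<or> error Y t s = 0"
proof -
  have "\<exists>Y. Y t0 = y \<and> (\<forall>s\<in>insert t0 F. \<forall>t\<in>insert t0 F.
      s < t \<longrightarrow> insert t0 F \<inter> {s<..<t} = {} \<longrightarrow> error Y s t = 0 \<or> error Y t s = 0)"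
    using assms
  proof (induction F rule: finite_ranking_induct[where f = "\<lambda>t. \<bar>t - t0\<bar>"])
    case empty
    then show ?case by auto
  next
    case (insert x S)
    define G where "G = insert t0 S"
    have G: "finite G" "G \<noteq> {}" "t0 \<in> G" using insert by (auto simp: G_def)
    from insert(3)[folded G_def] obtain Y where Y: "Y t0 = y"
      "\<And>s t. s \<in> G \<Longrightarrow> t \<in> G \<Longrightarrow> s < t \<Longrightarrow> G \<inter> {s<..<t} = {} \<Longrightarrow> error Y s t = 0 \<or> error Y t s = 0"
      by blast
    have far: "\<bar>y - t0\<bar> \<le> \<bar>x - t0\<bar>" if "y \<in> G" for y
      using that insert(2) by (auto simp: G_def)
    have eq: "insert t0 (insert x S) = insert x G" by (auto simp: G_def)
    show ?case
    proof (cases "x \<in> G")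
      case True
      then show ?thesis using Y unfolding eq by (auto simp: insert_absorb)
    next
      case False
      \<comment> \<open>The neighbour of the new point towards the base point.\<close>
      define p where "p = (if t0 < x then Max G else Min G)"
      define Y' where "Y' = Y(x := Y p + A (Y p) p x)"
      have p: "p \<in> G" using G by (simp add: p_def)
      have ne: "x \<noteq> t0" using False G by auto
      have px: "error Y' p x = 0"
        using p False by (auto simp: error_def Y'_def)
      have old: "error Y' s t = error Y s t" if "s \<in> G" "t \<in> G" for s t
        using that False by (auto simp: error_def Y'_def)
      have "error Y' s t = 0 \<or> error Y' t s = 0"
        if st: "s \<in> insert x G" "t \<in> insert x G" "s < t" "insert x G \<inter> {s<..<t} = {}" for s t
      proof (cases "s = x \<or> t = x")
        case False
        then show ?thesis using st Y(2)[of s t] old by auto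
      next
        case True
        show ?thesis
        proof (cases "t0 < x")
          case right: True
          have le: "y < x" if "y \<in> G" for y
            using far[OF that] that \<open>x \<notin> G\<close> right by (cases "y = x") auto
          then have "t = x" "s \<in> G" using True st by force+
          moreover have "s \<le> p" "p < x" using \<open>s \<in> G\<close> G le[OF p] right by (auto simp: p_def)
          ultimately have "s = p" using st p by force
          then show ?thesis using px \<open>t = x\<close> by simp
        next
          case left: False
          have le: "x < y" if "y \<in> G" for y
            using far[OF that] that \<open>x \<notin> G\<close> left ne by (cases "y = x") auto
          then have "s = x" "t \<in> G" using True st by force+
          moreover have "p \<le> t" "x < p" using \<open>t \<in> G\<close> G le[OF p] left by (auto simp: p_def)
          ultimately have "t = p" using st p by force
          then show ?thesis using px \<open>s = x\<close> by simp
        qed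
      qed
      moreover have "Y' t0 = y" using Y ne by (simp add: Y'_def)
      ultimately show ?thesis unfolding eq by (intro exI[of _ Y']) auto
    qed
  qed
  then show thesis using that by blast
qed

text \<open>A grid interval cannot be halved exactly. It is cut at the two neighbouring grid points around
  its midpoint instead; both outer parts have at most half its length, and the error over the gap
  is at most a single defect.\<close>

lemma grid_error_step:
  assumes F: "finite F" "F \<subseteq> J"
    and scheme: "\<And>s t. \<lbrakk>s \<in> F; t \<in> F; s < t; F \<inter> {s<..<t} = {}\<rbrakk> \<Longrightarrow> error Y s t = 0 \<or> error Y t s = 0"
    and "0 \<le> p"
    and IH: "\<And>s t. \<lbrakk>s \<in> F; t \<in> F; \<bar>t - s\<bar> \<le> h\<rbrakk> \<Longrightarrow> norm (error Y s t) \<le> p * \<bar>t - s\<bar> powr z"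
    and st: "s \<in> F" "t \<in> F" "\<bar>t - s\<bar> \<le> h"
  shows "norm (error Y s t) \<le> ((2 powr (1 - z) + 3 * \<epsilon>) * p + 3 * K) * \<bar>t - s\<bar> powr z"
proof (cases "s = t")
  case True
  then show ?thesis using st F diagonal by (auto simp: error_def)
next
  case False
  define L where "L = \<bar>t - s\<bar>"
  define e where "e = (K + \<epsilon> * p) * L powr z"
  have L: "0 < L" "L \<le> h" using False st by (auto simp: L_def)
  have def3: "norm (A (Y a) a c - A (Y b) b c - A (Y a) a b) \<le> e"
    if "a \<in> F" "b \<in> F" "c \<in> F" "\<bar>b - a\<bar> \<le> L" "\<bar>c - b\<bar> \<le> L" for a b c
    unfolding e_def
  proof (rule defect)
    have "norm (error Y a b) \<le> p * \<bar>b - a\<bar> powr z" using that L by (intro IH) auto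
    also have "\<dots> \<le> p * L powr z"
      using that z \<open>0 \<le> p\<close> by (intro mult_left_mono powr_mono2) auto
    finally show "norm (A (Y a) a b - (Y b - Y a)) \<le> p * L powr z" by (simp add: error_def)
  qed (use that F L \<open>0 \<le> p\<close> in auto)
  have half: "norm (error Y a b) \<le> p * (L / 2) powr z" if "a \<in> F" "b \<in> F" "\<bar>b - a\<bar> \<le> L / 2" for a b
  proof -
    have "norm (error Y a b) \<le> p * \<bar>b - a\<bar> powr z" using that L by (intro IH) auto
    also have "\<dots> \<le> p * (L / 2) powr z"
      using that z \<open>0 \<le> p\<close> by (intro mult_left_mono powr_mono2) auto
    finally show ?thesis .
  qed
  \<comment> \<open>Where the scheme runs from b to a, the error from a to b is the defect of the round trip
    from a to b and back.\<close>
  have adj: "norm (error Y a b) \<le> e"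
    if "a \<in> F" "b \<in> F" "\<bar>b - a\<bar> \<le> L" "error Y a b = 0 \<or> error Y b a = 0" for a b
  proof -
    have "norm (A (Y a) a a - A (Y b) b a - A (Y a) a b) \<le> e"
      by (rule def3) (use that in auto)
    moreover have "error Y a b = - (A (Y a) a a - A (Y b) b a - A (Y a) a b)" if "error Y b a = 0"
      using error_split[of Y a a b] that diagonal[of a "Y a"] F \<open>a \<in> F\<close>
      by (auto simp: error_def algebra_simps)
    ultimately show ?thesis using that
      by (metis norm_ge_zero norm_minus_cancel norm_zero order_trans)
  qed
  have via: "norm (error Y s t) \<le> 2 * (p * (L / 2) powr z) + 3 * e"
    if ab: "a \<in> F" "b \<in> F" "\<bar>a - s\<bar> \<le> L / 2" "\<bar>t - b\<bar> \<le> L / 2" "\<bar>b - a\<bar> \<le> L" "\<bar>t - a\<bar> \<le> L"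
      and "error Y a b = 0 \<or> error Y b a = 0" for a b
  proof -
    have "error Y s t = error Y s a + (error Y a b + error Y b t
        + (A (Y a) a t - A (Y b) b t - A (Y a) a b)) + (A (Y s) s t - A (Y a) a t - A (Y s) s a)"
      using error_split[of Y s t a] error_split[of Y a t b] by simp
    moreover have "norm \<dots> \<le> p * (L / 2) powr z + (e + p * (L / 2) powr z + e) + e"
    proof -
      have "\<bar>a - s\<bar> \<le> L" "\<bar>t - b\<bar> \<le> L" using ab L by linarith+
      then show ?thesis
        by (intro norm_triangle_mono half adj def3) (use that st in auto)
    qed
    ultimately show ?thesis by simp
  qed
  define lo hi where "lo = min s t" and "hi = max s t"
  have lh: "lo < hi" "hi - lo = L" "lo \<in> F" "hi \<in> F"
    using False st by (auto simp: lo_def hi_def L_def min_def max_def)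
  define m where "m = Max {x \<in> F. lo \<le> x \<and> x \<le> (lo + hi) / 2}"
  define m' where "m' = Min {x \<in> F. (lo + hi) / 2 < x \<and> x \<le> hi}"
  have "m \<in> {x \<in> F. lo \<le> x \<and> x \<le> (lo + hi) / 2}"
    unfolding m_def using F lh by (intro Max_in) (auto intro!: exI[of _ lo])
  moreover have "m' \<in> {x \<in> F. (lo + hi) / 2 < x \<and> x \<le> hi}"
    unfolding m'_def using F lh by (intro Min_in) (auto intro!: exI[of _ hi])
  ultimately have mm: "m \<in> F" "lo \<le> m" "m \<le> (lo + hi) / 2" "m' \<in> F" "(lo + hi) / 2 < m'" "m' \<le> hi"
    by auto
  have "False" if x: "x \<in> F" "m < x" "x < m'" for x
  proof (cases "x \<le> (lo + hi) / 2")
    case True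
    then have "x \<le> m" unfolding m_def using x mm F by (intro Max_ge) auto
    then show False using x by simp
  next
    case False
    then have "m' \<le> x" unfolding m'_def using x mm F by (intro Min_le) auto
    then show False using x by simp
  qed
  then have gap: "error Y m m' = 0 \<or> error Y m' m = 0"
    using mm by (intro scheme) auto
  have "norm (error Y s t) \<le> 2 * (p * (L / 2) powr z) + 3 * e"
  proof (cases "s < t")
    case True
    then have eqs: "lo = s" "hi = t" by (auto simp: lo_def hi_def)
    show ?thesis
      by (rule via[of m m']) (use mm lh gap in \<open>auto simp: eqs abs_if field_simps\<close>)
  next
    case False
    then have eqs: "lo = t" "hi = s" by (auto simp: lo_def hi_def)
    show ?thesis
      by (rule via[of m' m]) (use mm lh gap in \<open>auto simp: eqs abs_if field_simps\<close>)
  qed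
  also have "\<dots> = ((2 powr (1 - z) + 3 * \<epsilon>) * p + 3 * K) * L powr z"
    using L by (simp add: e_def powr_divide powr_diff field_simps)
  finally show ?thesis by (simp add: L_def)
qed

lemma grid_error_bound:
  assumes F: "finite F" "F \<subseteq> J"
    and scheme: "\<And>s t. \<lbrakk>s \<in> F; t \<in> F; s < t; F \<inter> {s<..<t} = {}\<rbrakk> \<Longrightarrow> error Y s t = 0 \<or> error Y t s = 0"
    and st: "s \<in> F" "t \<in> F" "\<bar>t - s\<bar> \<le> h"
  shows "norm (error Y s t) \<le> error_const * \<bar>t - s\<bar> powr z"
proof -
  define P where "P p \<longleftrightarrow> (\<forall>s\<in>F. \<forall>t\<in>F. \<bar>t - s\<bar> \<le> h \<longrightarrow> norm (error Y s t) \<le> p * \<bar>t - s\<bar> powr z)" for p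
  define p0 where "p0 = (\<Sum>(s, t)\<in>F \<times> F. norm (error Y s t) / \<bar>t - s\<bar> powr z)"
  have "P p0"
    unfolding P_def
  proof (intro ballI impI)
    fix s t assume st: "s \<in> F" "t \<in> F"
    show "norm (error Y s t) \<le> p0 * \<bar>t - s\<bar> powr z"
    proof (cases "s = t")
      case True
      then show ?thesis using st F diagonal by (auto simp: error_def)
    next
      case False
      have "norm (error Y s t) / \<bar>t - s\<bar> powr z \<le> p0"
        unfolding p0_def
        using member_le_sum[of "(s, t)" "F \<times> F" "\<lambda>(s, t). norm (error Y s t) / \<bar>t - s\<bar> powr z"] st F
        by auto
      then show ?thesis using False by (simp add: field_simps)
    qed
  qed
  moreover have "0 \<le> p0" by (auto simp: p0_def intro!: sum_nonneg)
  moreover have "P ((2 powr (1 - z) + 3 * \<epsilon>) * p + 3 * K)" if "0 \<le> p" "P p" for p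
    using grid_error_step[OF F scheme \<open>0 \<le> p\<close>] that(2) unfolding P_def by blast
  ultimately show ?thesis
    unfolding error_const_def
    by (rule contraction_bootstrap) (use K \<epsilon> st in \<open>auto simp: P_def\<close>)
qed

end

text \<open>Walk from \<open>t0\<close> to \<open>t\<close> in steps of length at most \<open>h\<close> through the points \<open>t0 \<plusminus> n h\<close>. The
  induction step may use that its starting point is one of them, which is what a finite grid can
  be made to contain.\<close>

lemma interval_chain_induct:
  fixes t0 :: real
  assumes "0 < h" "t0 \<in> J" "is_interval J"
    and base: "\<And>n. P n t0"
    and step: "\<And>n s t. \<lbrakk>s \<in> J; t \<in> J; \<bar>t - s\<bar> \<le> h; s = t0 + real n * h \<or> s = t0 - real n * h; P n s\<rbrakk> \<Longrightarrow> P (Suc n) t"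
    and mono: "\<And>n t. P n t \<Longrightarrow> P (Suc n) t"
    and "t \<in> J" "\<bar>t - t0\<bar> \<le> real n * h"
  shows "P n t"
  using assms(7,8)
proof (induction n arbitrary: t)
  case 0
  then show ?case using base by auto
next
  case (Suc n)
  show ?case
  proof (cases "\<bar>t - t0\<bar> \<le> real n * h")
    case True
    then show ?thesis using Suc mono by blast
  next
    case False
    define s where "s = (if t0 < t then t0 + real n * h else t0 - real n * h)"
    have nh: "0 \<le> real n * h" using \<open>0 < h\<close> by simp
    have "s \<in> J"
      by (rule mem_is_interval_1_I[OF \<open>is_interval J\<close>, of "min t0 t" "max t0 t"])
        (use False nh Suc.prems assms(2) in \<open>auto simp: s_def min_def max_def\<close>)
    moreover have "\<bar>t - s\<bar> \<le> h" "\<bar>s - t0\<bar> \<le> real n * h"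
      using False Suc.prems nh by (auto simp: s_def algebra_simps)
    ultimately show ?thesis
      using Suc by (intro step[of s]) (auto simp: s_def)
  qed
qed

context almost_flow
begin

text \<open>The grid estimates for all pairs of times are closed conditions in the product of balls around
  \<open>y\<close>, one for each time. Any finitely many of them are met by the scheme on a grid that contains
  the times involved, so by compactness all of them hold for one path.\<close>

theorem sewing:
  assumes "t0 \<in> J"
  obtains Y where "Y t0 = y" "bounded (Y ` J)"
    and "\<And>s t. \<lbrakk>s \<in> J; t \<in> J; \<bar>t - s\<bar> \<le> h\<rbrakk> \<Longrightarrow> norm (error Y s t) \<le> error_const * \<bar>t - s\<bar> powr z"
proof -
  obtain B where B: "\<And>y s t. s \<in> J \<Longrightarrow> t \<in> J \<Longrightarrow> norm (A y s t) \<le> B"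
    using bounded_increment by blast
  define b where "b = B + error_const * h powr z"
  have "0 \<le> b"
    using order_trans[OF norm_ge_zero B[OF assms assms]] error_const_nonneg by (simp add: b_def)
  obtain D where D: "\<And>s t. s \<in> J \<Longrightarrow> t \<in> J \<Longrightarrow> \<bar>s - t\<bar> \<le> D"
    using bounded_time by (auto simp: bounded_two_points dist_real_def)
  obtain n where n: "D \<le> real n * h"
    using reals_Archimedean3[OF h] by (meson less_imp_le)
  \<comment> \<open>Every grid contains these points, so its values stay within n steps of size b from y.\<close>
  define F0 where "F0 = insert t0 (J \<inter> ((\<lambda>i. t0 + real i * h) ` {..n} \<union> (\<lambda>i. t0 - real i * h) ` {..n}))"
  define S where "S = PiE UNIV (\<lambda>_::real. cball y (real n * b))"
  define C where "C = (\<lambda>(s, t). {Y. norm (error Y s t) \<le> error_const * \<bar>t - s\<bar> powr z})"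
  define I where "I = {(s, t). s \<in> J \<and> t \<in> J \<and> \<bar>t - s\<bar> \<le> h}"
  have "compactin (product_topology (\<lambda>_. euclidean) UNIV) S"
    unfolding S_def by (subst compactin_PiE) auto
  then have "compact S"
    by (simp add: euclidean_product_topology)
  then have "compact (S \<inter> {Y. Y t0 = y})"
    by (intro compact_Int_closed closed_Collect_eq continuous_intros continuous_on_product_coordinates)
  moreover have "closed (C i)" if "i \<in> I" for i
  proof -
    obtain s t where i: "i = (s, t)" by (cases i)
    have "continuous_on UNIV (\<lambda>Y :: real \<Rightarrow> 'v. A (Y s) s t)"
      by (rule continuous_on_compose2[OF continuous_state]) (use that i in \<open>auto simp: I_def\<close>)
    then show ?thesis
      unfolding C_def i error_def
      by (auto intro!: closed_Collect_le continuous_intros)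
  qed
  moreover have "S \<inter> {Y. Y t0 = y} \<inter> (\<Inter>i\<in>I'. C i) \<noteq> {}" if I': "finite I'" "I' \<subseteq> I" for I'
  proof -
    define F where "F = F0 \<union> fst ` I' \<union> snd ` I'"
    have F: "finite F" "F \<subseteq> J" "t0 \<in> F"
      using I' assms by (auto simp: F_def F0_def I_def)
    have ins: "insert t0 F = F" using F by auto
    obtain Y where Y: "Y t0 = y"
      and "\<And>s t. \<lbrakk>s \<in> F; t \<in> F; s < t; F \<inter> {s<..<t} = {}\<rbrakk> \<Longrightarrow> error Y s t = 0 \<or> error Y t s = 0"
      using grid_scheme[OF F(1), of t0 y] unfolding ins by blast
    then have err: "norm (error Y s t) \<le> error_const * \<bar>t - s\<bar> powr z"
      if "s \<in> F" "t \<in> F" "\<bar>t - s\<bar> \<le> h" for s t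
      using grid_error_bound F that by blast
    have inc: "norm (Y t - Y s) \<le> b" if "s \<in> F" "t \<in> F" "\<bar>t - s\<bar> \<le> h" for s t
    proof -
      have "norm (Y t - Y s) \<le> norm (A (Y s) s t) + norm (error Y s t)"
        using norm_triangle_ineq4[of "A (Y s) s t" "error Y s t"] by (simp add: error_def)
      also have "\<dots> \<le> B + error_const * \<bar>t - s\<bar> powr z"
        using that F by (intro add_mono B err) auto
      also have "\<dots> \<le> b"
        unfolding b_def using that z error_const_nonneg
        by (intro add_left_mono mult_left_mono powr_mono2) auto
      finally show ?thesis .
    qed
    have "t \<in> F \<longrightarrow> m \<le> n \<longrightarrow> norm (Y t - y) \<le> real m * b" if "t \<in> J" "\<bar>t - t0\<bar> \<le> real m * h" for t m
    proof (rule interval_chain_induct[OF h assms interval _ _ _ that])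
      show "t0 \<in> F \<longrightarrow> m \<le> n \<longrightarrow> norm (Y t0 - y) \<le> real m * b" for m
        using Y \<open>0 \<le> b\<close> by simp
    next
      fix m s t assume st: "s \<in> J" "t \<in> J" "\<bar>t - s\<bar> \<le> h" "s = t0 + real m * h \<or> s = t0 - real m * h"
        and IH: "s \<in> F \<longrightarrow> m \<le> n \<longrightarrow> norm (Y s - y) \<le> real m * b"
      show "t \<in> F \<longrightarrow> Suc m \<le> n \<longrightarrow> norm (Y t - y) \<le> real (Suc m) * b"
      proof (intro impI)
        assume "t \<in> F" "Suc m \<le> n"
        then have "s \<in> F" using st by (auto simp: F_def F0_def)
        then have "norm (Y t - Y s) \<le> b" "norm (Y s - y) \<le> real m * b"
          using inc st \<open>t \<in> F\<close> IH \<open>Suc m \<le> n\<close> by auto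
        then show "norm (Y t - y) \<le> real (Suc m) * b"
          using norm_triangle_ineq[of "Y t - Y s" "Y s - y"] by (simp add: algebra_simps)
      qed
    next
      fix m t assume "t \<in> F \<longrightarrow> m \<le> n \<longrightarrow> norm (Y t - y) \<le> real m * b"
      then show "t \<in> F \<longrightarrow> Suc m \<le> n \<longrightarrow> norm (Y t - y) \<le> real (Suc m) * b"
        using \<open>0 \<le> b\<close> by (auto simp: algebra_simps)
    qed
    moreover have "\<bar>t - t0\<bar> \<le> real n * h" if "t \<in> J" for t
      using D[OF that assms] n by linarith
    ultimately have bd: "norm (Y t - y) \<le> real n * b" if "t \<in> F" for t
      using that F by blast
    \<comment> \<open>Off the grid any value in the ball will do.\<close>
    define Y' where "Y' t = (if t \<in> F then Y t else y)" for t
    have "Y' \<in> S"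
      using bd \<open>0 \<le> b\<close> by (auto simp: S_def Y'_def dist_norm norm_minus_commute)
    moreover have "Y' t0 = y" using Y by (simp add: Y'_def)
    moreover have "Y' \<in> C i" if "i \<in> I'" for i
    proof -
      obtain s t where i: "i = (s, t)" by (cases i)
      have st: "s \<in> F" "t \<in> F" using that i by (force simp: F_def)+
      then have "error Y' s t = error Y s t" by (simp add: error_def Y'_def)
      then show ?thesis using err[OF st] that I' i by (auto simp: C_def I_def)
    qed
    ultimately show ?thesis by blast
  qed
  ultimately have "S \<inter> {Y. Y t0 = y} \<inter> (\<Inter>i\<in>I. C i) \<noteq> {}"
    by (rule compact_imp_fip_image)
  then obtain Y where "Y \<in> S" "Y t0 = y" "\<And>i. i \<in> I \<Longrightarrow> Y \<in> C i" by blast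
  moreover from \<open>Y \<in> S\<close> have "bounded (Y ` J)"
    by (intro bounded_subset[OF bounded_cball]) (auto simp: S_def)
  ultimately show thesis using that by (auto simp: C_def I_def)
qed

end

section \<open>The Milstein germ of a rough differential equation\<close>

lemma contract2_diff_left: "contract2 (A - B) M = contract2 A M - contract2 B M"
  by (simp add: contract2_def blinfun.bilinear_simps scaleR_diff_right sum_subtractf)

lemma contract2_diff_right: "contract2 B (M - N) = contract2 B M - contract2 B N"
  by (simp add: contract2_def scaleR_diff_left sum_subtractf)

lemma contract2_add_right: "contract2 B (M + N) = contract2 B M + contract2 B N"
  by (simp add: contract2_def scaleR_add_left sum.distrib)

text \<open>Chen's relation makes the defect of the second level an outer product; this evaluates the
  contraction on it.\<close>

lemma contract2_outer:
  fixes B :: "(real ^ 'n) \<Rightarrow>\<^sub>L (real ^ 'n) \<Rightarrow>\<^sub>L 'u::real_normed_vector"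
  assumes "\<And>\<mu> \<nu>. M $ \<mu> $ \<nu> = u $ \<mu> * v $ \<nu>"
  shows "contract2 B M = B u v"
proof -
  have u: "u = (\<Sum>\<kappa>\<in>UNIV. u $ \<kappa> *\<^sub>R axis \<kappa> 1)" and v: "v = (\<Sum>\<nu>\<in>UNIV. v $ \<nu> *\<^sub>R axis \<nu> 1)"
    using basis_expansion[of u] basis_expansion[of v] by (simp_all add: scalar_mult_eq_scaleR)
  have "B u v = B (\<Sum>\<kappa>\<in>UNIV. u $ \<kappa> *\<^sub>R axis \<kappa> 1) (\<Sum>\<nu>\<in>UNIV. v $ \<nu> *\<^sub>R axis \<nu> 1)"
    using u v by simp
  also have "\<dots> = (\<Sum>\<kappa>\<in>UNIV. \<Sum>\<nu>\<in>UNIV. (u $ \<kappa> * v $ \<nu>) *\<^sub>R B (axis \<kappa> 1) (axis \<nu> 1))"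
    by (simp add: blinfun.sum_left blinfun.sum_right blinfun.scaleR_left blinfun.scaleR_right
        scaleR_sum_right) (subst sum.swap, simp add: mult.commute)
  finally show ?thesis by (simp add: contract2_def assms)
qed

lemma norm_contract2_le:
  fixes B :: "(real ^ 'n) \<Rightarrow>\<^sub>L (real ^ 'n) \<Rightarrow>\<^sub>L 'u::real_normed_vector"
  shows "norm (contract2 B M) \<le> (real CARD('n))\<^sup>2 * norm B * norm M"
proof -
  have "norm ((M $ \<kappa> $ \<nu>) *\<^sub>R B (axis \<kappa> 1) (axis \<nu> 1)) \<le> norm B * norm M" for \<kappa> \<nu>
  proof -
    have "norm (B (axis \<kappa> 1) (axis \<nu> 1)) \<le> norm (B (axis \<kappa> 1)) * norm (axis \<nu> (1::real))"
      by (rule norm_blinfun)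
    also have "\<dots> \<le> (norm B * norm (axis \<kappa> (1::real))) * norm (axis \<nu> (1::real))"
      by (intro mult_right_mono norm_blinfun) auto
    finally have "norm (B (axis \<kappa> 1) (axis \<nu> 1)) \<le> norm B" by (simp add: norm_axis_1)
    moreover have "norm (M $ \<kappa> $ \<nu>) \<le> norm M"
      using Finite_Cartesian_Product.norm_nth_le[of M \<kappa>]
        Finite_Cartesian_Product.norm_nth_le[of "M $ \<kappa>" \<nu>] by linarith
    ultimately have "norm (M $ \<kappa> $ \<nu>) * norm (B (axis \<kappa> 1) (axis \<nu> 1)) \<le> norm M * norm B"
      by (intro mult_mono) auto
    then show ?thesis by (simp add: mult.commute)
  qed
  then have "norm (contract2 B M) \<le> (\<Sum>\<kappa>\<in>(UNIV::'n set). \<Sum>\<nu>\<in>(UNIV::'n set). norm B * norm M)"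
    unfolding contract2_def by (intro sum_norm_le) 
  then show ?thesis by (simp add: power2_eq_square mult.assoc)
qed

lemma continuous_on_contract2 [continuous_intros]:
  assumes "continuous_on S f" "continuous_on S g"
  shows "continuous_on S (\<lambda>x. contract2 (f x) (g x))"
  unfolding contract2_def using assms by (intro continuous_intros)

type_synonym 'n vfield = "real ^ 'n \<Rightarrow> (real ^ 'n) \<Rightarrow>\<^sub>L (real ^ 'n)"

text \<open>The field \<open>D\<phi> \<circ> \<phi>\<close>, whose first argument goes into \<open>\<phi>\<close>.\<close>

definition second_field :: "'n::finite vfield \<Rightarrow> real ^ 'n \<Rightarrow> (real ^ 'n) \<Rightarrow>\<^sub>L (real ^ 'n) \<Rightarrow>\<^sub>L (real ^ 'n)" where
  "second_field \<phi> y = fderiv \<phi> y o\<^sub>L \<phi> y"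

text \<open>The germ of the rough integral of \<open>\<phi>(Y)\<close> once \<open>Y' = \<phi>(Y)\<close> is inserted; it depends on the path
  through its starting value only.\<close>

definition milstein :: "'n::finite vfield \<Rightarrow> (real \<Rightarrow> real ^ 'n) \<Rightarrow> (real \<Rightarrow> real \<Rightarrow> real ^ 'n ^ 'n) \<Rightarrow>
    real ^ 'n \<Rightarrow> real \<Rightarrow> real \<Rightarrow> real ^ 'n" where
  "milstein \<phi> X XX y s t = \<phi> y (incr X s t) + contract2 (second_field \<phi> y) (XX s t)"

text \<open>The remainder of \<open>\<phi>(Y)\<close> as a controlled path, for \<open>Y\<close> moving from \<open>a\<close> to \<open>b\<close> while \<open>X\<close> moves by
  \<open>\<xi>\<close>.\<close>

definition field_increment_error :: "'n::finite vfield \<Rightarrow> real ^ 'n \<Rightarrow> real ^ 'n \<Rightarrow> real ^ 'n \<Rightarrow>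
    (real ^ 'n) \<Rightarrow>\<^sub>L (real ^ 'n)" where
  "field_increment_error \<phi> a b \<xi> = \<phi> b - \<phi> a - fderiv \<phi> a (\<phi> a \<xi>)"

definition rough_bound ::
    "real \<Rightarrow> real \<Rightarrow> real set \<Rightarrow> (real \<Rightarrow> real ^ 'n) \<Rightarrow> (real \<Rightarrow> real \<Rightarrow> real ^ 'n ^ 'n) \<Rightarrow> bool" where
  "rough_bound \<gamma> K J X XX \<longleftrightarrow>
     (\<forall>s\<in>J. \<forall>t\<in>J. norm (incr X s t) \<le> K * \<bar>t - s\<bar> powr \<gamma> \<and>
        norm (XX s t) \<le> K * \<bar>t - s\<bar> powr (2 * \<gamma>)) \<and>
     (\<forall>s\<in>J. \<forall>u\<in>J. \<forall>t\<in>J. \<forall>\<mu> \<nu>. N_op XX s u t $ \<mu> $ \<nu> = incr X s u $ \<mu> * incr X u t $ \<nu>)"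

text \<open>By Chen's relation the contribution \<open>D\<phi>(a) \<circ> \<phi>(a)\<close> of the cross term \<open>X_su \<otimes> X_ut\<close> completes the
  difference of the first-order terms to the remainder of \<open>\<phi>(Y)\<close>. Every product that is left has
  order \<open>3\<gamma>\<close>.\<close>

lemma milstein_defect:
  assumes "rough_bound \<gamma> K J X XX" "s \<in> J" "u \<in> J" "t \<in> J"
  shows "milstein \<phi> X XX a s t - milstein \<phi> X XX b u t - milstein \<phi> X XX a s u
    = - (field_increment_error \<phi> a b (incr X s u) (incr X u t)
         + contract2 (second_field \<phi> b - second_field \<phi> a) (XX u t))"
proof -
  have X: "incr X s t = incr X s u + incr X u t" by (simp add: incr_def)
  have XX: "XX s t = N_op XX s u t + XX u t + XX s u" by (simp add: N_op_def)
  have "contract2 (second_field \<phi> a) (N_op XX s u t) = second_field \<phi> a (incr X s u) (incr X u t)"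
    using assms by (intro contract2_outer) (auto simp: rough_bound_def)
  then show ?thesis
    unfolding milstein_def X XX field_increment_error_def
    by (simp add: contract2_add_right contract2_diff_left blinfun.bilinear_simps second_field_def)
qed

lemma C2_bound_nonneg: "C2_bound \<delta> K f \<Longrightarrow> 0 \<le> K"
  using C2_boundD(3) norm_ge_zero order_trans by blast

lemma C2_bound_mono:
  assumes f: "C2_bound \<delta> K f" and "K \<le> K'"
  shows "C2_bound \<delta> K' f"
proof -
  have "norm (fderiv (fderiv f) x - fderiv (fderiv f) y) \<le> K' * norm (x - y) powr \<delta>" for x y
    using C2_boundD(6)[OF f, of x y] mult_right_mono[OF assms(2), of "norm (x - y) powr \<delta>"] by simp
  then show ?thesis
    using C2_boundD[OF f] assms(2) unfolding C2_bound_def by (meson order_trans)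
qed

text \<open>Expanding \<open>\<phi>\<close> at \<open>a + \<phi> a \<xi>\<close>, and not at \<open>b\<close>, makes the bound linear in the residual
  \<open>b - a - \<phi> a \<xi>\<close>. This matters for existence, where the residual carries the unknown error
  constant and a quadratic dependence would spoil the bootstrap.\<close>

lemma field_increment_error_le:
  assumes f: "C2_bound \<delta> K \<phi>"
  shows "norm (field_increment_error \<phi> a b \<xi>) \<le> K * norm (b - a - \<phi> a \<xi>) + K ^ 3 * (norm \<xi>)\<^sup>2"
proof -
  note D = C2_boundD[OF f] and K = C2_bound_nonneg[OF f]
  have "field_increment_error \<phi> a b \<xi> = (\<phi> b - \<phi> (a + \<phi> a \<xi>)) + taylor1 \<phi> a (a + \<phi> a \<xi>)"
    by (simp add: field_increment_error_def taylor1_def)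
  also have "norm \<dots> \<le> K * norm (b - (a + \<phi> a \<xi>)) + K * (norm (a + \<phi> a \<xi> - a))\<^sup>2"
    by (intro norm_triangle_mono blinfun_derivative_lipschitz[OF D(1) D(4)] taylor1_le[OF f])
  also have "\<dots> \<le> K * norm (b - a - \<phi> a \<xi>) + K * (K * norm \<xi>)\<^sup>2"
    using norm_blinfun[of "\<phi> a" \<xi>] mult_right_mono[OF D(3)[of a], of "norm \<xi>"] K
    by (intro add_mono mult_left_mono power_mono) (auto simp: algebra_simps)
  finally show ?thesis by (simp add: power_mult_distrib power2_eq_square power3_eq_cube mult_ac)
qed

lemma norm_blinfun_compose_mono:
  assumes "norm A \<le> a" "norm B \<le> b"
  shows "norm (A o\<^sub>L B) \<le> a * b"
  using norm_blinfun_compose[of A B] mult_mono[OF assms] norm_ge_zero[of A] norm_ge_zero[of B] assms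
  by (smt (verit))

lemma norm_blinfun_mono:
  assumes "norm A \<le> a" "norm x \<le> b"
  shows "norm (blinfun_apply A x) \<le> a * b"
  using norm_blinfun[of A x] mult_mono[OF assms] norm_ge_zero[of A] norm_ge_zero[of x] assms
  by (smt (verit))

lemma second_field_le:
  assumes f: "C2_bound \<delta> K \<phi>"
  shows "norm (second_field \<phi> a) \<le> K\<^sup>2"
  unfolding second_field_def power2_eq_square
  by (intro norm_blinfun_compose_mono C2_boundD[OF f])

lemma second_field_increment:
  "second_field \<phi> b - second_field \<phi> a
     = (fderiv \<phi> b o\<^sub>L (\<phi> b - \<phi> a)) + ((fderiv \<phi> b - fderiv \<phi> a) o\<^sub>L \<phi> a)"
  by (rule blinfun_eqI) (simp add: second_field_def blinfun.bilinear_simps)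

lemma second_field_lipschitz:
  assumes f: "C2_bound \<delta> K \<phi>"
  shows "norm (second_field \<phi> b - second_field \<phi> a) \<le> 2 * K\<^sup>2 * norm (b - a)"
proof -
  note D = C2_boundD[OF f]
  have "norm (second_field \<phi> b - second_field \<phi> a) \<le> K * (K * norm (b - a)) + (K * norm (b - a)) * K"
    unfolding second_field_increment
    by (intro norm_triangle_mono norm_blinfun_compose_mono D
        blinfun_derivative_lipschitz[OF D(1) D(4)] blinfun_derivative_lipschitz[OF D(2) D(5)])
  then show ?thesis by (simp add: power2_eq_square)
qed

lemma milstein_le:
  fixes \<phi> :: "'n::finite vfield"
  assumes f: "C2_bound \<delta> K \<phi>" and "norm (incr X s t) \<le> a" "norm (XX s t) \<le> b"
  shows "norm (milstein \<phi> X XX y s t) \<le> K * a + (real CARD('n))\<^sup>2 * K\<^sup>2 * b"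
  unfolding milstein_def
proof (intro norm_triangle_mono norm_blinfun_mono C2_boundD[OF f] assms)
  have "norm (contract2 (second_field \<phi> y) (XX s t))
      \<le> (real CARD('n))\<^sup>2 * norm (second_field \<phi> y) * norm (XX s t)"
    by (rule norm_contract2_le)
  also have "\<dots> \<le> (real CARD('n))\<^sup>2 * K\<^sup>2 * b"
    using second_field_le[OF f, of y] assms by (intro mult_mono mult_left_mono) auto
  finally show "norm (contract2 (second_field \<phi> y) (XX s t)) \<le> (real CARD('n))\<^sup>2 * K\<^sup>2 * b" .
qed

lemma continuous_on_C2_bound:
  assumes f: "C2_bound \<delta> K f"
  shows "continuous_on S f" "continuous_on S (fderiv f)"
  using C2_boundD(1,2)[OF f] by (meson continuous_at_imp_continuous_on has_derivative_continuous)+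

lemma continuous_on_second_field:
  assumes f: "C2_bound \<delta> K \<phi>"
  shows "continuous_on S (second_field \<phi>)"
  unfolding second_field_def
  by (intro bounded_bilinear.continuous_on[OF bounded_bilinear_blinfun_compose]
      continuous_on_C2_bound[OF f])

lemma milstein_defect_le:
  fixes \<phi> :: "'n::finite vfield"
  assumes f: "C2_bound \<delta> K \<phi>" and X: "rough_bound \<gamma> K J X XX" and sut: "s \<in> J" "u \<in> J" "t \<in> J"
    and "0 < \<gamma>" and L: "\<bar>u - s\<bar> \<le> L" "\<bar>t - u\<bar> \<le> L"
    and R: "norm (b - a - \<phi> a (incr X s u)) \<le> r * L powr (2 * \<gamma>)"
    and ba: "norm (b - a) \<le> d * L powr \<gamma>"
  shows "norm (milstein \<phi> X XX a s t - milstein \<phi> X XX b u t - milstein \<phi> X XX a s u)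
    \<le> (K\<^sup>2 * r + K ^ 6 + 2 * (real CARD('n))\<^sup>2 * K ^ 3 * d) * L powr (3 * \<gamma>)"
proof -
  note K = C2_bound_nonneg[OF f]
  define x where "x = L powr \<gamma>"
  have x2: "L powr (2 * \<gamma>) = x\<^sup>2" and x3: "L powr (3 * \<gamma>) = x ^ 3"
    by (simp_all add: x_def power2_eq_square power3_eq_cube flip: powr_add)
  have pw: "K * \<bar>l\<bar> powr \<alpha> \<le> K * L powr \<alpha>" if "\<bar>l\<bar> \<le> L" "0 \<le> \<alpha>" for l \<alpha>
    using that K by (intro mult_left_mono powr_mono2) auto
  have xi: "norm (incr X s u) \<le> K * x" and eta: "norm (incr X u t) \<le> K * x"
    and H: "norm (XX u t) \<le> K * x\<^sup>2"
    using X sut pw[of "u - s" \<gamma>] pw[of "t - u" \<gamma>] pw[of "t - u" "2 * \<gamma>"] L \<open>0 < \<gamma>\<close>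
    unfolding rough_bound_def x_def[symmetric] x2
    by (meson less_imp_le order_trans zero_le_mult_iff zero_le_numeral)+
  have "norm (field_increment_error \<phi> a b (incr X s u)) \<le> K * (r * x\<^sup>2) + K ^ 3 * (K * x)\<^sup>2"
    by (rule order_trans[OF field_increment_error_le[OF f]])
      (use R K xi in \<open>auto simp: x2 intro!: add_mono mult_left_mono power_mono\<close>)
  then have 1: "norm (field_increment_error \<phi> a b (incr X s u) (incr X u t))
      \<le> (K * (r * x\<^sup>2) + K ^ 3 * (K * x)\<^sup>2) * (K * x)"
    by (rule norm_blinfun_mono) (rule eta)
  have sf: "norm (second_field \<phi> b - second_field \<phi> a) \<le> 2 * K\<^sup>2 * (d * x)"
    by (rule order_trans[OF second_field_lipschitz[OF f]])
      (use ba in \<open>auto simp: x_def intro!: mult_left_mono\<close>)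
  have sf0: "0 \<le> 2 * K\<^sup>2 * (d * x)" by (rule order_trans[OF norm_ge_zero sf])
  have 2: "norm (contract2 (second_field \<phi> b - second_field \<phi> a) (XX u t))
      \<le> (real CARD('n))\<^sup>2 * (2 * K\<^sup>2 * (d * x)) * (K * x\<^sup>2)"
    by (intro order_trans[OF norm_contract2_le] mult_mono mult_left_mono H sf
        mult_nonneg_nonneg[OF _ sf0]) auto
  have "norm (milstein \<phi> X XX a s t - milstein \<phi> X XX b u t - milstein \<phi> X XX a s u)
      \<le> (K * (r * x\<^sup>2) + K ^ 3 * (K * x)\<^sup>2) * (K * x)
        + (real CARD('n))\<^sup>2 * (2 * K\<^sup>2 * (d * x)) * (K * x\<^sup>2)"
    unfolding milstein_defect[OF X sut] norm_minus_cancel by (intro norm_triangle_mono 1 2)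
  also have "\<dots> = (K\<^sup>2 * r + K ^ 6 + 2 * (real CARD('n))\<^sup>2 * K ^ 3 * d) * L powr (3 * \<gamma>)"
    unfolding x3 by algebra
  finally show ?thesis .
qed

section \<open>Existence of solutions in the sense of Davie\<close>

text \<open>The notion of solution that refers to neither integrals nor derivatives of paths.\<close>

definition davie :: "real \<Rightarrow> real set \<Rightarrow> 'n::finite vfield \<Rightarrow> (real \<Rightarrow> real ^ 'n) \<Rightarrow>
    (real \<Rightarrow> real \<Rightarrow> real ^ 'n ^ 'n) \<Rightarrow> (real \<Rightarrow> real ^ 'n) \<Rightarrow> bool" where
  "davie z J \<phi> X XX Y \<longleftrightarrow>
     (\<exists>C\<ge>0. \<forall>s\<in>J. \<forall>t\<in>J. norm (milstein \<phi> X XX (Y s) s t - incr Y s t) \<le> C * \<bar>t - s\<bar> powr z)"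

lemma bounded_diameter:
  assumes "bounded (J :: real set)"
  obtains D where "1 \<le> D" "\<And>s t. s \<in> J \<Longrightarrow> t \<in> J \<Longrightarrow> \<bar>t - s\<bar> \<le> D"
proof -
  obtain D where D: "\<And>s t. s \<in> J \<Longrightarrow> t \<in> J \<Longrightarrow> \<bar>t - s\<bar> \<le> D"
    using assms by (auto simp: bounded_two_points dist_real_def)
  show thesis
    by (rule that[of "max 1 D"]) (use D in \<open>auto simp: le_max_iff_disj\<close>)
qed

lemma powr_exponent_le:
  assumes "\<bar>l\<bar> \<le> D" "1 \<le> D" "\<beta> \<le> \<alpha>"
  shows "\<bar>l\<bar> powr \<alpha> \<le> D powr (\<alpha> - \<beta>) * \<bar>l :: real\<bar> powr \<beta>"
proof -
  have "\<bar>l\<bar> powr \<alpha> = \<bar>l\<bar> powr (\<alpha> - \<beta>) * \<bar>l\<bar> powr \<beta>" by (simp flip: powr_add)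
  also have "\<dots> \<le> D powr (\<alpha> - \<beta>) * \<bar>l\<bar> powr \<beta>"
    using assms by (intro mult_right_mono powr_mono2) auto
  finally show ?thesis .
qed

lemma small_powr:
  assumes "0 < \<eta>" "0 < \<alpha>"
  obtains h :: real where "0 < h" "h \<le> 1" "h powr \<alpha> \<le> \<eta>"
proof -
  define h where "h = min 1 \<eta> powr (1 / \<alpha>)"
  have "h \<le> 1" unfolding h_def using assms by (intro powr_le1) auto
  moreover have "h powr \<alpha> = min 1 \<eta>" using assms by (simp add: h_def powr_powr)
  ultimately show thesis using that[of h] assms by (auto simp: h_def)
qed

text \<open>Over times farther apart than \<open>h\<close> the bound holds because everything is bounded.\<close>

lemma (in almost_flow) sewing_bounded:
  assumes "t0 \<in> J"
  obtains Y C where "Y t0 = y" "bounded (Y ` J)" "0 \<le> C"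
    and "\<And>s t. \<lbrakk>s \<in> J; t \<in> J\<rbrakk> \<Longrightarrow> norm (A (Y s) s t - incr Y s t) \<le> C * \<bar>t - s\<bar> powr z"
proof -
  obtain Y where Y: "Y t0 = y" "bounded (Y ` J)"
    and loc: "\<And>s t. \<lbrakk>s \<in> J; t \<in> J; \<bar>t - s\<bar> \<le> h\<rbrakk> \<Longrightarrow> norm (error Y s t) \<le> error_const * \<bar>t - s\<bar> powr z"
    using sewing[OF assms, of y] by metis
  obtain b where b: "\<And>t. t \<in> J \<Longrightarrow> norm (Y t) \<le> b"
    using Y(2) by (auto simp: bounded_iff)
  obtain B where B: "\<And>y s t. s \<in> J \<Longrightarrow> t \<in> J \<Longrightarrow> norm (A y s t) \<le> B"
    using bounded_increment by blast
  have nn: "0 \<le> b" "0 \<le> B"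
    using order_trans[OF norm_ge_zero b[OF assms]] order_trans[OF norm_ge_zero B[OF assms assms]] by auto
  define C where "C = error_const + (B + 2 * b) / h powr z"
  have "norm (A (Y s) s t - incr Y s t) \<le> C * \<bar>t - s\<bar> powr z" if st: "s \<in> J" "t \<in> J" for s t
  proof (cases "\<bar>t - s\<bar> \<le> h")
    case True
    have "error_const * \<bar>t - s\<bar> powr z \<le> C * \<bar>t - s\<bar> powr z"
      using nn by (intro mult_right_mono) (auto simp: C_def)
    then show ?thesis using loc[OF st True] by (simp add: error_def incr_def)
  next
    case False
    have "norm (A (Y s) s t - incr Y s t) \<le> B + (b + b)"
      unfolding incr_def using st by (intro order_trans[OF norm_triangle_ineq4] add_mono B b) 
    also have "\<dots> = (B + 2 * b) / h powr z * h powr z" using h by simp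
    also have "\<dots> \<le> C * \<bar>t - s\<bar> powr z"
      using nn False h z error_const_nonneg
      by (intro mult_mono powr_mono2) (auto simp: C_def)
    finally show ?thesis .
  qed
  moreover have "0 \<le> C" using nn error_const_nonneg by (simp add: C_def)
  ultimately show thesis using that Y by blast
qed

lemma rough_boundD:
  assumes "rough_bound \<gamma> K J X XX" "s \<in> J" "t \<in> J"
  shows "norm (incr X s t) \<le> K * \<bar>t - s\<bar> powr \<gamma>" "norm (XX s t) \<le> K * \<bar>t - s\<bar> powr (2 * \<gamma>)"
  using assms by (auto simp: rough_bound_def)

lemma milstein_diagonal:
  assumes X: "rough_bound \<gamma> K J X XX" and "s \<in> J"
  shows "milstein \<phi> X XX y s s = 0"
  using rough_boundD(2)[OF X \<open>s \<in> J\<close> \<open>s \<in> J\<close>]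
  by (simp add: milstein_def incr_def blinfun.bilinear_simps contract2_def)

lemma milstein_bounded:
  fixes \<phi> :: "'n::finite vfield"
  assumes "bounded J" "0 < \<gamma>" and f: "C2_bound \<delta> K \<phi>" and X: "rough_bound \<gamma> K J X XX"
  obtains B where "\<And>y s t. s \<in> J \<Longrightarrow> t \<in> J \<Longrightarrow> norm (milstein \<phi> X XX y s t) \<le> B"
proof -
  obtain D where D: "1 \<le> D" "\<And>s t. s \<in> J \<Longrightarrow> t \<in> J \<Longrightarrow> \<bar>t - s\<bar> \<le> D"
    using bounded_diameter[OF assms(1)] by blast
  have "norm (milstein \<phi> X XX y s t) \<le> K * (K * D powr \<gamma>) + (real CARD('n))\<^sup>2 * K\<^sup>2 * (K * D powr (2 * \<gamma>))"
    if st: "s \<in> J" "t \<in> J" for y s t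
    using \<open>0 < \<gamma>\<close> C2_bound_nonneg[OF f] D(2)[OF st]
    by (intro milstein_le[OF f] order_trans[OF rough_boundD(1)[OF X st]]
        order_trans[OF rough_boundD(2)[OF X st]] mult_left_mono powr_mono2) auto
  then show thesis by (rule that)
qed

locale rde_setting =
  fixes J :: "real set" and t0 \<gamma> \<delta> :: real
  assumes J: "is_interval J" "bounded J" "t0 \<in> J" and \<gamma>: "0 < \<gamma>" and \<delta>: "0 < \<delta>" "\<delta> < 1"
    and z: "1 < (2 + \<delta>) * \<gamma>"
begin

text \<open>The error \<open>p L^z\<close> of the intermediate state is \<open>p L^(\<delta>\<gamma>)\<close> times \<open>L^(2\<gamma>)\<close>, the order of the
  first-order remainder. It therefore changes the constant of the defect by a multiple of
  \<open>p h^(\<delta>\<gamma>)\<close>, and \<open>\<epsilon>\<close> is small on short intervals.\<close>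

lemma davie_solution_exists:
  fixes \<phi> :: "'n::finite vfield"
  assumes f: "C2_bound \<delta> K \<phi>" and X: "rough_bound \<gamma> K J X XX"
  obtains Y where "Y t0 = y" "bounded (Y ` J)" "davie ((2 + \<delta>) * \<gamma>) J \<phi> X XX Y"
proof -
  note K = C2_bound_nonneg[OF f]
  define c where "c = (real CARD('n))\<^sup>2"
  define \<theta> where "\<theta> = 2 powr (1 - (2 + \<delta>) * \<gamma>)"
  have "\<theta> < 1" using z powr_less_mono[of "1 - (2 + \<delta>) * \<gamma>" 0 2] by (simp add: \<theta>_def)
  \<comment> \<open>The factor with which an error of the intermediate state enters the defect.\<close>
  define E where "E = K\<^sup>2 + 2 * c * K ^ 3"
  have c: "0 \<le> c" and E: "0 \<le> E" using K by (auto simp: c_def E_def)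
  obtain h where h: "0 < h" "h \<le> 1" "h powr (\<delta> * \<gamma>) \<le> (1 - \<theta>) / (3 * E + 1) / 2"
    using small_powr[of "(1 - \<theta>) / (3 * E + 1) / 2" "\<delta> * \<gamma>"] \<open>\<theta> < 1\<close> E \<gamma> \<delta> by auto
  define \<epsilon> where "\<epsilon> = E * h powr (\<delta> * \<gamma>)"
  define K' where "K' = K\<^sup>2 * (c * K ^ 3) + K ^ 6 + 2 * c * K ^ 3 * (K\<^sup>2 + c * K ^ 3)"
  interpret almost_flow J "milstein \<phi> X XX" K' \<epsilon> "(2 + \<delta>) * \<gamma>" h
  proof
    show "continuous_on UNIV (\<lambda>y. milstein \<phi> X XX y s t)" for s t
      unfolding milstein_def
      by (intro continuous_intros continuous_on_C2_bound[OF f] continuous_on_second_field[OF f])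
  next
    show "milstein \<phi> X XX y s s = 0" if "s \<in> J" for y s by (rule milstein_diagonal[OF X that])
    show "\<exists>B. \<forall>y. \<forall>s\<in>J. \<forall>t\<in>J. norm (milstein \<phi> X XX y s t) \<le> B"
      using milstein_bounded[OF J(2) \<gamma> f X] by metis
  next
    have "3 * \<epsilon> = 3 * E * h powr (\<delta> * \<gamma>)" by (simp add: \<epsilon>_def)
    also have "\<dots> \<le> 3 * E * ((1 - \<theta>) / (3 * E + 1) / 2)" using h E by (intro mult_left_mono) auto
    also have "\<dots> \<le> (3 * E + 1) * ((1 - \<theta>) / (3 * E + 1) / 2)"
      using E \<open>\<theta> < 1\<close> by (intro mult_right_mono) auto
    also have "\<dots> = (1 - \<theta>) / 2"
    proof -
      have "3 * E + 1 \<noteq> 0" using E by linarith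
      then show ?thesis by (metis nonzero_mult_div_cancel_left times_divide_eq_right)
    qed
    also have "\<dots> < 1 - \<theta>" using \<open>\<theta> < 1\<close> by simp
    finally show "2 powr (1 - (2 + \<delta>) * \<gamma>) + 3 * \<epsilon> < 1" by (simp add: \<theta>_def)
  next
    fix a b s u t L p
    assume sut: "s \<in> J" "u \<in> J" "t \<in> J" and p: "0 \<le> p" and L: "\<bar>u - s\<bar> \<le> L" "\<bar>t - u\<bar> \<le> L" "L \<le> h"
      and e: "norm (milstein \<phi> X XX a s u - (b - a)) \<le> p * L powr ((2 + \<delta>) * \<gamma>)"
    have "0 \<le> L" using L by linarith
    define x w where "x = L powr \<gamma>" and "w = L powr (\<delta> * \<gamma>)"
    have x2: "L powr (2 * \<gamma>) = x\<^sup>2" and x3: "L powr (3 * \<gamma>) = x ^ 3"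
      and xz: "L powr ((2 + \<delta>) * \<gamma>) = x\<^sup>2 * w"
      by (simp_all add: x_def w_def power2_eq_square power3_eq_cube algebra_simps flip: powr_add)
    have xw: "0 \<le> x" "x \<le> w" "x \<le> 1" "0 \<le> w" "w \<le> h powr (\<delta> * \<gamma>)"
      using L \<open>0 \<le> L\<close> h \<gamma> \<delta>
      by (auto simp: x_def w_def intro!: powr_mono' powr_le1 powr_mono2)
    have pw: "K * \<bar>u - s\<bar> powr \<alpha> \<le> K * L powr \<alpha>" if "0 \<le> \<alpha>" for \<alpha>
      using that L K by (intro mult_left_mono powr_mono2) auto
    have xi: "norm (incr X s u) \<le> K * x" and H: "norm (XX s u) \<le> K * x\<^sup>2"
      using X sut pw[of \<gamma>] pw[of "2 * \<gamma>"] \<gamma> unfolding rough_bound_def x_def[symmetric] x2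
      by (meson less_imp_le order_trans zero_le_mult_iff zero_le_numeral)+
    define r where "r = c * K ^ 3 + p * h powr (\<delta> * \<gamma>)"
    have "norm (contract2 (second_field \<phi> a) (XX s u)) \<le> c * K\<^sup>2 * (K * x\<^sup>2)"
      unfolding c_def
      by (rule order_trans[OF norm_contract2_le]) (intro mult_mono mult_left_mono H second_field_le[OF f]; simp)
    moreover have "norm (milstein \<phi> X XX a s u - (b - a)) \<le> p * h powr (\<delta> * \<gamma>) * x\<^sup>2"
    proof -
      have "p * (x\<^sup>2 * w) \<le> p * (x\<^sup>2 * h powr (\<delta> * \<gamma>))"
        using p xw by (intro mult_left_mono) auto
      then show ?thesis using e unfolding xz by (simp add: mult_ac)
    qed
    moreover have "b - a - \<phi> a (incr X s u)
        = contract2 (second_field \<phi> a) (XX s u) - (milstein \<phi> X XX a s u - (b - a))"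
      by (simp add: milstein_def)
    ultimately have R: "norm (b - a - \<phi> a (incr X s u)) \<le> r * x\<^sup>2"
      using norm_triangle_ineq4[of "contract2 (second_field \<phi> a) (XX s u)" "milstein \<phi> X XX a s u - (b - a)"]
      by (simp add: r_def algebra_simps power2_eq_square power3_eq_cube)
    have "0 \<le> r" using c K p by (simp add: r_def)
    have "norm (b - a) \<le> norm (\<phi> a (incr X s u)) + norm (b - a - \<phi> a (incr X s u))"
      using norm_triangle_ineq[of "\<phi> a (incr X s u)" "b - a - \<phi> a (incr X s u)"] by simp
    also have "\<dots> \<le> K * (K * x) + r * x\<^sup>2"
      by (intro add_mono R norm_blinfun_mono C2_boundD[OF f] xi)
    also have "\<dots> \<le> (K\<^sup>2 + r) * x"
      using mult_left_mono[OF xw(3), of "r * x"] xw \<open>0 \<le> r\<close> by (simp add: algebra_simps power2_eq_square)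
    finally have "norm (milstein \<phi> X XX a s t - milstein \<phi> X XX b u t - milstein \<phi> X XX a s u)
        \<le> (K\<^sup>2 * r + K ^ 6 + 2 * c * K ^ 3 * (K\<^sup>2 + r)) * L powr (3 * \<gamma>)"
      unfolding c_def using sut L(1,2) R \<gamma>
      by (intro milstein_defect_le[OF f X]) (auto simp: x_def x2)
    also have "\<dots> = (K' + \<epsilon> * p) * x ^ 3"
      unfolding x3 by (simp add: K'_def \<epsilon>_def r_def E_def algebra_simps)
    also have "\<dots> \<le> (K' + \<epsilon> * p) * (x\<^sup>2 * w)"
    proof (rule mult_left_mono)
      show "x ^ 3 \<le> x\<^sup>2 * w"
        using mult_left_mono[OF xw(2), of "x\<^sup>2"] by (simp add: power2_eq_square power3_eq_cube)
      show "0 \<le> K' + \<epsilon> * p" using c K p E by (simp add: K'_def \<epsilon>_def)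
    qed
    finally show "norm (milstein \<phi> X XX a s t - milstein \<phi> X XX b u t - milstein \<phi> X XX a s u)
        \<le> (K' + \<epsilon> * p) * L powr ((2 + \<delta>) * \<gamma>)" by (simp add: xz)
  qed (use J K c E z h in \<open>auto simp: K'_def \<epsilon>_def\<close>)
  show thesis
    using sewing_bounded[OF J(3), of y] that unfolding davie_def by metis
qed

end

section \<open>Davie solutions and the rough integral equation\<close>

lemma two_norm_le:
  assumes "I \<noteq> {}" "0 \<le> C" "\<And>s t. s \<in> I \<Longrightarrow> t \<in> I \<Longrightarrow> norm (R s t) \<le> C * \<bar>t - s\<bar> powr \<gamma>"
  shows "two_norm \<gamma> I R \<le> C" "bdd_above (two_quot \<gamma> R ` (I \<times> I))"
proof -
  have "two_quot \<gamma> R p \<le> C" if I: "p \<in> I \<times> I" for p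
  proof -
    obtain s t where p: "p = (s, t)" "s \<in> I" "t \<in> I" using I by (cases p) auto
    show ?thesis
      using assms(3)[OF p(2,3)] \<open>0 \<le> C\<close> by (cases "s = t") (auto simp: two_quot_def p(1) field_simps)
  qed
  then show "two_norm \<gamma> I R \<le> C" "bdd_above (two_quot \<gamma> R ` (I \<times> I))"
    using assms(1) by (auto simp: two_norm_def intro!: cSUP_least bdd_aboveI2)
qed

lemma two_norm_bound:
  assumes "bdd_above (two_quot \<gamma> R ` (I \<times> I))" "s \<in> I" "t \<in> I" "R s s = 0"
  shows "norm (R s t) \<le> two_norm \<gamma> I R * \<bar>t - s\<bar> powr \<gamma>"
proof (cases "s = t")
  case False
  have "two_quot \<gamma> R (s, t) \<le> two_norm \<gamma> I R"
    unfolding two_norm_def using assms by (intro cSUP_upper) auto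
  then show ?thesis using False by (simp add: two_quot_def field_simps)
qed (use assms in auto)

lemma two_norm_nonneg:
  assumes "bdd_above (two_quot \<gamma> R ` (I \<times> I))" "I \<noteq> {}"
  shows "0 \<le> two_norm \<gamma> I R"
proof -
  obtain s where "s \<in> I" using assms by auto
  then have "two_quot \<gamma> R (s, s) \<le> two_norm \<gamma> I R"
    unfolding two_norm_def using assms by (intro cSUP_upper) auto
  then show ?thesis by (simp add: two_quot_def)
qed

lemma Omega_spaceI:
  assumes "bounded I" "I \<noteq> {}" "0 \<le> C" "0 < \<gamma>" "continuous_on (I \<times> I) (\<lambda>(s, t). R s t)"
    and R: "\<And>s t. s \<in> I \<Longrightarrow> t \<in> I \<Longrightarrow> norm (R s t) \<le> C * \<bar>t - s\<bar> powr \<gamma>"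
  shows "R \<in> Omega_space \<gamma> I"
proof -
  obtain D where D: "1 \<le> D" "\<And>s t. s \<in> I \<Longrightarrow> t \<in> I \<Longrightarrow> \<bar>t - s\<bar> \<le> D"
    using bounded_diameter[OF assms(1)] by blast
  have "norm (R s t) \<le> C * D powr \<gamma>" if "s \<in> I" "t \<in> I" for s t
    using R[OF that] D(2)[OF that] assms
    by (intro order_trans[OF R[OF that]] mult_left_mono powr_mono2) auto
  then have "bounded ((\<lambda>(s, t). R s t) ` (I \<times> I))"
    by (auto simp: bounded_iff)
  moreover have "R t t = 0" if "t \<in> I" for t using R[OF that that] by simp
  ultimately show ?thesis
    using two_norm_le(2)[OF assms(2,3) R] assms(5) by (auto simp: Omega_space_def)
qed

lemma Omega_spaceD:
  assumes "R \<in> Omega_space \<gamma> I"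
  shows "s \<in> I \<Longrightarrow> t \<in> I \<Longrightarrow> norm (R s t) \<le> two_norm \<gamma> I R * \<bar>t - s\<bar> powr \<gamma>"
    and "I \<noteq> {} \<Longrightarrow> 0 \<le> two_norm \<gamma> I R"
    and "continuous_on (I \<times> I) (\<lambda>(s, t). R s t)"
  using assms by (auto simp: Omega_space_def two_norm_bound two_norm_nonneg)

lemma holder_bound_imp_continuous_on:
  assumes "0 < \<gamma>" "\<And>s t. s \<in> I \<Longrightarrow> t \<in> I \<Longrightarrow> norm (incr f s t) \<le> C * \<bar>t - s\<bar> powr \<gamma>"
  shows "continuous_on I f"
  unfolding continuous_on_def
proof
  fix s assume "s \<in> I"
  have "((\<lambda>t. C * \<bar>t - s\<bar> powr \<gamma>) \<longlongrightarrow> C * \<bar>s - s\<bar> powr \<gamma>) (at s within I)"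
    using assms(1) by (intro tendsto_intros) auto
  then have lim: "((\<lambda>t. C * \<bar>t - s\<bar> powr \<gamma>) \<longlongrightarrow> 0) (at s within I)" by simp
  have "((\<lambda>t. f t - f s) \<longlongrightarrow> 0) (at s within I)"
    by (rule Lim_null_comparison[OF _ lim])
      (use assms(2)[OF \<open>s \<in> I\<close>] in \<open>auto simp: eventually_at_filter incr_def\<close>)
  then show "(f \<longlongrightarrow> f s) (at s within I)" by (rule LIM_zero_cancel)
qed

lemma holder_spaceI:
  assumes "bounded I" "I \<noteq> {}" "0 \<le> C" "0 < \<gamma>"
    and f: "\<And>s t. s \<in> I \<Longrightarrow> t \<in> I \<Longrightarrow> norm (incr f s t) \<le> C * \<bar>t - s\<bar> powr \<gamma>"
  shows "f \<in> holder_space \<gamma> I"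
proof -
  obtain D where D: "1 \<le> D" "\<And>s t. s \<in> I \<Longrightarrow> t \<in> I \<Longrightarrow> \<bar>t - s\<bar> \<le> D"
    using bounded_diameter[OF assms(1)] by blast
  obtain s where s: "s \<in> I" using assms by auto
  have "norm (f t) \<le> norm (f s) + C * D powr \<gamma>" if "t \<in> I" for t
  proof -
    have "norm (incr f s t) \<le> C * D powr \<gamma>"
      using f[OF s that] D(2)[OF s that] assms
      by (intro order_trans[OF f[OF s that]] mult_left_mono powr_mono2) auto
    then show ?thesis using norm_triangle_ineq[of "f s" "incr f s t"] by (simp add: incr_def)
  qed
  then have "bounded (f ` I)" by (auto simp: bounded_iff)
  then show ?thesis
    using two_norm_le(2)[OF assms(2,3) f] holder_bound_imp_continuous_on[OF assms(4) f]
    by (auto simp: holder_space_def)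
qed

lemma holder_spaceD:
  assumes "f \<in> holder_space \<gamma> I"
  shows "s \<in> I \<Longrightarrow> t \<in> I \<Longrightarrow> norm (incr f s t) \<le> holder_norm \<gamma> I f * \<bar>t - s\<bar> powr \<gamma>"
    and "I \<noteq> {} \<Longrightarrow> 0 \<le> holder_norm \<gamma> I f"
    and "continuous_on I f" "bounded (f ` I)"
proof -
  have *: "continuous_on I f" "bounded (f ` I)" "bdd_above (two_quot \<gamma> (incr f) ` (I \<times> I))"
    using assms by (simp_all add: holder_space_def)
  then show "continuous_on I f" "bounded (f ` I)"
    by blast+
  show "norm (incr f s t) \<le> holder_norm \<gamma> I f * \<bar>t - s\<bar> powr \<gamma>" if "s \<in> I" "t \<in> I"
    unfolding holder_norm_def by (rule two_norm_bound[OF *(3) that]) (simp add: incr_def)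
  show "0 \<le> holder_norm \<gamma> I f" if "I \<noteq> {}"
    unfolding holder_norm_def by (rule two_norm_nonneg[OF *(3) that])
qed

text \<open>The bootstrap with defect zero: halving \<open>[s, t]\<close> lowers any admissible constant by the factor
  \<open>2^(1 - z)\<close>.\<close>

lemma additive_superlinear_zero:
  fixes D :: "real \<Rightarrow> real \<Rightarrow> 'u::real_normed_vector"
  assumes "is_interval J" "1 < z" "0 \<le> C"
    and D: "\<And>s t. s \<in> J \<Longrightarrow> t \<in> J \<Longrightarrow> norm (D s t) \<le> C * \<bar>t - s\<bar> powr z"
    and add: "\<And>s u t. s \<in> J \<Longrightarrow> u \<in> J \<Longrightarrow> t \<in> J \<Longrightarrow> D s t = D s u + D u t"
    and st: "s \<in> J" "t \<in> J"
  shows "D s t = 0"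
proof -
  define P where "P p \<longleftrightarrow> (\<forall>s\<in>J. \<forall>t\<in>J. norm (D s t) \<le> p * \<bar>t - s\<bar> powr z)" for p
  have "norm (D s t) \<le> 0 / (1 - 2 powr (1 - z)) * \<bar>t - s\<bar> powr z"
  proof (rule contraction_bootstrap[where P = P and ?p0.0 = C])
    show "P C" using D by (simp add: P_def)
    show "norm (D s t) \<le> p * \<bar>t - s\<bar> powr z" if "P p" for p using that st by (simp add: P_def)
    show "2 powr (1 - z) < 1" using \<open>1 < z\<close> powr_less_mono[of "1 - z" 0 2] by simp
  next
    fix p assume p: "0 \<le> p" "P p"
    show "P (2 powr (1 - z) * p + 0)"
      unfolding P_def
    proof (intro ballI)
      fix s t assume st: "s \<in> J" "t \<in> J"
      define u where "u = (s + t) / 2"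
      have "u \<in> J"
        by (rule mem_is_interval_1_I[OF assms(1), of "min s t" "max s t"])
          (use st in \<open>auto simp: u_def min_def max_def\<close>)
      then have "norm (D s t) \<le> p * \<bar>u - s\<bar> powr z + p * \<bar>t - u\<bar> powr z"
        using p st unfolding add[OF st(1) \<open>u \<in> J\<close> st(2)] P_def by (intro norm_triangle_mono) auto
      moreover have "\<bar>u - s\<bar> = \<bar>t - s\<bar> / 2" "\<bar>t - u\<bar> = \<bar>t - s\<bar> / 2" by (auto simp: u_def field_simps)
      ultimately show "norm (D s t) \<le> (2 powr (1 - z) * p + 0) * \<bar>t - s\<bar> powr z"
        by (simp add: powr_divide powr_diff)
    qed
  qed (use \<open>0 \<le> C\<close> in simp_all)
  then show "D s t = 0" by simp
qed

text \<open>The correction is a definite description, so it has to be identified through its uniqueness: two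
  candidates have the same defect, hence their difference is additive and superlinearly small.\<close>

lemma rough_integral_eq:
  fixes f :: "real \<Rightarrow> real ^ 'n"
  assumes J: "is_interval J" "bounded J" "J \<noteq> {}" and z: "1 < \<eta> + \<gamma>" and "0 \<le> C"
    and cont: "continuous_on (J \<times> J) (\<lambda>(s, t). germ X XX W W' s t)" "continuous_on J f"
    and f: "\<And>s t. s \<in> J \<Longrightarrow> t \<in> J \<Longrightarrow> norm (germ X XX W W' s t - incr f s t) \<le> C * \<bar>t - s\<bar> powr (\<eta> + \<gamma>)"
    and st: "s \<in> J" "t \<in> J"
  shows "rough_integral \<gamma> \<eta> J X XX W W' s t = incr f s t"
proof -
  define Q where "Q s t = (if (s, t) \<in> J \<times> J then germ X XX W W' s t - incr f s t else 0)" for s t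
  let ?P = "\<lambda>Q. Q \<in> Omega_space (\<eta> + \<gamma>) J \<and>
     (\<forall>s\<in>J. \<forall>u\<in>J. \<forall>t\<in>J. N_op Q s u t = N_op (germ X XX W W') s u t) \<and>
     (\<forall>s t. (s, t) \<notin> J \<times> J \<longrightarrow> Q s t = 0)"
  have "continuous_on (J \<times> J) (\<lambda>p. germ X XX W W' (fst p) (snd p) - (f (snd p) - f (fst p)))"
    using cont(1) by (intro continuous_intros continuous_on_compose2[OF cont(2)])
      (auto simp: case_prod_beta)
  then have "continuous_on (J \<times> J) (\<lambda>(s, t). Q s t)"
    by (rule continuous_on_eq) (auto simp: Q_def incr_def)
  then have "Q \<in> Omega_space (\<eta> + \<gamma>) J"
    using J z \<open>0 \<le> C\<close> f by (intro Omega_spaceI[of J C]) (auto simp: Q_def)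
  moreover have "N_op Q s u t = N_op (germ X XX W W') s u t" if "s \<in> J" "u \<in> J" "t \<in> J" for s u t
    using that by (simp add: Q_def N_op_def incr_def)
  ultimately have Q: "?P Q" by (simp add: Q_def)
  have "(THE Q. ?P Q) = Q"
  proof (rule the_equality)
    show "?P Q" by (rule Q)
  next
    fix Q' assume Q': "?P Q'"
    have "Q' s t - Q s t = 0" if "s \<in> J" "t \<in> J" for s t
    proof (rule additive_superlinear_zero[OF J(1) z _ _ _ that])
      show "0 \<le> two_norm (\<eta> + \<gamma>) J Q' + two_norm (\<eta> + \<gamma>) J Q"
        using Q Q' J(3) by (intro add_nonneg_nonneg Omega_spaceD(2)) auto
    next
      fix s t assume st: "s \<in> J" "t \<in> J"
      have "norm (Q s t) \<le> two_norm (\<eta> + \<gamma>) J Q * \<bar>t - s\<bar> powr (\<eta> + \<gamma>)"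
        "norm (Q' s t) \<le> two_norm (\<eta> + \<gamma>) J Q' * \<bar>t - s\<bar> powr (\<eta> + \<gamma>)"
        using Q Q' by (auto intro: Omega_spaceD(1)[OF _ st])
      then show "norm (Q' s t - Q s t)
          \<le> (two_norm (\<eta> + \<gamma>) J Q' + two_norm (\<eta> + \<gamma>) J Q) * \<bar>t - s\<bar> powr (\<eta> + \<gamma>)"
        unfolding distrib_right using norm_triangle_ineq4[of "Q' s t" "Q s t"] by linarith
    next
      fix s u t assume "s \<in> J" "u \<in> J" "t \<in> J"
      then have "N_op Q' s u t = N_op Q s u t" using Q Q' by auto
      then show "Q' s t - Q s t = (Q' s u - Q s u) + (Q' u t - Q u t)"
        by (simp add: N_op_def algebra_simps)
    qed
    moreover have "Q' s t = Q s t" if "(s, t) \<notin> J \<times> J" for s t using Q Q' that by metis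
    ultimately have "Q' s t = Q s t" for s t by (cases "(s, t) \<in> J \<times> J") auto
    then show "Q' = Q" by blast
  qed
  then have "rough_correction \<gamma> \<eta> J X XX W W' = Q" by (simp add: rough_correction_def)
  then show ?thesis using st by (simp add: rough_integral_def Q_def)
qed

lemma germ_eq_milstein:
  "Y' s = \<phi> (Y s) \<Longrightarrow>
    germ X XX (\<lambda>u. \<phi> (Y u)) (\<lambda>u. fderiv \<phi> (Y u) o\<^sub>L Y' u) s t = milstein \<phi> X XX (Y s) s t"
  by (simp add: germ_def milstein_def second_field_def)

text \<open>Serves both a solution, with \<open>g = Y\<close>, and the indefinite rough integral \<open>g\<close> along a given
  controlled path \<open>Y\<close>.\<close>

lemma milstein_primitive_bounds:
  fixes \<phi> :: "'n::finite vfield"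
  assumes "bounded J" and "0 < \<gamma>" and z: "2 * \<gamma> \<le> z" "0 \<le> C"
    and f: "C2_bound \<delta> K \<phi>" and X: "rough_bound \<gamma> K J X XX"
    and g: "\<And>s t. s \<in> J \<Longrightarrow> t \<in> J \<Longrightarrow> norm (milstein \<phi> X XX (Y s) s t - incr g s t) \<le> C * \<bar>t - s\<bar> powr z"
  obtains H where "0 \<le> H"
    "\<And>s t. s \<in> J \<Longrightarrow> t \<in> J \<Longrightarrow> norm (incr g s t) \<le> H * \<bar>t - s\<bar> powr \<gamma>"
    "\<And>s t. s \<in> J \<Longrightarrow> t \<in> J \<Longrightarrow> norm (incr g s t - \<phi> (Y s) (incr X s t)) \<le> H * \<bar>t - s\<bar> powr (2 * \<gamma>)"
proof -
  note K = C2_bound_nonneg[OF f]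
  obtain D where D: "1 \<le> D" "\<And>s t. s \<in> J \<Longrightarrow> t \<in> J \<Longrightarrow> \<bar>t - s\<bar> \<le> D"
    using bounded_diameter[OF assms(1)] by blast
  define c where "c = (real CARD('n))\<^sup>2"
  have "0 \<le> c" by (simp add: c_def)
  define H1 where "H1 = c * K\<^sup>2 * K + C * D powr (z - 2 * \<gamma>)"
  define H where "H = H1 + K * K + H1 * D powr \<gamma>"
  have nn: "0 \<le> H1" "H1 \<le> H" using K \<open>0 \<le> c\<close> \<open>0 \<le> C\<close> by (auto simp: H1_def H_def)
  have 2: "norm (incr g s t - \<phi> (Y s) (incr X s t)) \<le> H1 * \<bar>t - s\<bar> powr (2 * \<gamma>)" if "s \<in> J" "t \<in> J" for s t
  proof -
    have "incr g s t - \<phi> (Y s) (incr X s t)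
        = contract2 (second_field \<phi> (Y s)) (XX s t) - (milstein \<phi> X XX (Y s) s t - incr g s t)"
      by (simp add: milstein_def)
    also have "norm \<dots> \<le> c * K\<^sup>2 * (K * \<bar>t - s\<bar> powr (2 * \<gamma>)) + C * \<bar>t - s\<bar> powr z"
    proof (rule order_trans[OF norm_triangle_ineq4], intro add_mono g that)
      show "norm (contract2 (second_field \<phi> (Y s)) (XX s t)) \<le> c * K\<^sup>2 * (K * \<bar>t - s\<bar> powr (2 * \<gamma>))"
        unfolding c_def
        by (rule order_trans[OF norm_contract2_le])
          (intro mult_mono mult_left_mono second_field_le[OF f] rough_boundD[OF X that]; simp)
    qed
    also have "C * \<bar>t - s\<bar> powr z \<le> C * (D powr (z - 2 * \<gamma>) * \<bar>t - s\<bar> powr (2 * \<gamma>))"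
      using D that z by (intro mult_left_mono powr_exponent_le) auto
    finally show ?thesis by (simp add: H1_def algebra_simps)
  qed
  show thesis
  proof (rule that)
    show "0 \<le> H" using nn by linarith
  next
    fix s t assume st: "s \<in> J" "t \<in> J"
    have "H1 * \<bar>t - s\<bar> powr (2 * \<gamma>) \<le> H * \<bar>t - s\<bar> powr (2 * \<gamma>)"
      using nn by (intro mult_right_mono) auto
    then show "norm (incr g s t - \<phi> (Y s) (incr X s t)) \<le> H * \<bar>t - s\<bar> powr (2 * \<gamma>)"
      using 2[OF st] by linarith
    have "norm (incr g s t) \<le> norm (\<phi> (Y s) (incr X s t)) + norm (incr g s t - \<phi> (Y s) (incr X s t))"
      using norm_triangle_ineq[of "\<phi> (Y s) (incr X s t)" "incr g s t - \<phi> (Y s) (incr X s t)"] by simp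
    also have "\<dots> \<le> K * (K * \<bar>t - s\<bar> powr \<gamma>) + H1 * \<bar>t - s\<bar> powr (2 * \<gamma>)"
      by (intro add_mono norm_blinfun_mono C2_boundD[OF f] rough_boundD[OF X] 2 st)
    also have "H1 * \<bar>t - s\<bar> powr (2 * \<gamma>) \<le> H1 * (D powr (2 * \<gamma> - \<gamma>) * \<bar>t - s\<bar> powr \<gamma>)"
      using D st nn \<open>0 < \<gamma>\<close> by (intro mult_left_mono powr_exponent_le) auto
    also have "K * (K * \<bar>t - s\<bar> powr \<gamma>) + \<dots> \<le> H * \<bar>t - s\<bar> powr \<gamma>"
      using nn by (simp add: H_def algebra_simps)
    finally show "norm (incr g s t) \<le> H * \<bar>t - s\<bar> powr \<gamma>" by simp
  qed
qed

lemma continuous_on_fst_compose: "continuous_on A f \<Longrightarrow> continuous_on (A \<times> B) (\<lambda>p. f (fst p))"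
  by (erule continuous_on_compose2) (auto intro: continuous_on_fst continuous_on_id)

lemma continuous_on_snd_compose: "continuous_on B f \<Longrightarrow> continuous_on (A \<times> B) (\<lambda>p. f (snd p))"
  by (erule continuous_on_compose2) (auto intro: continuous_on_snd continuous_on_id)

lemma continuous_on_milstein:
  fixes \<phi> :: "'n::finite vfield"
  assumes f: "C2_bound \<delta> K \<phi>" and rp: "rough_path \<gamma> J X XX" and Y: "continuous_on J Y"
  shows "continuous_on (J \<times> J) (\<lambda>(s, t). milstein \<phi> X XX (Y s) s t)"
proof -
  have X: "continuous_on J X"
    using rp by (auto simp: rough_path_def intro: holder_spaceD(3))
  have XX: "continuous_on (J \<times> J) (\<lambda>p. XX (fst p) (snd p))"
    using rp Omega_spaceD(3)[of XX] by (auto simp: rough_path_def case_prod_beta)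
  note Y1 = continuous_on_fst_compose[OF Y, where B = J]
  note YF = continuous_on_compose2[OF continuous_on_C2_bound(1)[OF f, of UNIV] Y1 subset_UNIV]
  note YS = continuous_on_compose2[OF continuous_on_second_field[OF f, of UNIV] Y1 subset_UNIV]
  show ?thesis
    unfolding milstein_def incr_def case_prod_beta
    by (intro continuous_on_add continuous_on_contract2 continuous_on_diff XX YS
        continuous_on_fst_compose[OF X] continuous_on_snd_compose[OF X]
        bounded_bilinear.continuous_on[OF bounded_bilinear_blinfun_apply] YF)
qed

context rde_setting
begin

lemma davie_imp_rde_solution:
  fixes \<phi> :: "'n::finite vfield"
  assumes f: "C2_bound \<delta> K \<phi>" and X: "rough_bound \<gamma> K J X XX" and rp: "rough_path \<gamma> J X XX"
    and Y: "Y t0 = y" "davie ((2 + \<delta>) * \<gamma>) J \<phi> X XX Y"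
  shows "rde_solution \<gamma> \<delta> J t0 y \<phi> X XX (Y, \<lambda>t. \<phi> (Y t))"
proof -
  note K = C2_bound_nonneg[OF f]
  obtain C where C: "0 \<le> C"
    "\<And>s t. s \<in> J \<Longrightarrow> t \<in> J \<Longrightarrow> norm (milstein \<phi> X XX (Y s) s t - incr Y s t) \<le> C * \<bar>t - s\<bar> powr ((2 + \<delta>) * \<gamma>)"
    using Y(2) by (auto simp: davie_def)
  have "2 * \<gamma> \<le> (2 + \<delta>) * \<gamma>" using \<gamma> \<delta> by (simp add: algebra_simps)
  then obtain H where H: "0 \<le> H"
    "\<And>s t. s \<in> J \<Longrightarrow> t \<in> J \<Longrightarrow> norm (incr Y s t) \<le> H * \<bar>t - s\<bar> powr \<gamma>"
    "\<And>s t. s \<in> J \<Longrightarrow> t \<in> J \<Longrightarrow> norm (incr Y s t - \<phi> (Y s) (incr X s t)) \<le> H * \<bar>t - s\<bar> powr (2 * \<gamma>)"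
    by (rule milstein_primitive_bounds[OF J(2) \<gamma> _ C(1) f X C(2)]) auto
  have ne: "J \<noteq> {}" using J by auto
  have Yh: "Y \<in> holder_space \<gamma> J"
    using H by (intro holder_spaceI[OF J(2) ne H(1) \<gamma>]) auto
  have "(\<lambda>t. \<phi> (Y t)) \<in> holder_space \<gamma> J"
  proof (rule holder_spaceI[OF J(2) ne _ \<gamma>])
    show "0 \<le> K * H" using K H by simp
    fix s t assume st: "s \<in> J" "t \<in> J"
    have "norm (incr (\<lambda>t. \<phi> (Y t)) s t) \<le> K * norm (incr Y s t)"
      unfolding incr_def by (rule blinfun_derivative_lipschitz[OF C2_boundD(1,4)[OF f]])
    also have "\<dots> \<le> K * (H * \<bar>t - s\<bar> powr \<gamma>)" using K H(2)[OF st] by (intro mult_left_mono)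
    finally show "norm (incr (\<lambda>t. \<phi> (Y t)) s t) \<le> K * H * \<bar>t - s\<bar> powr \<gamma>" by (simp add: mult.assoc)
  qed
  moreover have "remainder X Y (\<lambda>t. \<phi> (Y t)) \<in> Omega_space (2 * \<gamma>) J"
  proof (rule Omega_spaceI[OF J(2) ne H(1)])
    have X: "continuous_on J X" using rp by (auto simp: rough_path_def intro: holder_spaceD(3))
    note Yc = holder_spaceD(3)[OF Yh]
    note YF = continuous_on_compose2[OF continuous_on_C2_bound(1)[OF f, of UNIV]
        continuous_on_fst_compose[OF Yc, where B = J] subset_UNIV]
    show "continuous_on (J \<times> J) (\<lambda>(s, t). remainder X Y (\<lambda>t. \<phi> (Y t)) s t)"
      unfolding remainder_def incr_def case_prod_beta
      by (intro continuous_on_diff continuous_on_fst_compose[OF X] continuous_on_snd_compose[OF X]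
          continuous_on_fst_compose[OF Yc] continuous_on_snd_compose[OF Yc] YF
          bounded_bilinear.continuous_on[OF bounded_bilinear_blinfun_apply])
  qed (use H \<gamma> in \<open>auto simp: remainder_def\<close>)
  ultimately have "controlled \<gamma> (2 * \<gamma>) J X Y (\<lambda>t. \<phi> (Y t))"
    using Yh by (simp add: controlled_def)
  moreover have zz: "(1 + \<delta>) * \<gamma> + \<gamma> = (2 + \<delta>) * \<gamma>" by (simp add: algebra_simps)
  have "rough_integral \<gamma> ((1 + \<delta>) * \<gamma>) J X XX (\<lambda>u. \<phi> (Y u)) (\<lambda>u. fderiv \<phi> (Y u) o\<^sub>L \<phi> (Y u)) t0 t
      = incr Y t0 t" if "t \<in> J" for t
    by (rule rough_integral_eq[OF J(1,2) ne _ C(1) _ holder_spaceD(3)[OF Yh] _ J(3) that])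
      (use z C(2) continuous_on_milstein[OF f rp holder_spaceD(3)[OF Yh]] in
        \<open>simp_all add: germ_eq_milstein[of "\<lambda>u. \<phi> (Y u)"] zz\<close>)
  ultimately show ?thesis using Y(1) by (simp add: rde_solution_def incr_def)
qed

text \<open>The equation says nothing about \<open>Y\<close> before the correction in the rough integral is known to
  exist. Sewing the germ \<open>\<Xi>(Y_s; s, t)\<close> along the given path, with no dependence on the state
  argument, yields a path \<open>g\<close> that the integral must equal; the equation then turns into
  \<open>Y = y + g\<close>, up to the value of \<open>g\<close> at \<open>t0\<close>.\<close>

lemma rde_solution_imp_davie:
  fixes \<phi> :: "'n::finite vfield"
  assumes f: "C2_bound \<delta> K \<phi>" and X: "rough_bound \<gamma> K J X XX" and rp: "rough_path \<gamma> J X XX"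
    and sol: "rde_solution \<gamma> \<delta> J t0 y \<phi> X XX (Y, Y')"
  shows "Y t0 = y" "davie ((2 + \<delta>) * \<gamma>) J \<phi> X XX Y"
proof -
  note K = C2_bound_nonneg[OF f]
  define c where "c = (real CARD('n))\<^sup>2"
  have "0 \<le> c" by (simp add: c_def)
  have ne: "J \<noteq> {}" using J by auto
  obtain D where D: "1 \<le> D" "\<And>s t. s \<in> J \<Longrightarrow> t \<in> J \<Longrightarrow> \<bar>t - s\<bar> \<le> D"
    using bounded_diameter[OF J(2)] by blast
  have Yh: "Y \<in> holder_space \<gamma> J" and R: "remainder X Y Y' \<in> Omega_space (2 * \<gamma>) J"
    and Y': "\<And>t. t \<in> J \<Longrightarrow> Y' t = \<phi> (Y t)"
    and int: "\<And>t. t \<in> J \<Longrightarrow> Y t = y + rough_integral \<gamma> ((1 + \<delta>) * \<gamma>) J X XX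
        (\<lambda>u. \<phi> (Y u)) (\<lambda>u. fderiv \<phi> (Y u) o\<^sub>L Y' u) t0 t"
    using sol by (auto simp: rde_solution_def controlled_def)
  define d r where "d = holder_norm \<gamma> J Y" and "r = two_norm (2 * \<gamma>) J (remainder X Y Y')"
  have dr: "0 \<le> d" "0 \<le> r" using holder_spaceD(2)[OF Yh ne] Omega_spaceD(2)[OF R ne] by (auto simp: d_def r_def)
  define k where "k = (K\<^sup>2 * r + K ^ 6 + 2 * c * K ^ 3 * d) * D powr (3 * \<gamma> - (2 + \<delta>) * \<gamma>)"
  have exps: "2 * \<gamma> \<le> (2 + \<delta>) * \<gamma>" "(2 + \<delta>) * \<gamma> \<le> 3 * \<gamma>"
    using \<gamma> \<delta> by (simp_all add: algebra_simps)
  interpret almost_flow J "\<lambda>_ s t. milstein \<phi> X XX (Y s) s t" k 0 "(2 + \<delta>) * \<gamma>" D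
  proof
    show "milstein \<phi> X XX (Y s) s s = 0" if "s \<in> J" for s by (rule milstein_diagonal[OF X that])
    show "\<exists>B. \<forall>y::real^'n. \<forall>s\<in>J. \<forall>t\<in>J. norm (milstein \<phi> X XX (Y s) s t) \<le> B"
      using milstein_bounded[OF J(2) \<gamma> f X] by metis
  next
    fix s u t L p :: real
    assume sut: "s \<in> J" "u \<in> J" "t \<in> J" and L: "\<bar>u - s\<bar> \<le> L" "\<bar>t - u\<bar> \<le> L" "L \<le> D"
    have "0 \<le> L" using L by linarith
    have "norm (Y u - Y s - \<phi> (Y s) (incr X s u)) \<le> r * \<bar>u - s\<bar> powr (2 * \<gamma>)"
      using Omega_spaceD(1)[OF R sut(1,2)] Y'[OF sut(1)] by (simp add: remainder_def incr_def r_def)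
    also have "\<dots> \<le> r * L powr (2 * \<gamma>)"
      using L dr \<gamma> by (intro mult_left_mono powr_mono2) auto
    finally have R': "norm (Y u - Y s - \<phi> (Y s) (incr X s u)) \<le> r * L powr (2 * \<gamma>)" .
    have "norm (Y u - Y s) \<le> d * \<bar>u - s\<bar> powr \<gamma>"
      using holder_spaceD(1)[OF Yh sut(1,2)] by (simp add: incr_def d_def)
    also have "\<dots> \<le> d * L powr \<gamma>"
      using L dr \<gamma> by (intro mult_left_mono powr_mono2) auto
    finally have "norm (milstein \<phi> X XX (Y s) s t - milstein \<phi> X XX (Y u) u t - milstein \<phi> X XX (Y s) s u)
        \<le> (K\<^sup>2 * r + K ^ 6 + 2 * c * K ^ 3 * d) * L powr (3 * \<gamma>)"
      unfolding c_def by (rule milstein_defect_le[OF f X sut \<gamma> L(1,2) R'])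
    also have "\<dots> \<le> (K\<^sup>2 * r + K ^ 6 + 2 * c * K ^ 3 * d)
        * (D powr (3 * \<gamma> - (2 + \<delta>) * \<gamma>) * L powr ((2 + \<delta>) * \<gamma>))"
      using powr_exponent_le[of L D "(2 + \<delta>) * \<gamma>" "3 * \<gamma>"] L \<open>0 \<le> L\<close> D exps K \<open>0 \<le> c\<close> dr
      by (intro mult_left_mono) auto
    finally show "norm (milstein \<phi> X XX (Y s) s t - milstein \<phi> X XX (Y u) u t - milstein \<phi> X XX (Y s) s u)
        \<le> (k + 0 * p) * L powr ((2 + \<delta>) * \<gamma>)" by (simp add: k_def mult.assoc)
  qed (use J K \<open>0 \<le> c\<close> dr D z powr_less_mono[of "1 - (2 + \<delta>) * \<gamma>" 0 2] in \<open>auto simp: k_def\<close>)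
  obtain g C where "0 \<le> C"
    and g: "\<And>s t. s \<in> J \<Longrightarrow> t \<in> J \<Longrightarrow> norm (milstein \<phi> X XX (Y s) s t - incr g s t) \<le> C * \<bar>t - s\<bar> powr ((2 + \<delta>) * \<gamma>)"
    using sewing_bounded[OF J(3), of 0] by metis
  obtain H where "\<And>s t. s \<in> J \<Longrightarrow> t \<in> J \<Longrightarrow> norm (incr g s t) \<le> H * \<bar>t - s\<bar> powr \<gamma>"
    by (rule milstein_primitive_bounds[OF J(2) \<gamma> exps(1) \<open>0 \<le> C\<close> f X g]) auto
  then have gc: "continuous_on J g" by (rule holder_bound_imp_continuous_on[OF \<gamma>])
  have germ: "germ X XX (\<lambda>u. \<phi> (Y u)) (\<lambda>u. fderiv \<phi> (Y u) o\<^sub>L Y' u) s t = milstein \<phi> X XX (Y s) s t"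
    if "s \<in> J" for s t using Y'[OF that] by (rule germ_eq_milstein)
  have zz: "(1 + \<delta>) * \<gamma> + \<gamma> = (2 + \<delta>) * \<gamma>" by (simp add: algebra_simps)
  have "continuous_on (J \<times> J) (\<lambda>(s, t). germ X XX (\<lambda>u. \<phi> (Y u)) (\<lambda>u. fderiv \<phi> (Y u) o\<^sub>L Y' u) s t)"
    by (rule continuous_on_eq[OF continuous_on_milstein[OF f rp holder_spaceD(3)[OF Yh]]])
      (auto simp: germ)
  then have "rough_integral \<gamma> ((1 + \<delta>) * \<gamma>) J X XX (\<lambda>u. \<phi> (Y u)) (\<lambda>u. fderiv \<phi> (Y u) o\<^sub>L Y' u) t0 t
      = incr g t0 t" if "t \<in> J" for t
    using z g by (intro rough_integral_eq[OF J(1,2) ne _ \<open>0 \<le> C\<close> _ gc _ J(3) that]) (simp_all add: germ zz)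
  then have Yg: "Y t = y + incr g t0 t" if "t \<in> J" for t using int that by simp
  show "Y t0 = y" using Yg[OF J(3)] by (simp add: incr_def)
  have "incr Y s t = incr g s t" if "s \<in> J" "t \<in> J" for s t
    using Yg that by (simp add: incr_def)
  then show "davie ((2 + \<delta>) * \<gamma>) J \<phi> X XX Y"
    using g \<open>0 \<le> C\<close> by (auto simp: davie_def)
qed

end

section \<open>Dependence of the defect on the data\<close>

definition C2_close :: "real \<Rightarrow> ('a::real_normed_vector \<Rightarrow> 'b::real_normed_vector) \<Rightarrow> ('a \<Rightarrow> 'b) \<Rightarrow> bool" where
  "C2_close r f f' \<longleftrightarrow> (\<forall>x. norm (f x - f' x) \<le> r \<and> norm (fderiv f x - fderiv f' x) \<le> r \<and>
     norm (fderiv (fderiv f) x - fderiv (fderiv f') x) \<le> r)"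

lemma C2_closeD:
  assumes "C2_close r f f'"
  shows "norm (f x - f' x) \<le> r" "norm (fderiv f x - fderiv f' x) \<le> r"
    "norm (fderiv (fderiv f) x - fderiv (fderiv f') x) \<le> r"
  using assms by (auto simp: C2_close_def)

lemma has_derivative_blinfun_diff:
  assumes "(f has_derivative blinfun_apply A) F" "(f' has_derivative blinfun_apply A') F"
  shows "((\<lambda>x. f x - f' x) has_derivative blinfun_apply (A - A')) F"
  using has_derivative_diff[OF assms] by (simp add: minus_blinfun.rep_eq)

lemma difference_lipschitz:
  assumes "\<And>x. (f has_derivative blinfun_apply (Df x)) (at x)"
    and "\<And>x. (f' has_derivative blinfun_apply (Df' x)) (at x)"
    and "\<And>x. norm (Df x - Df' x) \<le> r"
  shows "norm ((f b - f' b) - (f a - f' a)) \<le> r * norm (b - a)"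
  by (rule blinfun_derivative_lipschitz[where f = "\<lambda>x. f x - f' x" and Df = "\<lambda>x. Df x - Df' x"])
    (use assms in \<open>auto intro: has_derivative_blinfun_diff\<close>)

text \<open>First move the points under \<open>f\<close>, then exchange \<open>f\<close> for \<open>f'\<close> at the points \<open>a'\<close> and \<open>b'\<close>.\<close>

lemma double_difference_close:
  assumes f: "\<And>x. (f has_derivative blinfun_apply (Df x)) (at x)" "\<And>x. norm (Df x) \<le> K"
    and f': "\<And>x. (f' has_derivative blinfun_apply (Df' x)) (at x)"
    and r: "\<And>x. norm (Df x - Df' x) \<le> r"
    and \<kappa>: "\<And>u v. norm (v - u) \<le> m \<Longrightarrow> norm (Df v - Df u) \<le> \<kappa>"
    and m: "norm (b - a) \<le> m" "norm (b' - a') \<le> m"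
    and E: "norm (a - a') \<le> E" and D: "norm ((b - a) - (b' - a')) \<le> D"
  shows "norm ((f b - f a) - (f' b' - f' a')) \<le> \<kappa> * E + K * D + r * m"
proof -
  have nn: "0 \<le> m" "0 \<le> K" "0 \<le> r"
    using order_trans[OF norm_ge_zero m(1)] order_trans[OF norm_ge_zero f(2)]
      order_trans[OF norm_ge_zero r] by auto
  then have "0 \<le> \<kappa>" using \<kappa>[of 0 0] by simp
  have "norm ((f b - f a) - (f b' - f a')) \<le> \<kappa> * norm (a - a') + K * norm ((b - a) - (b' - a'))"
    by (intro double_difference_bound[OF f] \<kappa> interpolated_increment_bound m)
  also have "\<dots> \<le> \<kappa> * E + K * D"
    using E D nn \<open>0 \<le> \<kappa>\<close> by (intro add_mono mult_left_mono) auto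
  finally have 1: "norm ((f b - f a) - (f b' - f a')) \<le> \<kappa> * E + K * D" .
  have "norm ((f b' - f' b') - (f a' - f' a')) \<le> r * norm (b' - a')"
    by (rule difference_lipschitz[OF f(1) f' r])
  also have "\<dots> \<le> r * m" using m nn by (intro mult_left_mono) auto
  finally have 2: "norm ((f b' - f' b') - (f a' - f' a')) \<le> r * m" .
  have "(f b - f a) - (f' b' - f' a')
      = ((f b - f a) - (f b' - f a')) + ((f b' - f' b') - (f a' - f' a'))" by simp
  also have "norm \<dots> \<le> (\<kappa> * E + K * D) + r * m" by (intro norm_triangle_mono 1 2)
  finally show ?thesis .
qed

lemma close_values:
  assumes "\<And>x. (f has_derivative blinfun_apply (Df x)) (at x)" "\<And>x. norm (Df x) \<le> K"
    and "\<And>x. norm (f x - f' x) \<le> r" and "norm (a - a') \<le> E"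
  shows "norm (f a - f' a') \<le> K * E + r"
proof -
  have "0 \<le> K" by (rule order_trans[OF norm_ge_zero assms(2)])
  have "norm (f a - f a') \<le> K * norm (a - a')" by (rule blinfun_derivative_lipschitz[OF assms(1,2)])
  also have "\<dots> \<le> K * E" using assms(4) \<open>0 \<le> K\<close> by (intro mult_left_mono)
  finally show ?thesis
    using norm_triangle_ineq[of "f a - f a'" "f a' - f' a'"] assms(3)[of a'] by simp
qed

lemma taylor1_close:
  assumes f: "C2_bound \<delta> K f" and f': "C2_bound \<delta>' K' f'" and r: "C2_close r f f'"
  shows "norm (taylor1 f a b - taylor1 f' a b) \<le> r * norm (b - a) ^ 2"
proof -
  note D = C2_boundD[OF f] and D' = C2_boundD[OF f'] and C = C2_closeD[OF r]
  have "0 \<le> r" by (rule order_trans[OF norm_ge_zero C(1)])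
  have "norm ((f b - f' b) - (f a - f' a) - (fderiv f a - fderiv f' a) (b - a)) \<le> (r * norm (b - a)) * norm (b - a)"
  proof (rule blinfun_derivative_linearization[where S = "cball a (norm (b - a))"
        and f = "\<lambda>x. f x - f' x" and Df = "\<lambda>x. fderiv f x - fderiv f' x"])
    fix x assume x: "x \<in> cball a (norm (b - a))"
    show "((\<lambda>x. f x - f' x) has_derivative blinfun_apply (fderiv f x - fderiv f' x)) (at x)"
      by (rule has_derivative_blinfun_diff[OF D(1) D'(1)])
    have "norm ((fderiv f x - fderiv f' x) - (fderiv f a - fderiv f' a)) \<le> r * norm (x - a)"
      by (rule difference_lipschitz[OF D(2) D'(2) C(3)])
    also have "\<dots> \<le> r * norm (b - a)"
      using x \<open>0 \<le> r\<close> by (intro mult_left_mono) (auto simp: dist_norm norm_minus_commute)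
    finally show "norm ((fderiv f x - fderiv f' x) - (fderiv f a - fderiv f' a)) \<le> r * norm (b - a)" .
  qed (auto simp: dist_norm norm_minus_commute)
  moreover have "taylor1 f a b - taylor1 f' a b
      = (f b - f' b) - (f a - f' a) - (fderiv f a - fderiv f' a) (b - a)"
    by (simp add: taylor1_def blinfun.bilinear_simps)
  ultimately show ?thesis by (simp add: power2_eq_square mult.assoc)
qed

lemma powers_ge_one:
  assumes "1 \<le> (K::real)"
  shows "0 \<le> K" "1 \<le> K\<^sup>2" "K \<le> K\<^sup>2" "K \<le> K ^ 3" "K\<^sup>2 \<le> K ^ 3" "1 \<le> K ^ 3" "K ^ 3 \<le> K ^ 4" "0 \<le> K ^ 4"
  using assms power_increasing[of 1 2 K] power_increasing[of 1 3 K] power_increasing[of 2 3 K]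
    power_increasing[of 3 4 K] one_le_power[of K 2] one_le_power[of K 3]
  by auto

text \<open>Two vector fields at distance \<open>r\<close>, with a common bound \<open>K\<close>. In the lemmas below \<open>x\<close> stands for
  \<open>L^\<gamma>\<close> with \<open>L\<close> the length of a time interval, so \<open>w = x^\<delta>\<close> is the factor that the Hoelder
  exponent of the second derivative contributes; \<open>E\<close>, \<open>d\<close> and \<open>G\<close> measure the distance of the two
  solutions, of their increments and of their first-order remainders. As \<open>1 \<le> K\<close>, powers of \<open>K\<close>
  can be rounded up.\<close>

locale field_pair =
  fixes \<delta> K r :: real and \<phi> \<phi>' :: "'n::finite vfield"
  assumes \<delta>: "0 < \<delta>" "\<delta> < 1" and K1: "1 \<le> K" and r0: "0 \<le> r"
    and f: "C2_bound \<delta> K \<phi>" and f': "C2_bound \<delta> K \<phi>'" and close: "C2_close r \<phi> \<phi>'"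
begin

lemmas D = C2_boundD[OF f] and D' = C2_boundD[OF f'] and C = C2_closeD[OF close]

definition c :: real where "c = (real CARD('n))\<^sup>2"

lemma c1: "1 \<le> c"
  by (simp add: c_def Suc_leI)

lemma scaled_powr_le:
  assumes "0 \<le> x"
  shows "(K * x) powr \<delta> \<le> K * x powr \<delta>"
proof -
  have "K powr \<delta> \<le> K powr 1" using K1 \<delta> by (intro powr_mono) auto
  then show ?thesis using K1 assms by (simp add: powr_mult mult_right_mono)
qed

text \<open>With \<open>R = b - a - \<phi> a \<xi>\<close> the error is \<open>D\<phi>(a) R\<close> plus the Taylor remainder of \<open>\<phi>\<close>, and the two
  parts are compared separately. The Taylor remainder contributes the order \<open>x w\<close>, everything else
  \<open>x\<^sup>2\<close>.\<close>

lemma field_increment_error_difference: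
  assumes x: "0 \<le> x" "x \<le> w" "w = x powr \<delta>"
    and nn: "0 \<le> E" "0 \<le> d" "0 \<le> G"
    and E: "norm (a - a') \<le> E" and d: "norm ((b - a) - (b' - a')) \<le> d * x"
    and m: "norm (b - a) \<le> K * x" "norm (b' - a') \<le> K * x"
    and R': "norm (b' - a' - \<phi>' a' \<xi>') \<le> K * x\<^sup>2"
    and G: "norm ((b - a - \<phi> a \<xi>) - (b' - a' - \<phi>' a' \<xi>')) \<le> G * x\<^sup>2"
  shows "norm (field_increment_error \<phi> a b \<xi> - field_increment_error \<phi>' a' b' \<xi>')
      \<le> 2 * K ^ 3 * (E + d + G + r) * (x * w)"
    and "norm (field_increment_error \<phi>' a' b' \<xi>') \<le> 2 * K ^ 3 * x\<^sup>2"
proof -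
  note p = powers_ge_one[OF K1]
  define R R' where "R = b - a - \<phi> a \<xi>" and "R' = b' - a' - \<phi>' a' \<xi>'"
  have split: "field_increment_error \<phi> a b \<xi> = fderiv \<phi> a R + taylor1 \<phi> a b"
    "field_increment_error \<phi>' a' b' \<xi>' = fderiv \<phi>' a' R' + taylor1 \<phi>' a' b'"
    by (simp_all add: field_increment_error_def taylor1_def R_def R'_def blinfun.bilinear_simps)
  have xx: "x\<^sup>2 \<le> x * w" using x by (simp add: power2_eq_square mult_left_mono)
  have xw: "0 \<le> x * w" using x by simp
  have Kx: "0 \<le> K * x" using p x by simp
  have 1: "norm (fderiv \<phi> a (R - R')) \<le> K * (G * x\<^sup>2)"
    by (intro norm_blinfun_mono D) (use G in \<open>simp add: R_def R'_def\<close>)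
  have 2: "norm ((fderiv \<phi> a - fderiv \<phi>' a') R') \<le> (K * E + r) * (K * x\<^sup>2)"
    by (intro norm_blinfun_mono close_values[OF D(2,5) C(2) E]) (use R' in \<open>simp add: R'_def\<close>)
  have "norm (taylor1 \<phi> a b - taylor1 \<phi> a' b')
      \<le> K * (K * x) powr \<delta> * (K * x) * norm (a - a') + K * (K * x) * norm ((b - a) - (b' - a'))"
    by (rule taylor1_difference_le[OF f \<delta>(1) m])
  also have "\<dots> \<le> K * (K * w) * (K * x) * E + K * (K * x) * (d * x)"
    using p Kx x nn E d scaled_powr_le[OF x(1)]
    by (intro add_mono mult_mono mult_left_mono mult_nonneg_nonneg) auto
  finally have 3: "norm (taylor1 \<phi> a b - taylor1 \<phi> a' b') \<le> K * (K * w) * (K * x) * E + K * (K * x) * (d * x)" .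
  have "norm (taylor1 \<phi> a' b' - taylor1 \<phi>' a' b') \<le> r * norm (b' - a') ^ 2"
    by (rule taylor1_close[OF f f' close])
  also have "\<dots> \<le> r * (K * x)\<^sup>2" using r0 m by (intro mult_left_mono power_mono) auto
  finally have 4: "norm (taylor1 \<phi> a' b' - taylor1 \<phi>' a' b') \<le> r * (K * x)\<^sup>2" .
  have "field_increment_error \<phi> a b \<xi> - field_increment_error \<phi>' a' b' \<xi>'
      = fderiv \<phi> a (R - R') + (fderiv \<phi> a - fderiv \<phi>' a') R'
        + (taylor1 \<phi> a b - taylor1 \<phi> a' b') + (taylor1 \<phi> a' b' - taylor1 \<phi>' a' b')"
    by (simp add: split blinfun.bilinear_simps)
  also have "norm \<dots> \<le> K * (G * x\<^sup>2) + (K * E + r) * (K * x\<^sup>2)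
      + (K * (K * w) * (K * x) * E + K * (K * x) * (d * x)) + r * (K * x)\<^sup>2"
    by (intro norm_triangle_mono 1 2 3 4)
  also have "\<dots> = (K * G + K\<^sup>2 * E + K * r + K\<^sup>2 * d + K\<^sup>2 * r) * x\<^sup>2 + K ^ 3 * E * (x * w)"
    by algebra
  also have "\<dots> \<le> (K * G + K\<^sup>2 * E + K * r + K\<^sup>2 * d + K\<^sup>2 * r) * (x * w) + K ^ 3 * E * (x * w)"
    using xx p nn r0 by (intro add_right_mono mult_left_mono) auto
  also have "\<dots> = (K * G + K\<^sup>2 * E + K * r + K\<^sup>2 * d + K\<^sup>2 * r + K ^ 3 * E) * (x * w)"
    by (simp add: algebra_simps)
  also have "\<dots> \<le> (2 * K ^ 3 * (E + d + G + r)) * (x * w)"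
  proof (rule mult_right_mono[OF _ xw])
    have "K * G \<le> K ^ 3 * G" "K\<^sup>2 * E \<le> K ^ 3 * E" "K * r \<le> K ^ 3 * r" "K\<^sup>2 * d \<le> K ^ 3 * d"
      "K\<^sup>2 * r \<le> K ^ 3 * r" "0 \<le> K ^ 3 * G" "0 \<le> K ^ 3 * d"
      using p nn r0 by (auto intro: mult_right_mono)
    then show "K * G + K\<^sup>2 * E + K * r + K\<^sup>2 * d + K\<^sup>2 * r + K ^ 3 * E \<le> 2 * K ^ 3 * (E + d + G + r)"
      by (simp add: algebra_simps)
  qed
  finally show "norm (field_increment_error \<phi> a b \<xi> - field_increment_error \<phi>' a' b' \<xi>')
      \<le> 2 * K ^ 3 * (E + d + G + r) * (x * w)" .
  have "norm (taylor1 \<phi>' a' b') \<le> K * (K * x)\<^sup>2"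
    by (rule order_trans[OF taylor1_le[OF f']]) (use p m in \<open>auto intro!: mult_left_mono power_mono\<close>)
  then have "norm (field_increment_error \<phi>' a' b' \<xi>') \<le> K * (K * x\<^sup>2) + K * (K * x)\<^sup>2"
    unfolding split using R' by (intro norm_triangle_mono norm_blinfun_mono D') (simp_all add: R'_def)
  also have "\<dots> = (K\<^sup>2 + K ^ 3) * x\<^sup>2" by algebra
  also have "\<dots> \<le> 2 * K ^ 3 * x\<^sup>2" using p by (intro mult_right_mono) auto
  finally show "norm (field_increment_error \<phi>' a' b' \<xi>') \<le> 2 * K ^ 3 * x\<^sup>2" .
qed

text \<open>The double difference of \<open>D\<phi>\<close> is governed by \<open>D\<^sup>2\<phi>\<close>, which is only Hoelder continuous, so the
  order \<open>w\<close> is all that is left. That is enough, because this term is contracted with the second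
  level, of order \<open>x\<^sup>2\<close>.\<close>

lemma second_field_increment_difference:
  assumes x: "0 \<le> x" "x \<le> w" "x \<le> 1" "w = x powr \<delta>"
    and nn: "0 \<le> E" "0 \<le> d"
    and E: "norm (a - a') \<le> E" and d: "norm ((b - a) - (b' - a')) \<le> d * x"
    and m: "norm (b - a) \<le> K * x" "norm (b' - a') \<le> K * x"
  shows "norm ((second_field \<phi> b - second_field \<phi> a) - (second_field \<phi>' b' - second_field \<phi>' a'))
      \<le> 4 * K ^ 3 * (E + d + r) * w"
proof -
  note p = powers_ge_one[OF K1]
  let ?S = "E + d + r"
  have S: "0 \<le> ?S" using nn r0 by simp
  have KS: "0 \<le> K\<^sup>2 * ?S" using S by simp
  have w: "0 \<le> w" using x by simp
  have e: "K * E \<le> K\<^sup>2 * E" "K * d \<le> K\<^sup>2 * d" "K * r \<le> K\<^sup>2 * r" "r \<le> K * r" "0 \<le> K * d" "0 \<le> K\<^sup>2 * d"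
    using p nn r0 K1 by (auto intro: mult_right_mono mult_right_mono[of 1 K r, simplified])
  have "norm ((\<phi> b - \<phi> a) - (\<phi>' b' - \<phi>' a')) \<le> (K * (K * x)) * E + K * (d * x) + r * (K * x)"
  proof (rule double_difference_close[OF D(1,4) D'(1) C(2) _ m E d])
    fix u v :: "real ^ 'n" assume "norm (v - u) \<le> K * x"
    then have "K * norm (v - u) \<le> K * (K * x)" using p by (intro mult_left_mono)
    then show "norm (fderiv \<phi> v - fderiv \<phi> u) \<le> K * (K * x)"
      using blinfun_derivative_lipschitz[OF D(2,5), of v u] by linarith
  qed
  also have "\<dots> = (K\<^sup>2 * E + K * d + K * r) * x" by algebra
  also have "\<dots> \<le> (K\<^sup>2 * ?S) * w"
    using x e KS by (intro mult_mono) (auto simp: algebra_simps)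
  finally have 1: "norm ((\<phi> b - \<phi> a) - (\<phi>' b' - \<phi>' a')) \<le> (K\<^sup>2 * ?S) * w" .
  have "norm (b - b') \<le> E + d * x"
    using norm_triangle_ineq[of "a - a'" "(b - a) - (b' - a')"] E d by simp
  also have "\<dots> \<le> E + d" using x nn mult_left_mono[of x 1 d] by simp
  finally have "norm (fderiv \<phi> b - fderiv \<phi>' b') \<le> K * (E + d) + r"
    by (rule close_values[OF D(2,5) C(2)])
  also have "\<dots> \<le> K * ?S" using e by (simp add: algebra_simps)
  finally have 2: "norm (fderiv \<phi> b - fderiv \<phi>' b') \<le> K * ?S" .
  have "norm (\<phi> a - \<phi>' a') \<le> K * E + r" by (rule close_values[OF D(1,4) C(1) E])
  also have "\<dots> \<le> K * ?S" using e by (simp add: algebra_simps)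
  finally have 3: "norm (\<phi> a - \<phi>' a') \<le> K * ?S" .
  have "norm ((fderiv \<phi> b - fderiv \<phi> a) - (fderiv \<phi>' b' - fderiv \<phi>' a'))
      \<le> (K * (K * w)) * E + K * (d * x) + r * (K * x)"
  proof (rule double_difference_close[OF D(2,5) D'(2) C(3) _ m E d])
    fix u v :: "real ^ 'n" assume "norm (v - u) \<le> K * x"
    then have "norm (v - u) powr \<delta> \<le> (K * x) powr \<delta>" using \<delta> by (intro powr_mono2) auto
    then have "K * norm (v - u) powr \<delta> \<le> K * (K * w)"
      using p scaled_powr_le[OF x(1)] x by (intro mult_left_mono) auto
    then show "norm (fderiv (fderiv \<phi>) v - fderiv (fderiv \<phi>) u) \<le> K * (K * w)"
      using D(6)[of v u] by linarith
  qed
  also have "\<dots> = K\<^sup>2 * E * w + (K * d + K * r) * x" by algebra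
  also have "\<dots> \<le> K\<^sup>2 * E * w + (K * d + K * r) * w"
    using x p nn r0 by (intro add_left_mono mult_left_mono) auto
  also have "\<dots> = (K\<^sup>2 * E + K * d + K * r) * w" by (simp add: algebra_simps)
  also have "\<dots> \<le> (K\<^sup>2 * ?S) * w"
    using x e p nn S w by (intro mult_right_mono) (auto simp: algebra_simps)
  finally have 4: "norm ((fderiv \<phi> b - fderiv \<phi> a) - (fderiv \<phi>' b' - fderiv \<phi>' a')) \<le> (K\<^sup>2 * ?S) * w" .
  have Kxw: "K * (K * x) \<le> K * (K * w)" using x p by (intro mult_left_mono) auto
  have 5: "norm (\<phi>' b' - \<phi>' a') \<le> K * (K * w)"
    by (rule order_trans[OF order_trans[OF blinfun_derivative_lipschitz[OF D'(1,4)]] Kxw])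
      (use m p in \<open>auto intro: mult_left_mono\<close>)
  have 6: "norm (fderiv \<phi>' b' - fderiv \<phi>' a') \<le> K * (K * w)"
    by (rule order_trans[OF order_trans[OF blinfun_derivative_lipschitz[OF D'(2,5)]] Kxw])
      (use m p in \<open>auto intro: mult_left_mono\<close>)
  have "(second_field \<phi> b - second_field \<phi> a) - (second_field \<phi>' b' - second_field \<phi>' a')
      = (fderiv \<phi> b o\<^sub>L ((\<phi> b - \<phi> a) - (\<phi>' b' - \<phi>' a'))) + ((fderiv \<phi> b - fderiv \<phi>' b') o\<^sub>L (\<phi>' b' - \<phi>' a'))
        + (((fderiv \<phi> b - fderiv \<phi> a) - (fderiv \<phi>' b' - fderiv \<phi>' a')) o\<^sub>L \<phi> a)
        + ((fderiv \<phi>' b' - fderiv \<phi>' a') o\<^sub>L (\<phi> a - \<phi>' a'))"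
    by (rule blinfun_eqI) (simp add: second_field_def blinfun.bilinear_simps)
  also have "norm \<dots> \<le> K * ((K\<^sup>2 * ?S) * w) + (K * ?S) * (K * (K * w)) + ((K\<^sup>2 * ?S) * w) * K
      + (K * (K * w)) * (K * ?S)"
    by (intro norm_triangle_mono norm_blinfun_compose_mono D 1 2 3 4 5 6)
  also have "\<dots> = 4 * K ^ 3 * ?S * w" by algebra
  finally show ?thesis .
qed

lemma contract2_difference:
  fixes B B' :: "(real ^ 'n) \<Rightarrow>\<^sub>L (real ^ 'n) \<Rightarrow>\<^sub>L (real ^ 'n)"
  assumes "norm (B - B') \<le> e" "norm M \<le> m" "norm B' \<le> b" "norm (M - M') \<le> \<mu>"
  shows "norm (contract2 B M - contract2 B' M') \<le> c * (e * m + b * \<mu>)"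
proof -
  have "contract2 B M - contract2 B' M' = contract2 (B - B') M + contract2 B' (M - M')"
    by (simp add: contract2_diff_left contract2_diff_right)
  also have "norm \<dots> \<le> c * norm (B - B') * norm M + c * norm B' * norm (M - M')"
    unfolding c_def by (intro norm_triangle_mono norm_contract2_le)
  also have "\<dots> \<le> c * e * m + c * b * \<mu>"
    using assms c1 order_trans[OF norm_ge_zero assms(1)] order_trans[OF norm_ge_zero assms(3)]
    by (intro add_mono mult_mono mult_left_mono) auto
  finally show ?thesis by (simp add: algebra_simps)
qed

lemma defect_difference:
  assumes x: "0 \<le> x" "x \<le> 1" "x \<le> w" "w = x powr \<delta>"
    and nn: "0 \<le> E" "0 \<le> d" "0 \<le> G"
    and E: "norm (a - a') \<le> E" and d: "norm ((b - a) - (b' - a')) \<le> d * x"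
    and m: "norm (b - a) \<le> K * x" "norm (b' - a') \<le> K * x"
    and R': "norm (b' - a' - \<phi>' a' \<xi>') \<le> K * x\<^sup>2"
    and G: "norm ((b - a - \<phi> a \<xi>) - (b' - a' - \<phi>' a' \<xi>')) \<le> G * x\<^sup>2"
    and \<eta>: "norm \<eta> \<le> K * x" "norm (\<eta> - \<eta>') \<le> r * x"
    and H: "norm H \<le> K * x\<^sup>2" "norm (H - H') \<le> r * x\<^sup>2"
  shows "norm ((field_increment_error \<phi> a b \<xi> \<eta> + contract2 (second_field \<phi> b - second_field \<phi> a) H)
      - (field_increment_error \<phi>' a' b' \<xi>' \<eta>' + contract2 (second_field \<phi>' b' - second_field \<phi>' a') H'))
      \<le> 10 * c * K ^ 4 * (E + d + G + r) * (x\<^sup>2 * w)"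
proof -
  note p = powers_ge_one[OF K1]
  let ?S = "E + d + G + r"
  let ?P = "field_increment_error \<phi> a b \<xi>" and ?P' = "field_increment_error \<phi>' a' b' \<xi>'"
  note FD = field_increment_error_difference[OF x(1,3,4) nn E d m R' G]
  have S: "0 \<le> ?S" "r \<le> ?S" using nn r0 by simp_all
  have w: "0 \<le> w" using x by simp
  have "?P \<eta> - ?P' \<eta>' = (?P - ?P') \<eta> + ?P' (\<eta> - \<eta>')" by (simp add: blinfun.bilinear_simps)
  also have "norm \<dots> \<le> (2 * K ^ 3 * ?S * (x * w)) * (K * x) + (2 * K ^ 3 * x\<^sup>2) * (r * x)"
    by (intro norm_triangle_mono norm_blinfun_mono FD \<eta>)
  also have "\<dots> \<le> (2 * K ^ 3 * ?S * (x * w)) * (K * x) + (2 * K ^ 4 * x\<^sup>2) * (?S * w)"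
    using p x w S r0 by (intro add_mono mult_mono) auto
  also have "\<dots> = 4 * K ^ 4 * ?S * (x\<^sup>2 * w)" by algebra
  finally have 1: "norm (?P \<eta> - ?P' \<eta>') \<le> 4 * K ^ 4 * ?S * (x\<^sup>2 * w)" .
  have "norm ((second_field \<phi> b - second_field \<phi> a) - (second_field \<phi>' b' - second_field \<phi>' a'))
      \<le> 4 * K ^ 3 * (E + d + r) * w"
    by (rule second_field_increment_difference[OF x(1,3,2,4) nn(1,2) E d m])
  also have "\<dots> \<le> 4 * K ^ 3 * ?S * w"
    using p w nn by (intro mult_right_mono mult_left_mono) auto
  finally have V: "norm ((second_field \<phi> b - second_field \<phi> a) - (second_field \<phi>' b' - second_field \<phi>' a'))
      \<le> 4 * K ^ 3 * ?S * w" .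
  have V': "norm (second_field \<phi>' b' - second_field \<phi>' a') \<le> 2 * K\<^sup>2 * (K * x)"
    by (rule order_trans[OF second_field_lipschitz[OF f']]) (use m p in \<open>auto intro: mult_left_mono\<close>)
  have "norm (contract2 (second_field \<phi> b - second_field \<phi> a) H
      - contract2 (second_field \<phi>' b' - second_field \<phi>' a') H')
      \<le> c * ((4 * K ^ 3 * ?S * w) * (K * x\<^sup>2) + (2 * K\<^sup>2 * (K * x)) * (r * x\<^sup>2))"
    by (rule contract2_difference[OF V H(1) V' H(2)])
  also have "\<dots> \<le> c * ((4 * K ^ 3 * ?S * w) * (K * x\<^sup>2) + (2 * K ^ 4 * w) * (?S * x\<^sup>2))"
  proof -
    have "(2 * K\<^sup>2 * (K * x)) * (r * x\<^sup>2) = (2 * K ^ 3 * x) * (r * x\<^sup>2)" by algebra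
    also have "\<dots> \<le> (2 * K ^ 4 * w) * (?S * x\<^sup>2)"
      using p x w S r0 by (intro mult_mono) auto
    finally show ?thesis using c1 by (intro mult_left_mono add_left_mono) auto
  qed
  also have "\<dots> = 6 * c * K ^ 4 * ?S * (x\<^sup>2 * w)" by algebra
  finally have 2: "norm (contract2 (second_field \<phi> b - second_field \<phi> a) H
      - contract2 (second_field \<phi>' b' - second_field \<phi>' a') H') \<le> 6 * c * K ^ 4 * ?S * (x\<^sup>2 * w)" .
  have "norm ((?P \<eta> - ?P' \<eta>') + (contract2 (second_field \<phi> b - second_field \<phi> a) H
      - contract2 (second_field \<phi>' b' - second_field \<phi>' a') H'))
      \<le> 4 * K ^ 4 * ?S * (x\<^sup>2 * w) + 6 * c * K ^ 4 * ?S * (x\<^sup>2 * w)"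
    by (intro norm_triangle_mono 1 2)
  also have "\<dots> \<le> 10 * c * K ^ 4 * ?S * (x\<^sup>2 * w)"
  proof -
    have "0 \<le> K ^ 4 * ?S * (x\<^sup>2 * w)" using p S w by simp
    then have "1 * (K ^ 4 * ?S * (x\<^sup>2 * w)) \<le> c * (K ^ 4 * ?S * (x\<^sup>2 * w))" using c1 by (intro mult_right_mono)
    then show ?thesis by (simp add: mult_ac)
  qed
  finally show ?thesis by (simp add: algebra_simps)
qed

lemma field_apply_difference:
  assumes "0 \<le> x" and E: "0 \<le> E" "norm (a - a') \<le> E"
    and \<xi>: "norm \<xi> \<le> K * x" "norm (\<xi> - \<xi>') \<le> r * x"
  shows "norm (\<phi> a \<xi> - \<phi>' a' \<xi>') \<le> 2 * K\<^sup>2 * (E + r) * x"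
proof -
  note p = powers_ge_one[OF K1]
  have "\<phi> a \<xi> - \<phi>' a' \<xi>' = (\<phi> a - \<phi>' a') \<xi> + \<phi>' a' (\<xi> - \<xi>')" by (simp add: blinfun.bilinear_simps)
  also have "norm \<dots> \<le> (K * E + r) * (K * x) + K * (r * x)"
    by (intro norm_triangle_mono norm_blinfun_mono close_values[OF D(1,4) C(1) E(2)] D' \<xi>)
  also have "\<dots> = (K\<^sup>2 * E + 2 * (K * r)) * x" by algebra
  also have "\<dots> \<le> 2 * K\<^sup>2 * (E + r) * x"
  proof (rule mult_right_mono[OF _ \<open>0 \<le> x\<close>])
    have "K * r \<le> K\<^sup>2 * r" "0 \<le> K\<^sup>2 * E" using mult_right_mono[OF p(3) r0] E by simp_all
    moreover have "2 * K\<^sup>2 * (E + r) = 2 * (K\<^sup>2 * E) + 2 * (K\<^sup>2 * r)" by algebra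
    ultimately show "K\<^sup>2 * E + 2 * (K * r) \<le> 2 * K\<^sup>2 * (E + r)" by linarith
  qed
  finally show ?thesis .
qed

lemma second_order_difference:
  assumes "0 \<le> y" and E: "0 \<le> E" "norm (a - a') \<le> E"
    and H: "norm H \<le> K * y" "norm (H - H') \<le> r * y"
  shows "norm (contract2 (second_field \<phi> a) H - contract2 (second_field \<phi>' a') H')
    \<le> 3 * c * K ^ 3 * (E + r) * y"
proof -
  note p = powers_ge_one[OF K1]
  have e: "K * E + r \<le> K * (E + r)" using mult_right_mono[OF K1 r0] by (simp add: algebra_simps)
  have "second_field \<phi> a - second_field \<phi>' a'
      = ((fderiv \<phi> a - fderiv \<phi>' a') o\<^sub>L \<phi> a) + (fderiv \<phi>' a' o\<^sub>L (\<phi> a - \<phi>' a'))"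
    by (rule blinfun_eqI) (simp add: second_field_def blinfun.bilinear_simps)
  also have "norm \<dots> \<le> (K * (E + r)) * K + K * (K * (E + r))"
    by (intro norm_triangle_mono norm_blinfun_compose_mono D D' order_trans[OF _ e]
        close_values[OF D(2,5) C(2) E(2)] close_values[OF D(1,4) C(1) E(2)])
  finally have "norm (second_field \<phi> a - second_field \<phi>' a') \<le> (K * (E + r)) * K + K * (K * (E + r))" .
  then have "norm (contract2 (second_field \<phi> a) H - contract2 (second_field \<phi>' a') H')
      \<le> c * (((K * (E + r)) * K + K * (K * (E + r))) * (K * y) + K\<^sup>2 * (r * y))"
    by (rule contract2_difference[OF _ H(1) second_field_le[OF f'] H(2)])
  also have "\<dots> = c * (2 * K ^ 3 * (E + r) * y + K\<^sup>2 * r * y)" by algebra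
  also have "\<dots> \<le> c * (2 * K ^ 3 * (E + r) * y + K ^ 3 * (E + r) * y)"
    using p c1 r0 E \<open>0 \<le> y\<close> by (intro mult_left_mono add_left_mono mult_right_mono mult_mono) auto
  finally show ?thesis by (simp add: algebra_simps)
qed

end

section \<open>The Lipschitz estimate for two solutions\<close>

text \<open>Two Davie solutions whose driving data differ by at most \<open>r\<close>.\<close>

locale solution_pair = field_pair \<delta> K r \<phi> \<phi>'
  for \<delta> K r :: real and \<phi> \<phi>' :: "'n::finite vfield" +
  fixes \<gamma> :: real and J :: "real set" and X X' :: "real \<Rightarrow> real ^ 'n"
    and XX XX' :: "real \<Rightarrow> real \<Rightarrow> real ^ 'n ^ 'n" and Y Y' :: "real \<Rightarrow> real ^ 'n"
  assumes interval: "is_interval J" and \<gamma>: "0 < \<gamma>" and z1: "1 < (2 + \<delta>) * \<gamma>"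
    and X: "rough_bound \<gamma> K J X XX" and X': "rough_bound \<gamma> K J X' XX'"
    and dX: "\<And>s t. s \<in> J \<Longrightarrow> t \<in> J \<Longrightarrow> norm (incr X s t - incr X' s t) \<le> r * \<bar>t - s\<bar> powr \<gamma>"
    and dXX: "\<And>s t. s \<in> J \<Longrightarrow> t \<in> J \<Longrightarrow> norm (XX s t - XX' s t) \<le> r * \<bar>t - s\<bar> powr (2 * \<gamma>)"
    and YH: "\<And>s t. s \<in> J \<Longrightarrow> t \<in> J \<Longrightarrow> norm (incr Y s t) \<le> K * \<bar>t - s\<bar> powr \<gamma>"
    and YH': "\<And>s t. s \<in> J \<Longrightarrow> t \<in> J \<Longrightarrow> norm (incr Y' s t) \<le> K * \<bar>t - s\<bar> powr \<gamma>"
    and YR': "\<And>s t. s \<in> J \<Longrightarrow> t \<in> J \<Longrightarrow>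
      norm (incr Y' s t - \<phi>' (Y' s) (incr X' s t)) \<le> K * \<bar>t - s\<bar> powr (2 * \<gamma>)"
    and Yd: "davie ((2 + \<delta>) * \<gamma>) J \<phi> X XX Y" and Yd': "davie ((2 + \<delta>) * \<gamma>) J \<phi>' X' XX' Y'"
begin

definition dY :: "real \<Rightarrow> real \<Rightarrow> real ^ 'n" where
  "dY s t = incr Y s t - incr Y' s t"

definition dR :: "real \<Rightarrow> real \<Rightarrow> real ^ 'n" where
  "dR s t = (incr Y s t - \<phi> (Y s) (incr X s t)) - (incr Y' s t - \<phi>' (Y' s) (incr X' s t))"

definition dQ :: "real \<Rightarrow> real \<Rightarrow> real ^ 'n" where
  "dQ s t = (milstein \<phi> X XX (Y s) s t - incr Y s t) - (milstein \<phi>' X' XX' (Y' s) s t - incr Y' s t)"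

definition \<theta> :: real where "\<theta> = 2 powr (1 - (2 + \<delta>) * \<gamma>)"

definition q :: real where "q = c * K ^ 3"

text \<open>The weight of the error bound relative to the increment bound. It is chosen so large that the
  increments enter the next error bound with the factor \<open>(1 - \<theta>) / 4\<close>.\<close>

definition A :: real where "A = 20 * (10 * c * K ^ 4) * q / (1 - \<theta>)"

text \<open>Increments and errors share one constant \<open>p\<close>, so that a single bootstrap improves both.\<close>

definition regular :: "real set \<Rightarrow> real \<Rightarrow> bool" where
  "regular I p \<longleftrightarrow> (\<forall>u\<in>I. \<forall>v\<in>I. norm (dY u v) \<le> p * \<bar>v - u\<bar> powr \<gamma> \<and>
     norm (dQ u v) \<le> A * p * \<bar>v - u\<bar> powr ((2 + \<delta>) * \<gamma>))"

definition gap :: "real \<Rightarrow> real" where "gap t = norm (Y t - Y' t)"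

lemma gap_nonneg: "0 \<le> gap t" by (simp add: gap_def)

lemma \<theta>: "0 < \<theta>" "\<theta> < 1"
  using z1 powr_less_mono[of "1 - (2 + \<delta>) * \<gamma>" 0 2] by (simp_all add: \<theta>_def)

lemma q1: "1 \<le> q"
  using mult_mono[OF c1 powers_ge_one(6)[OF K1]] c1 by (simp add: q_def)

lemma A_pos: "0 < A"
  unfolding A_def using q1 c1 K1 \<theta> by (intro divide_pos_pos mult_pos_pos) auto

lemma powr_split:
  "L powr (2 * \<gamma>) = (L powr \<gamma>)\<^sup>2" "L powr ((2 + \<delta>) * \<gamma>) = (L powr \<gamma>)\<^sup>2 * (L powr \<gamma>) powr \<delta>"
  by (simp_all add: power2_eq_square powr_powr algebra_simps flip: powr_add)

lemma field_difference:
  assumes "s \<in> J" "t \<in> J" "gap s \<le> E"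
  shows "norm (\<phi> (Y s) (incr X s t) - \<phi>' (Y' s) (incr X' s t)) \<le> 2 * K\<^sup>2 * (E + r) * \<bar>t - s\<bar> powr \<gamma>"
proof -
  have "0 \<le> E" using gap_nonneg[of s] assms(3) by linarith
  then show ?thesis
    using assms rough_boundD[OF X] dX by (intro field_apply_difference) (auto simp: gap_def)
qed

lemma second_difference:
  assumes "s \<in> J" "t \<in> J" "gap s \<le> E"
  shows "norm (contract2 (second_field \<phi> (Y s)) (XX s t) - contract2 (second_field \<phi>' (Y' s)) (XX' s t))
    \<le> 3 * q * (E + r) * \<bar>t - s\<bar> powr (2 * \<gamma>)"
proof -
  have "norm (contract2 (second_field \<phi> (Y s)) (XX s t) - contract2 (second_field \<phi>' (Y' s)) (XX' s t))
    \<le> 3 * c * K ^ 3 * (E + r) * \<bar>t - s\<bar> powr (2 * \<gamma>)"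
  proof -
    have "0 \<le> E" using gap_nonneg[of s] assms(3) by linarith
    then show ?thesis
      using assms rough_boundD[OF X] dXX by (intro second_order_difference) (auto simp: gap_def)
  qed
  then show ?thesis by (simp add: q_def mult.assoc)
qed

lemma dR_eq: "dR s t = (contract2 (second_field \<phi> (Y s)) (XX s t)
    - contract2 (second_field \<phi>' (Y' s)) (XX' s t)) - dQ s t"
  by (simp add: dR_def dQ_def milstein_def)

lemma dY_eq: "dY s t = (\<phi> (Y s) (incr X s t) - \<phi>' (Y' s) (incr X' s t)) + dR s t"
  by (simp add: dR_def dY_def)

lemma dR_bound:
  assumes st: "s \<in> J" "t \<in> J" "gap s \<le> E"
    and Q: "norm (dQ s t) \<le> B * \<bar>t - s\<bar> powr ((2 + \<delta>) * \<gamma>)" "0 \<le> B"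
    and w: "(\<bar>t - s\<bar> powr \<gamma>) powr \<delta> \<le> \<omega>"
  shows "norm (dR s t) \<le> (3 * q * (E + r) + B * \<omega>) * \<bar>t - s\<bar> powr (2 * \<gamma>)"
proof -
  have "norm (dR s t) \<le> 3 * q * (E + r) * \<bar>t - s\<bar> powr (2 * \<gamma>) + B * \<bar>t - s\<bar> powr ((2 + \<delta>) * \<gamma>)"
    unfolding dR_eq by (intro order_trans[OF norm_triangle_ineq4] add_mono second_difference st Q)
  also have "B * \<bar>t - s\<bar> powr ((2 + \<delta>) * \<gamma>) \<le> B * (\<bar>t - s\<bar> powr (2 * \<gamma>) * \<omega>)"
    unfolding powr_split using Q w by (intro mult_left_mono) auto
  finally show ?thesis by (simp add: algebra_simps)
qed

text \<open>The increments of the difference are a first-order term, controlled by the gap at the base point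
  and by \<open>p \<omega>\<close>, plus the error, which gains the factor \<open>\<omega>\<close> against the increments. The errors are
  halved as usual; the difference of the defects costs \<open>(1 - \<theta>) / 4\<close> through the weight \<open>A\<close> and
  another \<open>(1 - \<theta>) / 4\<close> through the smallness of \<open>\<omega>\<close>. Together with \<open>\<theta>\<close> this makes
  \<open>(1 + \<theta>) / 2 < 1\<close>.\<close>

lemma regular_step:
  assumes I: "I \<subseteq> J" "is_interval I" "\<And>u v. u \<in> I \<Longrightarrow> v \<in> I \<Longrightarrow> \<bar>v - u\<bar> \<le> h"
    and h: "0 < h" "h \<le> 1" and \<omega>: "\<omega> = (h powr \<gamma>) powr \<delta>"
    and small: "10 * c * K ^ 4 * \<omega> \<le> (1 - \<theta>) / 4" "(5 * q + A) * \<omega> \<le> 1 / 2"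
    and a: "a \<in> I" and p: "0 \<le> p" "regular I p"
  shows "regular I ((1 + \<theta>) / 2 * p + 5 * q * (gap a + r))"
proof -
  define z where "z = (2 + \<delta>) * \<gamma>"
  define k where "k = 5 * q * (gap a + r)"
  note pow = powers_ge_one[OF K1]
  have dYp: "norm (dY u v) \<le> p * \<bar>v - u\<bar> powr \<gamma>" and dQp: "norm (dQ u v) \<le> A * p * \<bar>v - u\<bar> powr z"
    if "u \<in> I" "v \<in> I" for u v using p that by (auto simp: regular_def z_def)
  have IJ: "u \<in> J" if "u \<in> I" for u using that I by auto
  have Ap: "0 \<le> A * p" using A_pos p by simp
  have \<omega>0: "0 \<le> \<omega>" by (simp add: \<omega>)
  have h\<omega>: "h powr \<gamma> \<le> \<omega>"
  proof -
    have "(h powr \<gamma>) powr 1 \<le> (h powr \<gamma>) powr \<delta>"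
      using h \<gamma> \<delta> by (intro powr_mono') (auto intro: powr_le1)
    then show ?thesis by (simp add: \<omega>)
  qed
  have scale: "(\<bar>v - u\<bar> powr \<gamma>) powr \<delta> \<le> \<omega>" "\<bar>v - u\<bar> powr \<gamma> \<le> 1"
      "\<bar>v - u\<bar> powr \<gamma> \<le> (\<bar>v - u\<bar> powr \<gamma>) powr \<delta>" "\<bar>v - u\<bar> powr \<gamma> \<le> \<omega>"
    if "u \<in> I" "v \<in> I" for u v
  proof -
    show le: "\<bar>v - u\<bar> powr \<gamma> \<le> 1" using I(3)[OF that] h \<gamma> by (intro powr_le1) auto
    have hg: "\<bar>v - u\<bar> powr \<gamma> \<le> h powr \<gamma>" using I(3)[OF that] \<gamma> by (intro powr_mono2) auto
    then show "\<bar>v - u\<bar> powr \<gamma> \<le> \<omega>" using h\<omega> by linarith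
    show "(\<bar>v - u\<bar> powr \<gamma>) powr \<delta> \<le> \<omega>" unfolding \<omega> by (rule powr_mono2[OF _ _ hg]) (use \<delta> in auto)
    have "(\<bar>v - u\<bar> powr \<gamma>) powr 1 \<le> (\<bar>v - u\<bar> powr \<gamma>) powr \<delta>" using le \<delta> by (intro powr_mono') auto
    then show "\<bar>v - u\<bar> powr \<gamma> \<le> (\<bar>v - u\<bar> powr \<gamma>) powr \<delta>" by simp
  qed
  have gap\<omega>: "gap u \<le> gap a + p * \<omega>" if "u \<in> I" for u
  proof -
    have "gap u \<le> gap a + norm (dY a u)"
      using norm_triangle_ineq[of "Y a - Y' a" "dY a u"] by (simp add: gap_def dY_def incr_def)
    also have "norm (dY a u) \<le> p * \<bar>u - a\<bar> powr \<gamma>" by (rule dYp[OF a that])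
    also have "\<dots> \<le> p * \<omega>" using p scale(4)[OF a that] by (intro mult_left_mono) auto
    finally show ?thesis by simp
  qed
  have "\<omega> \<le> 1" using h by (auto simp: \<omega> intro!: powr_le1 \<gamma>[THEN less_imp_le] \<delta>(1)[THEN less_imp_le])
  then have "p * \<omega> \<le> p * 1" using p by (intro mult_left_mono)
  then have gap1: "gap u \<le> gap a + p" if "u \<in> I" for u using gap\<omega>[OF that] by linarith
  have 1: "norm (dY u v) \<le> ((1 + \<theta>) / 2 * p + k) * \<bar>v - u\<bar> powr \<gamma>" if uv: "u \<in> I" "v \<in> I" for u v
  proof -
    define x where "x = \<bar>v - u\<bar> powr \<gamma>"
    define E where "E = gap a + p * \<omega>"
    have x: "0 \<le> x" "x \<le> 1" "x \<le> \<omega>" using scale[OF uv] by (auto simp: x_def)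
    have E: "0 \<le> E + r" using gap_nonneg[of a] p \<omega>0 r0 by (simp add: E_def)
    have "norm (dR u v) \<le> (3 * q * (E + r) + A * p * \<omega>) * x\<^sup>2"
      using dR_bound[OF IJ[OF uv(1)] IJ[OF uv(2)] gap\<omega>[OF uv(1)] dQp[OF uv, unfolded z_def] Ap scale(1)[OF uv]]
      by (simp add: E_def x_def powr_split)
    also have "\<dots> \<le> (3 * q * (E + r) + A * p * \<omega>) * x"
      using x q1 E Ap \<omega>0 mult_left_mono[OF x(2,1)] by (intro mult_left_mono) (auto simp: power2_eq_square)
    finally have "norm (dY u v) \<le> 2 * K\<^sup>2 * (E + r) * x + (3 * q * (E + r) + A * p * \<omega>) * x"
      unfolding dY_eq x_def using uv by (intro norm_triangle_mono field_difference IJ gap\<omega>[folded E_def])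
    also have "2 * K\<^sup>2 * (E + r) * x \<le> 2 * q * (E + r) * x"
    proof -
      have "1 * K\<^sup>2 \<le> c * K ^ 3" using pow c1 by (intro mult_mono) auto
      then show ?thesis using E x by (intro mult_right_mono) (auto simp: q_def)
    qed
    also have "2 * q * (E + r) * x + (3 * q * (E + r) + A * p * \<omega>) * x = (k + (5 * q + A) * \<omega> * p) * x"
      by (simp add: k_def E_def algebra_simps)
    also have "\<dots> \<le> (k + (1 + \<theta>) / 2 * p) * x"
    proof -
      have "(5 * q + A) * \<omega> \<le> (1 + \<theta>) / 2" using small(2) \<theta> by simp
      then show ?thesis using x p by (intro mult_right_mono add_left_mono) auto
    qed
    finally show ?thesis by (simp add: x_def add.commute)
  qed
  have 2: "norm (dQ u v) \<le> A * ((1 + \<theta>) / 2 * p + k) * \<bar>v - u\<bar> powr z" if uv: "u \<in> I" "v \<in> I" for u v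
  proof -
    define m where "m = (u + v) / 2"
    have m: "m \<in> I"
      by (rule mem_is_interval_1_I[OF I(2), of "min u v" "max u v"])
        (use uv in \<open>auto simp: m_def min_def max_def\<close>)
    note J3 = IJ[OF uv(1)] IJ[OF m] IJ[OF uv(2)]
    define L where "L = \<bar>v - u\<bar>"
    have half: "\<bar>m - u\<bar> = L / 2" "\<bar>v - m\<bar> = L / 2" by (auto simp: m_def L_def field_simps)
    define x w where "x = L powr \<gamma>" and "w = x powr \<delta>"
    have L: "0 \<le> L" by (simp add: L_def)
    have x: "0 \<le> x" "x \<le> 1" "x \<le> w" using scale[OF uv] by (auto simp: x_def w_def L_def)
    have mono: "B * \<bar>l\<bar> powr \<gamma> \<le> B * x" "B * \<bar>l\<bar> powr (2 * \<gamma>) \<le> B * x\<^sup>2"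
      if "\<bar>l\<bar> = L / 2" "0 \<le> B" for B l
      using that L \<gamma> unfolding x_def powr_split(1)[symmetric] by (auto intro!: mult_left_mono powr_mono2)
    define E G where "E = gap a + p" and "G = 3 * q * (gap a + p + r) + A * p * \<omega>"
    have nn: "0 \<le> E" "0 \<le> p" "0 \<le> G"
      using gap_nonneg[of a] p q1 r0 Ap \<omega>0 by (auto simp: E_def G_def)
    let ?F = "field_increment_error \<phi> (Y u) (Y m) (incr X u m) (incr X m v)
         + contract2 (second_field \<phi> (Y m) - second_field \<phi> (Y u)) (XX m v)"
    let ?F' = "field_increment_error \<phi>' (Y' u) (Y' m) (incr X' u m) (incr X' m v)
         + contract2 (second_field \<phi>' (Y' m) - second_field \<phi>' (Y' u)) (XX' m v)"
    have F: "norm (?F - ?F') \<le> 10 * c * K ^ 4 * (E + p + G + r) * (x\<^sup>2 * w)"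
    proof (rule defect_difference[OF x w_def nn])
      show "norm (Y u - Y' u) \<le> E" using gap1[OF uv(1)] by (simp add: gap_def E_def)
      have "norm (dY u m) \<le> p * x"
        using dYp[OF uv(1) m] mono(1)[OF half(1) p(1)] by linarith
      then show "norm ((Y m - Y u) - (Y' m - Y' u)) \<le> p * x" by (simp add: dY_def incr_def)
      show "norm (Y m - Y u) \<le> K * x" "norm (Y' m - Y' u) \<le> K * x"
        using YH[OF J3(1,2)] YH'[OF J3(1,2)] mono(1)[OF half(1) pow(1)] by (simp_all add: incr_def)
      show "norm (Y' m - Y' u - \<phi>' (Y' u) (incr X' u m)) \<le> K * x\<^sup>2"
        using YR'[OF J3(1,2)] mono(2)[OF half(1) pow(1)] by (simp add: incr_def)
      have "norm (dR u m) \<le> G * \<bar>m - u\<bar> powr (2 * \<gamma>)"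
        unfolding G_def
        by (rule dR_bound[OF J3(1,2) gap1[OF uv(1)] dQp[OF uv(1) m, unfolded z_def] Ap scale(1)[OF uv(1) m]])
      also have "\<dots> \<le> G * x\<^sup>2" by (rule mono(2)[OF half(1) nn(3)])
      finally show "norm ((Y m - Y u - \<phi> (Y u) (incr X u m)) - (Y' m - Y' u - \<phi>' (Y' u) (incr X' u m))) \<le> G * x\<^sup>2"
        by (simp add: dR_def incr_def)
      show "norm (incr X m v) \<le> K * x" "norm (XX m v) \<le> K * x\<^sup>2"
        using rough_boundD[OF X J3(2,3)] mono[OF half(2) pow(1)] by linarith+
      show "norm (incr X m v - incr X' m v) \<le> r * x" "norm (XX m v - XX' m v) \<le> r * x\<^sup>2"
        using dX[OF J3(2,3)] dXX[OF J3(2,3)] mono[OF half(2) r0] by linarith+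
    qed
    have split: "dQ u v = dQ u m + dQ m v - (?F - ?F')"
      using milstein_defect[OF X J3, of \<phi> "Y u" "Y m"] milstein_defect[OF X' J3, of \<phi>' "Y' u" "Y' m"]
      by (simp add: dQ_def incr_def algebra_simps)
    have halves: "norm (dQ u m) \<le> A * p * (L / 2) powr z" "norm (dQ m v) \<le> A * p * (L / 2) powr z"
      using dQp[OF uv(1) m] dQp[OF m uv(2)] by (simp_all add: half)
    have "norm (dQ u v) \<le> A * p * (L / 2) powr z + A * p * (L / 2) powr z
        + 10 * c * K ^ 4 * (E + p + G + r) * (x\<^sup>2 * w)"
      unfolding split
      by (rule order_trans[OF norm_triangle_ineq4 add_mono[OF norm_triangle_mono[OF halves] F]])
    also have "\<dots> = (\<theta> * A * p + 10 * c * K ^ 4 * (E + p + G + r)) * (x\<^sup>2 * w)"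
    proof -
      have "(L / 2) powr z = \<theta> / 2 * L powr z"
        using L by (simp add: powr_divide powr_diff \<theta>_def z_def)
      also have "L powr z = x\<^sup>2 * w" by (simp add: z_def x_def w_def powr_split)
      finally have "(L / 2) powr z = \<theta> / 2 * (x\<^sup>2 * w)" .
      then show ?thesis by (simp add: algebra_simps)
    qed
    also have "\<dots> \<le> (A * ((1 + \<theta>) / 2 * p + k)) * (x\<^sup>2 * w)"
    proof (rule mult_right_mono)
      define g where "g = gap a + r"
      define C0 where "C0 = 10 * c * K ^ 4"
      have C0: "0 \<le> C0" using c1 pow by (simp add: C0_def)
      have g: "0 \<le> g" using gap_nonneg r0 by (simp add: g_def)
      have qg: "g + p \<le> q * (g + p)" "p \<le> q * p"
        using mult_right_mono[OF q1, of "g + p"] mult_right_mono[OF q1, of p] g p by auto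
      have "E + p + G + r = (g + p) + p + 3 * (q * (g + p)) + A * p * \<omega>"
        by (simp add: E_def G_def g_def algebra_simps)
      also have "\<dots> \<le> 5 * q * (g + p) + A * p * \<omega>"
        using qg mult_nonneg_nonneg[OF order_trans[OF zero_le_one q1] g] by (simp add: algebra_simps)
      finally have "C0 * (E + p + G + r) \<le> C0 * (5 * q * (g + p) + A * p * \<omega>)"
        using C0 by (intro mult_left_mono)
      also have "\<dots> = A * ((1 - \<theta>) / 4 * (g + p)) + A * p * (C0 * \<omega>)"
      proof -
        have "5 * q * C0 = A * ((1 - \<theta>) / 4)" using \<theta> by (simp add: A_def C0_def)
        then have "C0 * (5 * q * (g + p)) = A * ((1 - \<theta>) / 4) * (g + p)" by (metis mult.assoc mult.commute)
        then show ?thesis by (simp add: distrib_left mult_ac)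
      qed
      also have "\<dots> \<le> A * ((1 - \<theta>) / 4 * (g + p)) + A * p * ((1 - \<theta>) / 4)"
        using small(1) Ap by (intro add_left_mono mult_left_mono) (auto simp: C0_def)
      finally have "\<theta> * A * p + C0 * (E + p + G + r) \<le> A * ((1 + \<theta>) / 2 * p + (1 - \<theta>) / 4 * g)"
        by (simp add: field_simps)
      also have "\<dots> \<le> A * ((1 + \<theta>) / 2 * p + k)"
        unfolding k_def g_def[symmetric] using A_pos \<theta> q1 g by (intro mult_left_mono add_left_mono mult_right_mono) auto
      finally show "\<theta> * A * p + 10 * c * K ^ 4 * (E + p + G + r) \<le> A * ((1 + \<theta>) / 2 * p + k)"
        by (simp add: C0_def)
    qed (use x in simp)
    finally show ?thesis by (simp add: x_def w_def L_def z_def powr_split)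
  qed
  show ?thesis using 1 2 by (simp add: regular_def k_def z_def)
qed

text \<open>The segment from \<open>s\<close> to \<open>t\<close> is short, and both solutions have finite constants of their own,
  which start the bootstrap.\<close>

lemma local_estimate:
  assumes st: "s \<in> J" "t \<in> J" "\<bar>t - s\<bar> \<le> h"
    and h: "0 < h" "h \<le> 1" and \<omega>: "\<omega> = (h powr \<gamma>) powr \<delta>"
    and small: "10 * c * K ^ 4 * \<omega> \<le> (1 - \<theta>) / 4" "(5 * q + A) * \<omega> \<le> 1 / 2"
    and M: "M = 5 * q / (1 - (1 + \<theta>) / 2)"
  shows "norm (dY s t) \<le> M * (gap s + r) * \<bar>t - s\<bar> powr \<gamma>"
    and "norm (dR s t) \<le> (3 * q + A * M) * (gap s + r) * \<bar>t - s\<bar> powr (2 * \<gamma>)"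
proof -
  define I where "I = closed_segment s t"
  have "I \<subseteq> J"
    unfolding I_def using st interval by (intro closed_segment_subset is_interval_convex)
  moreover have "is_interval I" by (simp add: I_def is_interval_closed_segment_1)
  moreover have "\<bar>v - u\<bar> \<le> h" if "u \<in> I" "v \<in> I" for u v
    using that st(3) unfolding I_def closed_segment_eq_real_ivl by (auto split: if_splits)
  moreover have I: "s \<in> I" "t \<in> I" by (auto simp: I_def)
  ultimately have step: "regular I ((1 + \<theta>) / 2 * p + 5 * q * (gap s + r))" if "0 \<le> p" "regular I p" for p
    using h \<omega> small that by (intro regular_step)
  have k: "0 \<le> 5 * q * (gap s + r)" using q1 gap_nonneg[of s] r0 by simp
  obtain C C' where C: "0 \<le> C" "0 \<le> C'"
    "\<And>s t. s \<in> J \<Longrightarrow> t \<in> J \<Longrightarrow> norm (milstein \<phi> X XX (Y s) s t - incr Y s t) \<le> C * \<bar>t - s\<bar> powr ((2 + \<delta>) * \<gamma>)"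
    "\<And>s t. s \<in> J \<Longrightarrow> t \<in> J \<Longrightarrow> norm (milstein \<phi>' X' XX' (Y' s) s t - incr Y' s t) \<le> C' * \<bar>t - s\<bar> powr ((2 + \<delta>) * \<gamma>)"
    using Yd Yd' by (auto simp: davie_def)
  \<comment> \<open>Finite, but without any relation to the distance of the data.\<close>
  define p0 where "p0 = 2 * K + (C + C') / A"
  have p0: "0 \<le> p0" "2 * K \<le> p0" "C + C' \<le> A * p0"
    using C A_pos K1 by (auto simp: p0_def field_simps)
  have "regular I p0"
    unfolding regular_def
  proof (intro ballI conjI)
    fix u v assume "u \<in> I" "v \<in> I"
    then have uv: "u \<in> J" "v \<in> J" using \<open>I \<subseteq> J\<close> by auto
    have "norm (dY u v) \<le> K * \<bar>v - u\<bar> powr \<gamma> + K * \<bar>v - u\<bar> powr \<gamma>"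
      unfolding dY_def by (rule order_trans[OF norm_triangle_ineq4 add_mono[OF YH[OF uv] YH'[OF uv]]])
    also have "\<dots> \<le> p0 * \<bar>v - u\<bar> powr \<gamma>" using mult_right_mono[OF p0(2), of "\<bar>v - u\<bar> powr \<gamma>"] by simp
    finally show "norm (dY u v) \<le> p0 * \<bar>v - u\<bar> powr \<gamma>" .
    have "norm (dQ u v) \<le> C * \<bar>v - u\<bar> powr ((2 + \<delta>) * \<gamma>) + C' * \<bar>v - u\<bar> powr ((2 + \<delta>) * \<gamma>)"
      unfolding dQ_def by (rule order_trans[OF norm_triangle_ineq4 add_mono[OF C(3)[OF uv] C(4)[OF uv]]])
    also have "\<dots> = (C + C') * \<bar>v - u\<bar> powr ((2 + \<delta>) * \<gamma>)" by (simp add: distrib_right)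
    also have "\<dots> \<le> A * p0 * \<bar>v - u\<bar> powr ((2 + \<delta>) * \<gamma>)" using p0 by (intro mult_right_mono) auto
    finally show "norm (dQ u v) \<le> A * p0 * \<bar>v - u\<bar> powr ((2 + \<delta>) * \<gamma>)" .
  qed
  note boot = contraction_bootstrap[where P = "regular I", OF this p0(1) step _ _ k]
  have M': "5 * q * (gap s + r) / (1 - (1 + \<theta>) / 2) = M * (gap s + r)" by (simp add: M)
  show "norm (dY s t) \<le> M * (gap s + r) * \<bar>t - s\<bar> powr \<gamma>"
    unfolding M'[symmetric] by (rule boot) (use \<theta> I in \<open>auto simp: regular_def\<close>)
  have "norm (dQ s t) \<le> 5 * q * (gap s + r) / (1 - (1 + \<theta>) / 2) * (A * \<bar>t - s\<bar> powr ((2 + \<delta>) * \<gamma>))"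
    by (rule boot) (use \<theta> I A_pos in \<open>auto simp: regular_def mult_ac\<close>)
  then have Q: "norm (dQ s t) \<le> A * (M * (gap s + r)) * \<bar>t - s\<bar> powr ((2 + \<delta>) * \<gamma>)"
    unfolding M' by (simp add: mult_ac)
  have "0 \<le> M" using \<theta> q1 by (simp add: M)
  then have B: "0 \<le> A * (M * (gap s + r))" using A_pos gap_nonneg[of s] r0 by simp
  have "\<bar>t - s\<bar> powr \<gamma> \<le> 1" using st(3) h \<gamma> by (intro powr_le1) auto
  then have "(\<bar>t - s\<bar> powr \<gamma>) powr \<delta> \<le> 1" using \<delta> by (intro powr_le1) auto
  from dR_bound[OF st(1,2) order_refl Q B this]
  show "norm (dR s t) \<le> (3 * q + A * M) * (gap s + r) * \<bar>t - s\<bar> powr (2 * \<gamma>)"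
    by (simp add: algebra_simps)
qed

end

context rde_setting
begin

text \<open>The constants are chosen before the data: \<open>h\<close>, and with it the number \<open>n\<close> of short intervals
  needed to cover \<open>J\<close>, depends on the data through \<open>K\<close> only. Over each of them \<open>|Y - Y~| + r\<close>
  grows at most by the factor \<open>1 + M1\<close>. Over times farther apart than \<open>h\<close> the increments are
  bounded by the uniform distance.\<close>

theorem ito_lipschitz:
  assumes K1: "1 \<le> K"
  obtains M where "0 \<le> M"
    "\<And>r \<phi> \<phi>' X X' XX XX' Y Y' s t. \<lbrakk>solution_pair \<delta> K r (\<phi> :: 'n::finite vfield) \<phi>' \<gamma> J X X' XX XX' Y Y'; s \<in> J; t \<in> J\<rbrakk>
      \<Longrightarrow> norm (Y t - Y' t) + r \<le> M * (norm (Y t0 - Y' t0) + r) \<and>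
        norm (incr Y s t - incr Y' s t) \<le> M * (norm (Y t0 - Y' t0) + r) * \<bar>t - s\<bar> powr \<gamma> \<and>
        norm ((incr Y s t - \<phi> (Y s) (incr X s t)) - (incr Y' s t - \<phi>' (Y' s) (incr X' s t)))
          \<le> M * (norm (Y t0 - Y' t0) + r) * \<bar>t - s\<bar> powr (2 * \<gamma>)"
proof -
  define c where "c = (real CARD('n))\<^sup>2"
  have c1: "1 \<le> c" by (simp add: c_def Suc_leI)
  define \<theta> where "\<theta> = 2 powr (1 - (2 + \<delta>) * \<gamma>)"
  have \<theta>: "0 < \<theta>" "\<theta> < 1"
    using z powr_less_mono[of "1 - (2 + \<delta>) * \<gamma>" 0 2] by (simp_all add: \<theta>_def)
  define q where "q = c * K ^ 3"
  have q1: "1 \<le> q" using mult_mono[OF c1 powers_ge_one(6)[OF K1]] c1 by (simp add: q_def)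
  define A where "A = 20 * (10 * c * K ^ 4) * q / (1 - \<theta>)"
  have "0 < A" unfolding A_def using q1 c1 K1 \<theta> by (intro divide_pos_pos mult_pos_pos) auto
  have C0: "0 < 10 * c * K ^ 4" using c1 K1 by simp
  define \<eta> where "\<eta> = min ((1 - \<theta>) / 4 / (10 * c * K ^ 4)) (1 / 2 / (5 * q + A))"
  have "0 < \<eta>" using \<theta> C0 q1 \<open>0 < A\<close> by (simp add: \<eta>_def)
  then obtain h where h: "0 < h" "h \<le> 1" "h powr (\<gamma> * \<delta>) \<le> \<eta>"
    using small_powr[of \<eta> "\<gamma> * \<delta>"] \<gamma> \<delta> by auto
  define \<omega> where "\<omega> = (h powr \<gamma>) powr \<delta>"
  have \<omega>: "\<omega> \<le> (1 - \<theta>) / 4 / (10 * c * K ^ 4)" "\<omega> \<le> 1 / 2 / (5 * q + A)"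
    using h(3) by (auto simp: \<omega>_def powr_powr \<eta>_def)
  have small: "10 * c * K ^ 4 * \<omega> \<le> (1 - \<theta>) / 4" "(5 * q + A) * \<omega> \<le> 1 / 2"
  proof -
    show "10 * c * K ^ 4 * \<omega> \<le> (1 - \<theta>) / 4" using \<omega>(1) C0 by (simp only: pos_le_divide_eq mult.commute)
    have "0 < 5 * q + A" using q1 \<open>0 < A\<close> by simp
    then show "(5 * q + A) * \<omega> \<le> 1 / 2" using \<omega>(2) by (simp only: pos_le_divide_eq mult.commute)
  qed
  define M1 where "M1 = 5 * q / (1 - (1 + \<theta>) / 2)"
  define M2 where "M2 = 3 * q + A * M1"
  have M1: "0 \<le> M1" "0 \<le> M2" using \<theta> q1 \<open>0 < A\<close> by (auto simp: M1_def M2_def)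
  obtain D where D: "1 \<le> D" "\<And>s t. s \<in> J \<Longrightarrow> t \<in> J \<Longrightarrow> \<bar>t - s\<bar> \<le> D"
    using bounded_diameter[OF J(2)] by blast
  obtain n where n: "D \<le> real n * h"
    using reals_Archimedean3[OF h(1)] by (meson less_imp_le)
  define B where "B = (1 + M1) ^ n"
  have B: "1 \<le> B" using M1 by (simp add: B_def one_le_power)
  define M where "M = B + (M1 * B + 2 * B / h powr \<gamma>) + (M2 * B + (2 * B + 2 * K\<^sup>2 * B * D powr \<gamma>) / h powr (2 * \<gamma>))"
  have M0: "0 \<le> M1 * B" "0 \<le> 2 * B / h powr \<gamma>" "0 \<le> M2 * B"
      "0 \<le> (2 * B + 2 * K\<^sup>2 * B * D powr \<gamma>) / h powr (2 * \<gamma>)"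
    using M1 B by auto
  show thesis
  proof (rule that)
    show "0 \<le> M" using M0 B by (simp add: M_def)
  next
    fix r and \<phi> \<phi>' :: "'n vfield" and X X' XX XX' Y Y' s t
    assume "solution_pair \<delta> K r \<phi> \<phi>' \<gamma> J X X' XX XX' Y Y'" and st: "s \<in> J" "t \<in> J"
    then interpret P: solution_pair \<delta> K r \<phi> \<phi>' \<gamma> J X X' XX XX' Y Y' by simp
    have eqs: "P.c = c" "P.\<theta> = \<theta>" "P.q = q" "P.A = A"
      by (simp_all add: P.c_def c_def P.\<theta>_def \<theta>_def P.q_def q_def P.A_def A_def)
    have loc: "norm (P.dY s t) \<le> M1 * (P.gap s + r) * \<bar>t - s\<bar> powr \<gamma>"
      "norm (P.dR s t) \<le> M2 * (P.gap s + r) * \<bar>t - s\<bar> powr (2 * \<gamma>)"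
      if "s \<in> J" "t \<in> J" "\<bar>t - s\<bar> \<le> h" for s t
      using P.local_estimate[OF that h(1,2) \<omega>_def] small unfolding eqs M2_def M1_def by blast+
    have pos: "0 \<le> P.gap t + r" for t using P.gap_nonneg[of t] P.r0 by simp
    define \<rho> where "\<rho> = P.gap t0 + r"
    have \<rho>: "0 \<le> \<rho>" using pos by (simp add: \<rho>_def)
    have chain: "P.gap t + r \<le> (1 + M1) ^ m * \<rho>" if "t \<in> J" "\<bar>t - t0\<bar> \<le> real m * h" for t m
    proof (rule interval_chain_induct[OF h(1) J(3,1) _ _ _ that])
      show "P.gap t0 + r \<le> (1 + M1) ^ m * \<rho>" for m
        using mult_right_mono[OF one_le_power[of "1 + M1" m] \<rho>] M1 by (simp add: \<rho>_def)
    next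
      fix m s t assume s: "s \<in> J" "t \<in> J" "\<bar>t - s\<bar> \<le> h" "P.gap s + r \<le> (1 + M1) ^ m * \<rho>"
      have "P.gap t \<le> P.gap s + norm (P.dY s t)"
        using norm_triangle_ineq[of "Y s - Y' s" "P.dY s t"] by (simp add: P.gap_def P.dY_def incr_def)
      also have "norm (P.dY s t) \<le> M1 * (P.gap s + r) * \<bar>t - s\<bar> powr \<gamma>" by (rule loc(1)[OF s(1-3)])
      also have "\<dots> \<le> M1 * (P.gap s + r) * 1"
        using s(3) h(2) \<gamma> M1 pos[of s] by (intro mult_left_mono powr_le1) auto
      finally have "P.gap t + r \<le> (1 + M1) * (P.gap s + r)" by (simp add: algebra_simps)
      also have "\<dots> \<le> (1 + M1) * ((1 + M1) ^ m * \<rho>)" using s(4) M1 by (intro mult_left_mono) auto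
      finally show "P.gap t + r \<le> (1 + M1) ^ Suc m * \<rho>" by (simp add: mult_ac)
    next
      fix m t assume *: "P.gap t + r \<le> (1 + M1) ^ m * \<rho>"
      have "(1 + M1) ^ m * \<rho> \<le> (1 + M1) ^ Suc m * \<rho>"
        using M1 \<rho> by (intro mult_right_mono power_increasing) auto
      then show "P.gap t + r \<le> (1 + M1) ^ Suc m * \<rho>" using * by linarith
    qed
    have gapB: "P.gap t + r \<le> B * \<rho>" if "t \<in> J" for t
      unfolding B_def using D(2)[OF J(3) that] n by (intro chain that) linarith
    have gapB': "P.gap t \<le> B * \<rho>" if "t \<in> J" for t using gapB[OF that] P.r0 by linarith
    have dYfar: "norm (P.dY s t) \<le> 2 * B * \<rho>"
      using norm_triangle_ineq4[of "Y t - Y' t" "Y s - Y' s"] gapB'[OF st(1)] gapB'[OF st(2)]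
      by (simp add: P.gap_def P.dY_def incr_def algebra_simps)
    have 1: "norm (P.dY s t) \<le> M * \<rho> * \<bar>t - s\<bar> powr \<gamma>"
    proof (cases "\<bar>t - s\<bar> \<le> h")
      case True
      have "norm (P.dY s t) \<le> M1 * (P.gap s + r) * \<bar>t - s\<bar> powr \<gamma>" by (rule loc(1)[OF st True])
      also have "\<dots> \<le> M1 * (B * \<rho>) * \<bar>t - s\<bar> powr \<gamma>"
        using gapB[OF st(1)] M1 by (intro mult_right_mono mult_left_mono) auto
      also have "\<dots> = M1 * B * \<rho> * \<bar>t - s\<bar> powr \<gamma>" by simp
      also have "\<dots> \<le> M * \<rho> * \<bar>t - s\<bar> powr \<gamma>"
        using M0 B \<rho> by (intro mult_right_mono) (auto simp: M_def)
      finally show ?thesis .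
    next
      case False
      have "2 * B * \<rho> = 2 * B / h powr \<gamma> * \<rho> * h powr \<gamma>" using h by simp
      also have "\<dots> \<le> M * \<rho> * \<bar>t - s\<bar> powr \<gamma>"
        using M0 B \<rho> False h \<gamma> by (intro mult_mono powr_mono2 mult_nonneg_nonneg) (auto simp: M_def)
      finally show ?thesis using dYfar by linarith
    qed
    have 2: "norm (P.dR s t) \<le> M * \<rho> * \<bar>t - s\<bar> powr (2 * \<gamma>)"
    proof (cases "\<bar>t - s\<bar> \<le> h")
      case True
      have "norm (P.dR s t) \<le> M2 * (P.gap s + r) * \<bar>t - s\<bar> powr (2 * \<gamma>)" by (rule loc(2)[OF st True])
      also have "\<dots> \<le> M2 * (B * \<rho>) * \<bar>t - s\<bar> powr (2 * \<gamma>)"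
        using gapB[OF st(1)] M1 by (intro mult_right_mono mult_left_mono) auto
      also have "\<dots> = M2 * B * \<rho> * \<bar>t - s\<bar> powr (2 * \<gamma>)" by simp
      also have "\<dots> \<le> M * \<rho> * \<bar>t - s\<bar> powr (2 * \<gamma>)"
        using M0 B \<rho> by (intro mult_right_mono) (auto simp: M_def)
      finally show ?thesis .
    next
      case False
      have "norm (\<phi> (Y s) (incr X s t) - \<phi>' (Y' s) (incr X' s t)) \<le> 2 * K\<^sup>2 * (P.gap s + r) * \<bar>t - s\<bar> powr \<gamma>"
        by (rule P.field_difference[OF st order_refl])
      also have "\<dots> \<le> 2 * K\<^sup>2 * (B * \<rho>) * D powr \<gamma>"
        using gapB[OF st(1)] D(2)[OF st] \<gamma> B \<rho> pos[of s] by (intro mult_mono mult_left_mono powr_mono2) auto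
      finally have "norm (P.dR s t) \<le> 2 * B * \<rho> + 2 * K\<^sup>2 * (B * \<rho>) * D powr \<gamma>"
        using norm_triangle_ineq4[of "P.dY s t" "\<phi> (Y s) (incr X s t) - \<phi>' (Y' s) (incr X' s t)"] dYfar
        by (simp add: P.dY_eq[of s t])
      also have "\<dots> = (2 * B + 2 * K\<^sup>2 * B * D powr \<gamma>) * \<rho>"
        by (simp add: algebra_simps)
      also have "\<dots> = (2 * B + 2 * K\<^sup>2 * B * D powr \<gamma>) / h powr (2 * \<gamma>) * \<rho> * h powr (2 * \<gamma>)"
        using h by simp
      also have "\<dots> \<le> M * \<rho> * \<bar>t - s\<bar> powr (2 * \<gamma>)"
        using M0 B \<rho> False h \<gamma> by (intro mult_mono powr_mono2 mult_nonneg_nonneg) (auto simp: M_def)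
      finally show ?thesis .
    qed
    have 3: "P.gap t + r \<le> M * \<rho>"
      using gapB[OF st(2)] mult_right_mono[of B M \<rho>] \<rho> M0 by (simp add: M_def)
    show "norm (Y t - Y' t) + r \<le> M * (norm (Y t0 - Y' t0) + r) \<and>
        norm (incr Y s t - incr Y' s t) \<le> M * (norm (Y t0 - Y' t0) + r) * \<bar>t - s\<bar> powr \<gamma> \<and>
        norm ((incr Y s t - \<phi> (Y s) (incr X s t)) - (incr Y' s t - \<phi>' (Y' s) (incr X' s t)))
          \<le> M * (norm (Y t0 - Y' t0) + r) * \<bar>t - s\<bar> powr (2 * \<gamma>)"
      using 1 2 3 by (simp add: \<rho>_def P.gap_def P.dY_def P.dR_def)
  qed
qed

end

section \<open>Existence, uniqueness and continuity of the Ito map\<close>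

lemma fderiv_eqI:
  assumes "(f has_derivative blinfun_apply A) (at x)"
  shows "fderiv f x = A"
  unfolding fderiv_def frechet_derivative_at[OF assms, symmetric] by (rule blinfun_apply_inverse)

lemma has_derivative_fderiv:
  assumes "f differentiable (at x)"
  shows "(f has_derivative blinfun_apply (fderiv f x)) (at x)"
proof -
  have "(f has_derivative frechet_derivative f (at x)) (at x)"
    using assms by (simp add: frechet_derivative_works)
  then show ?thesis
    unfolding fderiv_def by (metis bounded_linear_Blinfun_apply has_derivative_bounded_linear)
qed

lemma norm_le_SUP:
  assumes "bounded (f ` S)" "x \<in> S"
  shows "norm (f x) \<le> (SUP x\<in>S. norm (f x))"
proof -
  obtain B where "\<And>x. x \<in> S \<Longrightarrow> norm (f x) \<le> B" using assms(1) by (auto simp: bounded_iff)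
  then show ?thesis using assms(2) by (intro cSUP_upper bdd_aboveI2)
qed

lemma C2_space_norms:
  fixes f :: "'a::real_normed_vector \<Rightarrow> 'b::real_normed_vector"
  assumes f: "f \<in> C2_space \<delta>"
  shows "C2_bound \<delta> (C2_norm \<delta> f) f" "0 \<le> C2_norm \<delta> f"
proof -
  have f1: "f differentiable (at x)" and f2: "fderiv f differentiable (at x)" for x
    using f by (simp_all add: C2_space_def)
  have b: "bounded (range f)" "bounded (range (fderiv f))" "bounded (range (fderiv (fderiv f)))"
    and bq: "bdd_above (range (space_quot \<delta> (fderiv (fderiv f))))"
    using f by (simp_all add: C2_space_def)
  define a0 a1 a2 a3 where "a0 = (SUP x. norm (f x))" and "a1 = (SUP x. norm (fderiv f x))"
    and "a2 = (SUP x. norm (fderiv (fderiv f) x))" and "a3 = (SUP p. space_quot \<delta> (fderiv (fderiv f)) p)"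
  have N: "C2_norm \<delta> f = a0 + a1 + a2 + a3"
    by (simp add: C2_norm_def a0_def a1_def a2_def a3_def)
  have le: "norm (f x) \<le> a0" "norm (fderiv f x) \<le> a1" "norm (fderiv (fderiv f) x) \<le> a2" for x
    unfolding a0_def a1_def a2_def by (rule norm_le_SUP; use b in simp)+
  have q: "space_quot \<delta> (fderiv (fderiv f)) p \<le> a3" for p
    unfolding a3_def by (intro cSUP_upper bq) simp
  have nn: "0 \<le> a0" "0 \<le> a1" "0 \<le> a2" "0 \<le> a3"
    using order_trans[OF norm_ge_zero le(1)] order_trans[OF norm_ge_zero le(2)]
      order_trans[OF norm_ge_zero le(3)] q[of "(0, 0)"] by (auto simp: space_quot_def)
  have "norm (fderiv (fderiv f) x - fderiv (fderiv f) y) \<le> a3 * norm (x - y) powr \<delta>" for x y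
    using q[of "(x, y)"] by (cases "x = y") (auto simp: space_quot_def field_simps)
  moreover have "a3 * norm (x - y) powr \<delta> \<le> C2_norm \<delta> f * norm (x - y) powr \<delta>" for x y :: 'a
    using nn by (intro mult_right_mono) (auto simp: N)
  ultimately have "norm (fderiv (fderiv f) x - fderiv (fderiv f) y) \<le> C2_norm \<delta> f * norm (x - y) powr \<delta>" for x y
    by (meson order_trans)
  moreover have "norm (f x) \<le> C2_norm \<delta> f" "norm (fderiv f x) \<le> C2_norm \<delta> f"
    "norm (fderiv (fderiv f) x) \<le> C2_norm \<delta> f" for x
    using le[of x] nn by (auto simp: N)
  ultimately show "C2_bound \<delta> (C2_norm \<delta> f) f"
    using has_derivative_fderiv[OF f1] has_derivative_fderiv[OF f2] by (simp add: C2_bound_def)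
  show "0 \<le> C2_norm \<delta> f" using nn by (simp add: N)
qed

lemma bounded_range_diff:
  fixes f g :: "'a \<Rightarrow> 'b::real_normed_vector"
  assumes "bounded (range f)" "bounded (range g)"
  shows "bounded (range (\<lambda>x. f x - g x))"
proof -
  obtain a b where "\<And>x. norm (f x) \<le> a" "\<And>x. norm (g x) \<le> b" using assms by (auto simp: bounded_iff)
  then have "norm (f x - g x) \<le> a + b" for x
    by (intro order_trans[OF norm_triangle_ineq4] add_mono)
  then show ?thesis by (auto simp: bounded_iff)
qed

lemma C2_space_diff:
  fixes f g :: "'a::real_normed_vector \<Rightarrow> 'b::real_normed_vector"
  assumes f: "f \<in> C2_space \<delta>" and g: "g \<in> C2_space \<delta>"
  shows "(\<lambda>x. f x - g x) \<in> C2_space \<delta>" "C2_close (C2_norm \<delta> (\<lambda>x. f x - g x)) f g"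
proof -
  note F = C2_boundD[OF C2_space_norms(1)[OF f]] and G = C2_boundD[OF C2_space_norms(1)[OF g]]
  have d1: "fderiv (\<lambda>x. f x - g x) = (\<lambda>x. fderiv f x - fderiv g x)"
    by (intro ext fderiv_eqI has_derivative_blinfun_diff F G)
  have d2: "fderiv (\<lambda>x. fderiv f x - fderiv g x) = (\<lambda>x. fderiv (fderiv f) x - fderiv (fderiv g) x)"
    by (intro ext fderiv_eqI has_derivative_blinfun_diff F G)
  obtain a b where ab: "\<And>p. space_quot \<delta> (fderiv (fderiv f)) p \<le> a" "\<And>p. space_quot \<delta> (fderiv (fderiv g)) p \<le> b"
    using f g by (auto simp: C2_space_def bdd_above_def)
  have "space_quot \<delta> (\<lambda>x. fderiv (fderiv f) x - fderiv (fderiv g) x) p \<le> a + b" for p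
  proof -
    obtain x y where p: "p = (x, y)" by (cases p)
    have "norm ((fderiv (fderiv f) x - fderiv (fderiv g) x) - (fderiv (fderiv f) y - fderiv (fderiv g) y))
        \<le> norm (fderiv (fderiv f) x - fderiv (fderiv f) y) + norm (fderiv (fderiv g) x - fderiv (fderiv g) y)"
      using norm_triangle_ineq4[of "fderiv (fderiv f) x - fderiv (fderiv f) y" "fderiv (fderiv g) x - fderiv (fderiv g) y"]
      by (simp add: algebra_simps)
    then have "space_quot \<delta> (\<lambda>x. fderiv (fderiv f) x - fderiv (fderiv g) x) p
        \<le> space_quot \<delta> (fderiv (fderiv f)) p + space_quot \<delta> (fderiv (fderiv g)) p"
      by (simp add: p space_quot_def divide_right_mono flip: add_divide_distrib)
    then show ?thesis using ab(1)[of p] ab(2)[of p] by linarith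
  qed
  then show S: "(\<lambda>x. f x - g x) \<in> C2_space \<delta>"
    using f g by (auto simp: C2_space_def d1 d2 intro!: bounded_range_diff bdd_aboveI2)
  show "C2_close (C2_norm \<delta> (\<lambda>x. f x - g x)) f g"
    using C2_boundD(3-5)[OF C2_space_norms(1)[OF S]] by (simp add: C2_close_def d1 d2)
qed

lemma rough_path_imp_bound:
  assumes rp: "rough_path \<gamma> J X XX" and K: "holder_norm \<gamma> J X \<le> K" "two_norm (2 * \<gamma>) J XX \<le> K"
  shows "rough_bound \<gamma> K J X XX"
proof -
  have X: "X \<in> holder_space \<gamma> J" and XX: "XX \<in> Omega_space (2 * \<gamma>) J"
    using rp by (auto simp: rough_path_def)
  have "norm (incr X s t) \<le> K * \<bar>t - s\<bar> powr \<gamma>" "norm (XX s t) \<le> K * \<bar>t - s\<bar> powr (2 * \<gamma>)"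
    if "s \<in> J" "t \<in> J" for s t
    using holder_spaceD(1)[OF X that] Omega_spaceD(1)[OF XX that]
      mult_right_mono[OF K(1), of "\<bar>t - s\<bar> powr \<gamma>"] mult_right_mono[OF K(2), of "\<bar>t - s\<bar> powr (2 * \<gamma>)"]
    by auto
  then show ?thesis using rp by (auto simp: rough_bound_def rough_path_def)
qed

lemma rough_path_norms_nonneg:
  assumes "rough_path \<gamma> J X XX" "J \<noteq> {}"
  shows "0 \<le> holder_norm \<gamma> J X" "0 \<le> two_norm (2 * \<gamma>) J XX"
  using assms by (auto simp: rough_path_def intro: holder_spaceD(2) Omega_spaceD(2))

lemma rde_solution_controlled_norms:
  assumes sol: "rde_solution \<gamma> \<delta> J t0 y \<phi> X XX (Y, Y')" and "J \<noteq> {}"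
  shows "holder_norm \<gamma> J Y \<le> controlled_norm \<gamma> (2 * \<gamma>) J X Y Y'"
    "two_norm (2 * \<gamma>) J (remainder X Y Y') \<le> controlled_norm \<gamma> (2 * \<gamma>) J X Y Y'"
    "0 \<le> controlled_norm \<gamma> (2 * \<gamma>) J X Y Y'"
proof -
  have Y: "Y \<in> holder_space \<gamma> J" and Y': "Y' \<in> holder_space (2 * \<gamma> - \<gamma>) J"
    and R: "remainder X Y Y' \<in> Omega_space (2 * \<gamma>) J"
    using sol by (auto simp: rde_solution_def controlled_def)
  obtain s where "s \<in> J" using assms(2) by auto
  have "0 \<le> sup_norm J Y'"
    using norm_le_SUP[OF holder_spaceD(4)[OF Y'] \<open>s \<in> J\<close>] norm_ge_zero[of "Y' s"]
    unfolding sup_norm_def by linarith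
  then show "holder_norm \<gamma> J Y \<le> controlled_norm \<gamma> (2 * \<gamma>) J X Y Y'"
    "two_norm (2 * \<gamma>) J (remainder X Y Y') \<le> controlled_norm \<gamma> (2 * \<gamma>) J X Y Y'"
    "0 \<le> controlled_norm \<gamma> (2 * \<gamma>) J X Y Y'"
    using holder_spaceD(2)[OF Y assms(2)] holder_spaceD(2)[OF Y' assms(2)] Omega_spaceD(2)[OF R assms(2)]
    unfolding controlled_norm_def by linarith+
qed

context rde_setting
begin

text \<open>The sum of all norms bounds each of them, because none is negative; the two summands \<open>1\<close> in
  \<open>C_X\<close> and \<open>C_Y\<close> make it at least \<open>1\<close>.\<close>

lemma solution_pairI:
  fixes \<phi> \<phi>t :: "'n::finite vfield"
  assumes rp: "rough_path \<gamma> J X XX" "rough_path \<gamma> J Xt XXt" and C2: "\<phi> \<in> C2_space \<delta>" "\<phi>t \<in> C2_space \<delta>"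
    and sol: "rde_solution \<gamma> \<delta> J t0 y \<phi> X XX (Y, Y')" "rde_solution \<gamma> \<delta> J t0 yt \<phi>t Xt XXt (Yt, Yt')"
    and K: "K = C_X \<gamma> J X XX Xt XXt + C_Y \<gamma> J X Xt Y Y' Yt Yt' + C2_norm \<delta> \<phi> + C2_norm \<delta> \<phi>t"
    and r: "0 \<le> r" "C2_close r \<phi> \<phi>t"
      "\<And>s t. s \<in> J \<Longrightarrow> t \<in> J \<Longrightarrow> norm (incr X s t - incr Xt s t) \<le> r * \<bar>t - s\<bar> powr \<gamma>"
      "\<And>s t. s \<in> J \<Longrightarrow> t \<in> J \<Longrightarrow> norm (XX s t - XXt s t) \<le> r * \<bar>t - s\<bar> powr (2 * \<gamma>)"
  shows "1 \<le> K" "solution_pair \<delta> K r \<phi> \<phi>t \<gamma> J X Xt XX XXt Y Yt"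
proof -
  have ne: "J \<noteq> {}" using J by auto
  note nn = rough_path_norms_nonneg[OF rp(1) ne] rough_path_norms_nonneg[OF rp(2) ne]
    rde_solution_controlled_norms[OF sol(1) ne] rde_solution_controlled_norms[OF sol(2) ne]
    C2_space_norms(2)[OF C2(1)] C2_space_norms(2)[OF C2(2)]
  show K1: "1 \<le> K" using nn unfolding K C_X_def C_Y_def by linarith
  have Kge: "holder_norm \<gamma> J X \<le> K" "two_norm (2 * \<gamma>) J XX \<le> K" "holder_norm \<gamma> J Xt \<le> K"
    "two_norm (2 * \<gamma>) J XXt \<le> K" "C2_norm \<delta> \<phi> \<le> K" "C2_norm \<delta> \<phi>t \<le> K"
    "holder_norm \<gamma> J Y \<le> K" "holder_norm \<gamma> J Yt \<le> K" "two_norm (2 * \<gamma>) J (remainder Xt Yt Yt') \<le> K"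
    using nn unfolding K C_X_def C_Y_def by linarith+
  have f: "C2_bound \<delta> K \<phi>" "C2_bound \<delta> K \<phi>t"
    using C2_bound_mono[OF C2_space_norms(1)[OF C2(1)]] C2_bound_mono[OF C2_space_norms(1)[OF C2(2)]] Kge by auto
  have X: "rough_bound \<gamma> K J X XX" "rough_bound \<gamma> K J Xt XXt"
    using rough_path_imp_bound[OF rp(1)] rough_path_imp_bound[OF rp(2)] Kge by auto
  have Y: "Y \<in> holder_space \<gamma> J" "Yt \<in> holder_space \<gamma> J" "remainder Xt Yt Yt' \<in> Omega_space (2 * \<gamma>) J"
    and Yt': "\<And>t. t \<in> J \<Longrightarrow> Yt' t = \<phi>t (Yt t)"
    using sol by (auto simp: rde_solution_def controlled_def)
  have scale: "a * \<bar>t - s\<bar> powr \<alpha> \<le> K * \<bar>t - s\<bar> powr \<alpha>" if "a \<le> K" for a \<alpha> s t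
    using that by (intro mult_right_mono) auto
  show "solution_pair \<delta> K r \<phi> \<phi>t \<gamma> J X Xt XX XXt Y Yt"
  proof
    fix s t assume st: "s \<in> J" "t \<in> J"
    show "norm (incr Y s t) \<le> K * \<bar>t - s\<bar> powr \<gamma>"
      by (rule order_trans[OF holder_spaceD(1)[OF Y(1) st] scale[OF Kge(7)]])
    show "norm (incr Yt s t) \<le> K * \<bar>t - s\<bar> powr \<gamma>"
      by (rule order_trans[OF holder_spaceD(1)[OF Y(2) st] scale[OF Kge(8)]])
    have "norm (remainder Xt Yt Yt' s t) \<le> K * \<bar>t - s\<bar> powr (2 * \<gamma>)"
      by (rule order_trans[OF Omega_spaceD(1)[OF Y(3) st] scale[OF Kge(9)]])
    then show "norm (incr Yt s t - \<phi>t (Yt s) (incr Xt s t)) \<le> K * \<bar>t - s\<bar> powr (2 * \<gamma>)"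
      by (simp add: remainder_def Yt'[OF st(1)])
  next
    show "davie ((2 + \<delta>) * \<gamma>) J \<phi> X XX Y"
      by (rule rde_solution_imp_davie(2)[OF f(1) X(1) rp(1) sol(1)])
    show "davie ((2 + \<delta>) * \<gamma>) J \<phi>t Xt XXt Yt"
      by (rule rde_solution_imp_davie(2)[OF f(2) X(2) rp(2) sol(2)])
  qed (use J \<gamma> \<delta> z K1 r f X in auto)
qed

lemma rde_solution_exists:
  fixes \<phi> :: "'n::finite vfield"
  assumes rp: "rough_path \<gamma> J X XX" and C2: "\<phi> \<in> C2_space \<delta>"
  obtains Y where "rde_solution \<gamma> \<delta> J t0 y \<phi> X XX (Y, \<lambda>t. \<phi> (Y t))"
proof -
  have ne: "J \<noteq> {}" using J by auto
  define K where "K = C2_norm \<delta> \<phi> + holder_norm \<gamma> J X + two_norm (2 * \<gamma>) J XX"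
  note nn = rough_path_norms_nonneg[OF rp ne] C2_space_norms(2)[OF C2]
  have f: "C2_bound \<delta> K \<phi>"
    by (rule C2_bound_mono[OF C2_space_norms(1)[OF C2]]) (use nn in \<open>simp add: K_def\<close>)
  have X: "rough_bound \<gamma> K J X XX"
    by (rule rough_path_imp_bound[OF rp]) (use nn in \<open>simp_all add: K_def\<close>)
  obtain Y where "Y t0 = y" "davie ((2 + \<delta>) * \<gamma>) J \<phi> X XX Y"
    using davie_solution_exists[OF f X] by metis
  then show thesis
    using that davie_imp_rde_solution[OF f X rp] by blast
qed

text \<open>Compare a solution with another one for the same data and initial value: the right-hand side of
  the Lipschitz estimate is zero.\<close>

lemma rde_solution_unique:
  fixes \<phi> :: "'n::finite vfield"
  assumes rp: "rough_path \<gamma> J X XX" and C2: "\<phi> \<in> C2_space \<delta>"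
    and sol: "rde_solution \<gamma> \<delta> J t0 y \<phi> X XX (Y, Y')" "rde_solution \<gamma> \<delta> J t0 y \<phi> X XX (Z, Z')"
    and t: "t \<in> J"
  shows "Z t = Y t \<and> Z' t = Y' t"
proof -
  define K where "K = C_X \<gamma> J X XX X XX + C_Y \<gamma> J X X Y Y' Z Z' + C2_norm \<delta> \<phi> + C2_norm \<delta> \<phi>"
  have K1: "1 \<le> K" and pair: "solution_pair \<delta> K 0 \<phi> \<phi> \<gamma> J X X XX XX Y Z"
    using solution_pairI[OF rp rp C2 C2 sol K_def, of 0] by (auto simp: C2_close_def)
  interpret P: solution_pair \<delta> K 0 \<phi> \<phi> \<gamma> J X X XX XX Y Z by (rule pair)
  have "Y t0 = y" "Z t0 = y"
    using rde_solution_imp_davie(1)[OF P.f P.X rp] sol by auto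
  moreover obtain M where "norm (Y t - Z t) + 0 \<le> M * (norm (Y t0 - Z t0) + 0)"
    using ito_lipschitz[OF K1] pair t by metis
  ultimately have "Z t = Y t" by simp
  moreover have "Y' t = \<phi> (Y t)" "Z' t = \<phi> (Z t)" using sol t by (auto simp: rde_solution_def)
  ultimately show ?thesis by simp
qed

text \<open>The Lipschitz estimate controls \<open>Y\<close> and its remainder. The derivative \<open>Y' = \<phi>(Y)\<close> inherits the
  bound, in Hoelder norm because \<open>double_difference_close\<close> is linear in the distance of \<open>Y\<close> and
  \<open>Y~\<close>. No data have a sum of norms \<open>K\<close> below \<open>1\<close>, so passing to \<open>max 1 K\<close> loses nothing.\<close>

lemma eps_Y_bound: "\<exists>M. \<forall>(y :: real ^ 'n) yt \<phi> \<phi>t X XX Xt XXt Y Y' Yt Yt'.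
      rough_path \<gamma> J X XX \<longrightarrow> rough_path \<gamma> J Xt XXt \<longrightarrow> \<phi> \<in> C2_space \<delta> \<longrightarrow> \<phi>t \<in> C2_space \<delta> \<longrightarrow>
      rde_solution \<gamma> \<delta> J t0 y \<phi> X XX (Y, Y') \<longrightarrow> rde_solution \<gamma> \<delta> J t0 yt \<phi>t Xt XXt (Yt, Yt') \<longrightarrow>
      K = C_X \<gamma> J X XX Xt XXt + C_Y \<gamma> J X Xt Y Y' Yt Yt' + C2_norm \<delta> \<phi> + C2_norm \<delta> \<phi>t \<longrightarrow>
      eps_Y \<gamma> \<delta> J \<phi> \<phi>t X Xt Y Y' Yt Yt'
        \<le> M * (rho \<gamma> J t0 X XX Xt XXt Y Yt + C2_norm \<delta> (\<lambda>x. \<phi> x - \<phi>t x))"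
proof -
  have ne: "J \<noteq> {}" using J by auto
  obtain M where M: "0 \<le> M"
    "\<And>r \<phi> \<phi>' X X' XX XX' Y Y' s t. \<lbrakk>solution_pair \<delta> (max 1 K) r (\<phi> :: 'n::finite vfield) \<phi>' \<gamma> J X X' XX XX' Y Y'; s \<in> J; t \<in> J\<rbrakk>
      \<Longrightarrow> norm (Y t - Y' t) + r \<le> M * (norm (Y t0 - Y' t0) + r) \<and>
        norm (incr Y s t - incr Y' s t) \<le> M * (norm (Y t0 - Y' t0) + r) * \<bar>t - s\<bar> powr \<gamma> \<and>
        norm ((incr Y s t - \<phi> (Y s) (incr X s t)) - (incr Y' s t - \<phi>' (Y' s) (incr X' s t)))
          \<le> M * (norm (Y t0 - Y' t0) + r) * \<bar>t - s\<bar> powr (2 * \<gamma>)"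
    using ito_lipschitz[OF max.cobounded1[of 1 K]] by metis
  have "eps_Y \<gamma> \<delta> J \<phi> \<phi>t X Xt Y Y' Yt Yt'
      \<le> (K * M + (K\<^sup>2 + 2 * K) * M + M + 1) * (rho \<gamma> J t0 X XX Xt XXt Y Yt + C2_norm \<delta> (\<lambda>x. \<phi> x - \<phi>t x))"
    if rp: "rough_path \<gamma> J X XX" "rough_path \<gamma> J Xt XXt" and C2: "\<phi> \<in> C2_space \<delta>" "\<phi>t \<in> C2_space \<delta>"
      and sol: "rde_solution \<gamma> \<delta> J t0 y \<phi> X XX (Y, Y')" "rde_solution \<gamma> \<delta> J t0 yt \<phi>t Xt XXt (Yt, Yt')"
      and K: "K = C_X \<gamma> J X XX Xt XXt + C_Y \<gamma> J X Xt Y Y' Yt Yt' + C2_norm \<delta> \<phi> + C2_norm \<delta> \<phi>t"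
    for y yt and \<phi> \<phi>t :: "'n vfield" and X XX Xt XXt Y Y' Yt Yt'
  proof -
    define r1 r2 r3 where "r1 = holder_norm \<gamma> J (\<lambda>t. X t - Xt t)"
      and "r2 = two_norm (2 * \<gamma>) J (\<lambda>s t. XX s t - XXt s t)" and "r3 = C2_norm \<delta> (\<lambda>x. \<phi> x - \<phi>t x)"
    have X: "X \<in> holder_space \<gamma> J" "Xt \<in> holder_space \<gamma> J"
      and XX: "XX \<in> Omega_space (2 * \<gamma>) J" "XXt \<in> Omega_space (2 * \<gamma>) J"
      using rp by (auto simp: rough_path_def)
    note nX = holder_spaceD(2)[OF X(1) ne] holder_spaceD(2)[OF X(2) ne]
      Omega_spaceD(2)[OF XX(1) ne] Omega_spaceD(2)[OF XX(2) ne]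
    have inc: "incr (\<lambda>t. X t - Xt t) s t = incr X s t - incr Xt s t" for s t by (simp add: incr_def)
    have bX: "bdd_above (two_quot \<gamma> (incr (\<lambda>t. X t - Xt t)) ` (J \<times> J))"
    proof (rule two_norm_le(2)[OF ne, where C = "holder_norm \<gamma> J X + holder_norm \<gamma> J Xt"])
      fix s t assume "s \<in> J" "t \<in> J"
      then show "norm (incr (\<lambda>t. X t - Xt t) s t) \<le> (holder_norm \<gamma> J X + holder_norm \<gamma> J Xt) * \<bar>t - s\<bar> powr \<gamma>"
        unfolding inc distrib_right
        by (intro order_trans[OF norm_triangle_ineq4] add_mono holder_spaceD(1) X)
    qed (use nX in simp)
    have bXX: "bdd_above (two_quot (2 * \<gamma>) (\<lambda>s t. XX s t - XXt s t) ` (J \<times> J))"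
    proof (rule two_norm_le(2)[OF ne, where C = "two_norm (2 * \<gamma>) J XX + two_norm (2 * \<gamma>) J XXt"])
      fix s t assume "s \<in> J" "t \<in> J"
      then show "norm (XX s t - XXt s t) \<le> (two_norm (2 * \<gamma>) J XX + two_norm (2 * \<gamma>) J XXt) * \<bar>t - s\<bar> powr (2 * \<gamma>)"
        unfolding distrib_right
        by (intro order_trans[OF norm_triangle_ineq4] add_mono Omega_spaceD(1) XX)
    qed (use nX in simp)
    have r0: "0 \<le> r1" "0 \<le> r2" "0 \<le> r3"
      using two_norm_nonneg[OF bX ne] two_norm_nonneg[OF bXX ne] C2_space_norms(2)[OF C2_space_diff(1)[OF C2]]
      by (auto simp: r1_def r2_def r3_def holder_norm_def)
    define r where "r = r1 + r2 + r3"
    have le: "a * \<bar>t - s\<bar> powr \<alpha> \<le> r * \<bar>t - s\<bar> powr \<alpha>" if "a \<le> r" for a s t \<alpha>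
      using that by (intro mult_right_mono) auto
    have ri: "0 \<le> r" "r1 \<le> r" "r2 \<le> r" "r3 \<le> r" using r0 by (simp_all add: r_def)
    have close: "C2_close r \<phi> \<phi>t"
      using C2_space_diff(2)[OF C2] ri(4) unfolding r3_def C2_close_def by (meson order_trans)
    have dX: "norm (incr X s t - incr Xt s t) \<le> r * \<bar>t - s\<bar> powr \<gamma>"
      and dXX: "norm (XX s t - XXt s t) \<le> r * \<bar>t - s\<bar> powr (2 * \<gamma>)" if st: "s \<in> J" "t \<in> J" for s t
    proof -
      have "norm (incr X s t - incr Xt s t) \<le> r1 * \<bar>t - s\<bar> powr \<gamma>"
        using two_norm_bound[OF bX st] by (simp add: inc r1_def holder_norm_def) (simp add: incr_def)
      then show "norm (incr X s t - incr Xt s t) \<le> r * \<bar>t - s\<bar> powr \<gamma>"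
        using le[OF ri(2)] order_trans by blast
      have "XX s s - XXt s s = 0" using XX st by (simp add: Omega_space_def)
      then have "norm (XX s t - XXt s t) \<le> r2 * \<bar>t - s\<bar> powr (2 * \<gamma>)"
        using two_norm_bound[OF bXX st] by (simp add: r2_def)
      then show "norm (XX s t - XXt s t) \<le> r * \<bar>t - s\<bar> powr (2 * \<gamma>)"
        using le[OF ri(3)] order_trans by blast
    qed
    note SP = solution_pairI[OF rp C2 sol K ri(1) close dX dXX]
    have K1: "1 \<le> K" by (rule SP(1))
    have pair: "solution_pair \<delta> (max 1 K) r \<phi> \<phi>t \<gamma> J X Xt XX XXt Y Yt"
      using SP(2) K1 by (simp add: max_absorb2)
    interpret P: solution_pair \<delta> K r \<phi> \<phi>t \<gamma> J X Xt XX XXt Y Yt by (rule SP(2))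
    define \<rho> where "\<rho> = norm (Y t0 - Yt t0) + r"
    have \<rho>: "0 \<le> \<rho>" "r3 \<le> \<rho>" "rho \<gamma> J t0 X XX Xt XXt Y Yt + r3 = \<rho>"
      using r0 by (auto simp: \<rho>_def r_def rho_def r1_def r2_def add_nonneg_nonneg)
    define N where "N = M * \<rho>"
    have N: "0 \<le> N" using M(1) \<rho>(1) by (simp add: N_def)
    have K0: "0 \<le> K" using K1 by simp
    have gap: "norm (Y t - Yt t) + r \<le> N" if "t \<in> J" for t
      using M(2)[OF pair that that] by (simp add: N_def \<rho>_def)
    have rN: "r \<le> N" using gap[OF J(3)] norm_ge_zero[of "Y t0 - Yt t0"] by linarith
    have gap': "norm (Y t - Yt t) \<le> N" if "t \<in> J" for t
      using gap[OF that] P.r0 by linarith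
    have Y': "Y' t = \<phi> (Y t)" "Yt' t = \<phi>t (Yt t)" if "t \<in> J" for t
      using sol that by (auto simp: rde_solution_def)
    have "norm (Y' t - Yt' t) \<le> K * N" if "t \<in> J" for t
    proof -
      have "norm (\<phi> (Y t) - \<phi>t (Yt t)) \<le> K * norm (Y t - Yt t) + r"
        by (rule close_values[OF P.D(1,4) P.C(1) order_refl])
      also have "\<dots> \<le> K * (norm (Y t - Yt t) + r)"
        using mult_right_mono[OF K1 P.r0] by (simp add: algebra_simps)
      also have "\<dots> \<le> K * N" using gap[OF that] K0 by (intro mult_left_mono)
      finally show ?thesis by (simp add: Y'[OF that])
    qed
    then have 1: "sup_norm J (\<lambda>t. Y' t - Yt' t) \<le> K * N"
      unfolding sup_norm_def using ne by (intro cSUP_least)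
    have 2: "holder_norm \<gamma> J (\<lambda>t. Y' t - Yt' t) \<le> (K\<^sup>2 + 2 * K) * N"
      unfolding holder_norm_def
    proof (rule two_norm_le(1)[OF ne])
      show "0 \<le> (K\<^sup>2 + 2 * K) * N" using K0 N by simp
      fix s t assume st: "s \<in> J" "t \<in> J"
      define x where "x = \<bar>t - s\<bar> powr \<gamma>"
      have "norm ((\<phi> (Y t) - \<phi> (Y s)) - (\<phi>t (Yt t) - \<phi>t (Yt s))) \<le> (K * (K * x)) * N + K * (N * x) + r * (K * x)"
      proof (rule double_difference_close[OF P.D(1,4) P.D'(1) P.C(2)])
        show "norm (fderiv \<phi> v - fderiv \<phi> u) \<le> K * (K * x)" if "norm (v - u) \<le> K * x" for u v
          using blinfun_derivative_lipschitz[OF P.D(2,5), of v u] mult_left_mono[OF that K0] by linarith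
        show "norm (Y t - Y s) \<le> K * x" "norm (Yt t - Yt s) \<le> K * x"
          using P.YH[OF st] P.YH'[OF st] by (simp_all add: incr_def x_def)
        show "norm (Y s - Yt s) \<le> N" by (rule gap'[OF st(1)])
        show "norm ((Y t - Y s) - (Yt t - Yt s)) \<le> N * x"
          using M(2)[OF pair st] by (simp add: incr_def x_def N_def \<rho>_def)
      qed
      also have "\<dots> \<le> (K * (K * x)) * N + K * (N * x) + N * (K * x)"
        using rN K0 by (intro add_left_mono mult_right_mono) (auto simp: x_def)
      also have "\<dots> = (K\<^sup>2 + 2 * K) * N * x" by algebra
      finally show "norm (incr (\<lambda>t. Y' t - Yt' t) s t) \<le> (K\<^sup>2 + 2 * K) * N * \<bar>t - s\<bar> powr \<gamma>"
        using Y' st by (simp add: incr_def x_def algebra_simps)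
    qed
    have 3: "two_norm (2 * \<gamma>) J (\<lambda>s t. remainder X Y Y' s t - remainder Xt Yt Yt' s t) \<le> N"
    proof (rule two_norm_le(1)[OF ne N])
      fix s t assume st: "s \<in> J" "t \<in> J"
      then show "norm (remainder X Y Y' s t - remainder Xt Yt Yt' s t) \<le> N * \<bar>t - s\<bar> powr (2 * \<gamma>)"
        using M(2)[OF pair st] Y'[OF st(1)] by (simp add: remainder_def N_def \<rho>_def)
    qed
    have "eps_Y \<gamma> \<delta> J \<phi> \<phi>t X Xt Y Y' Yt Yt' \<le> K * N + (K\<^sup>2 + 2 * K) * N + N + \<rho>"
      using 1 2 3 \<rho>(2) unfolding eps_Y_def r3_def by linarith
    also have "\<dots> = (K * M + (K\<^sup>2 + 2 * K) * M + M + 1) * \<rho>" unfolding N_def by algebra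
    finally show ?thesis using \<rho>(3) by (simp add: r3_def)
  qed
  then show ?thesis
    by (intro exI[of _ "K * M + (K\<^sup>2 + 2 * K) * M + M + 1"]) blast
qed

end

theorem proposition8:
  fixes J :: "real set" and t0 \<gamma> \<delta> :: real
  assumes "is_interval J" and "bounded J" and "t0 \<in> J"
    and "\<gamma> > 1 / 3" and "0 < \<delta>" and "\<delta> < 1" and "(2 + \<delta>) * \<gamma> > 1"
  shows
    "(\<forall>(y :: real ^ 'n) \<phi> X XX. rough_path \<gamma> J X XX \<longrightarrow> \<phi> \<in> C2_space \<delta> \<longrightarrow>
        (\<exists>Y Y'. rde_solution \<gamma> \<delta> J t0 y \<phi> X XX (Y, Y') \<and>
          (\<forall>Z Z'. rde_solution \<gamma> \<delta> J t0 y \<phi> X XX (Z, Z') \<longrightarrow>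
            (\<forall>t\<in>J. Z t = Y t \<and> Z' t = Y' t)))) \<and>
     (\<exists>M :: real \<Rightarrow> real \<Rightarrow> real \<Rightarrow> real \<Rightarrow> real.
        \<forall>(y :: real ^ 'n) yt \<phi> \<phi>t X XX Xt XXt Y Y' Yt Yt'.
          rough_path \<gamma> J X XX \<longrightarrow> rough_path \<gamma> J Xt XXt \<longrightarrow>
          \<phi> \<in> C2_space \<delta> \<longrightarrow> \<phi>t \<in> C2_space \<delta> \<longrightarrow>
          (Y, Y') = ito_map \<gamma> \<delta> J t0 y \<phi> X XX \<longrightarrow>
          (Yt, Yt') = ito_map \<gamma> \<delta> J t0 yt \<phi>t Xt XXt \<longrightarrow>
          eps_Y \<gamma> \<delta> J \<phi> \<phi>t X Xt Y Y' Yt Yt'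
            \<le> M (C_X \<gamma> J X XX Xt XXt) (C_Y \<gamma> J X Xt Y Y' Yt Yt') (C2_norm \<delta> \<phi>) (C2_norm \<delta> \<phi>t)
              * (rho \<gamma> J t0 X XX Xt XXt Y Yt + C2_norm \<delta> (\<lambda>x. \<phi> x - \<phi>t x)))"
    (is "?unique \<and> ?lipschitz")
proof
  interpret rde_setting J t0 \<gamma> \<delta>
    by unfold_locales (use assms in auto)
  show ?unique
  proof (intro allI impI)
    fix y :: "real ^ 'n" and \<phi> :: "'n vfield" and X :: "real \<Rightarrow> real ^ 'n" and XX
    assume h: "rough_path \<gamma> J X XX" "\<phi> \<in> C2_space \<delta>"
    obtain Y where "rde_solution \<gamma> \<delta> J t0 y \<phi> X XX (Y, \<lambda>t. \<phi> (Y t))"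
      using rde_solution_exists[OF h] by blast
    then show "\<exists>Y Y'. rde_solution \<gamma> \<delta> J t0 y \<phi> X XX (Y, Y') \<and>
        (\<forall>Z Z'. rde_solution \<gamma> \<delta> J t0 y \<phi> X XX (Z, Z') \<longrightarrow> (\<forall>t\<in>J. Z t = Y t \<and> Z' t = Y' t))"
      using rde_solution_unique[OF h] by blast
  qed
  obtain N where N: "\<And>K (y :: real ^ 'n) yt \<phi> \<phi>t X XX Xt XXt Y Y' Yt Yt'.
      rough_path \<gamma> J X XX \<longrightarrow> rough_path \<gamma> J Xt XXt \<longrightarrow> \<phi> \<in> C2_space \<delta> \<longrightarrow> \<phi>t \<in> C2_space \<delta> \<longrightarrow>
      rde_solution \<gamma> \<delta> J t0 y \<phi> X XX (Y, Y') \<longrightarrow> rde_solution \<gamma> \<delta> J t0 yt \<phi>t Xt XXt (Yt, Yt') \<longrightarrow>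
      K = C_X \<gamma> J X XX Xt XXt + C_Y \<gamma> J X Xt Y Y' Yt Yt' + C2_norm \<delta> \<phi> + C2_norm \<delta> \<phi>t \<longrightarrow>
      eps_Y \<gamma> \<delta> J \<phi> \<phi>t X Xt Y Y' Yt Yt'
        \<le> N K * (rho \<gamma> J t0 X XX Xt XXt Y Yt + C2_norm \<delta> (\<lambda>x. \<phi> x - \<phi>t x))"
    using choice[OF allI[OF eps_Y_bound], of "\<lambda>K. K"] by blast
  have ito: "rde_solution \<gamma> \<delta> J t0 y \<phi> X XX (Y, Y')"
    if "rough_path \<gamma> J X XX" "\<phi> \<in> C2_space \<delta>" "(Y, Y') = ito_map \<gamma> \<delta> J t0 y \<phi> X XX"
    for y :: "real ^ 'n" and \<phi> :: "'n vfield" and X XX Y Y'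
    unfolding that(3) ito_map_def using rde_solution_exists[OF that(1,2)] by (metis someI)
  \<comment> \<open>The solutions in question are those chosen by the Ito map, and the constant depends on the
    norms through their sum.\<close>
  show ?lipschitz
    by (rule exI[of _ "\<lambda>a b c d. N (a + b + c + d)"]) (use N ito in blast)
qed

end
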